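(* Let $(\Omega,\mathcal{F},P)$ be a complete probability space and $B$ a normed space over $K$ with classical conjugate space $B'$. Then $L^{0}(\mathcal{F},B',w^{*})$ is isomorphic with the random conjugate space $(L^{0}(\mathcal{F},B))^{*}$ of $L^{0}(\mathcal{F},B)$ in a random-norm preserving manner under the canonical mapping $T:L^{0}(\mathcal{F},B',w^{*})\to(L^{0}(\mathcal{F},B))^{*}$ defined as follows: for each $f\in L^{0}(\mathcal{F},B',w^{*})$, $T_f:=T(f):L^{0}(\mathcal{F},B)\to L^{0}(\mathcal{F},K)$ is given by $T_f(g)=\langle g,f\rangle$ for all $g\in L^{0}(\mathcal{F},B)$. Further, if $L^{0}(\mathcal{F},B',w^{*})$ is replaced by $L^{0}(\mathcal{F},B')$, then a sufficient and necessary condition for $T:L^{0}(\mathcal{F},B')\to(L^{0}(\mathcal{F},B))^{*}$ to be again an isometric (random-norm preserving) isomorphism is that $B'$ has the Radon–Nikodým property with respect to $(\Omega,\mathcal{F},P)$.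
   Context: $K=\mathbb{R}$ or $\mathbb{C}$; $L^{0}(\mathcal{F},K)$ is the algebra of equivalence classes (under a.s. equality) of $K$-valued $\mathcal{F}$-measurable functions; $L^0(\mathcal F,\mathbb R)$ has a.s. pointwise order, $\wedge$ denotes lattice infimum, and $L^0_+$ is the set of its nonnegative elements. A random normed module over $K$ with base $(\Omega,\mathcal F,P)$ is a left $L^0(\mathcal F,K)$-module $E$ with an $L^0$-norm $\|\cdot\|:E\to L^0_+$, i.e. $\|\xi x\|=|\xi|\|x\|$, $\|x+y\|\le\|x\|+\|y\|$, and $\|x\|=0$ iff $x=\theta$. Its random conjugate space $E^*$ is the $L^0(\mathcal F,K)$-module of module homomorphisms $f:E\to L^0(\mathcal F,K)$ for which there is $\xi\in L^0_+$ with $|f(x)|\le\xi\|x\|$ for all $x\in E$ (equivalently, the continuous ones, for either the $(\varepsilon,\lambda)$- or the locally $L^0$-convex topology), with $L^0$-norm $\|f\|^*=\wedge\{\xi\in L^0_+:|f(x)|\le\xi\|x\|\ \forall x\in E\}$. For a normed space $B$, a $B$-valued $\mathcal F$-random variable is a map $V:\Omega\to B$ that is the pointwise norm limit of a sequence of $\mathcal F$-measurable maps with finite range. $L^0(\mathcal F,B)$ is the set of a.s.-equivalence classes of such maps, a random normed module with the pointwise module operations and $\|x\|=$ the class of $\omega\mapsto\|x^0(\omega)\|$, $x^0$ a representative. $L^0(\mathcal F,B')$ is defined likewise. A map $q:\Omega\to B'$ is a $w^*$-random variable if $\omega\mapsto\langle b,q(\omega)\rangle$ is $\mathcal F$-measurable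 for each $b\in B$, where $\langle\cdot,\cdot\rangle:B\times B'\to K$ is the natural pairing; $q_1,q_2$ are $w^*$-equivalent if $\langle b,q_1\rangle=\langle b,q_2\rangle$ a.s. for each fixed $b\in B$. $L^0(\mathcal F,B',w^* )$ is the $L^0(\mathcal F,K)$-module of $w^*$-equivalence classes, a random normed module with $\|x\|=$ the class of $\operatorname{ess\,sup}\{|\langle b,x^0\rangle|:b\in B,\|b\|\le1\}$, $x^0$ a representative of $x$. For $g\in L^0(\mathcal F,B)$ and $f$ in $L^0(\mathcal F,B',w^* )$ or $L^0(\mathcal F,B')$, $\langle g,f\rangle\in L^0(\mathcal F,K)$ is the class of $\omega\mapsto\langle g^0(\omega),f^0(\omega)\rangle$ for representatives $g^0,f^0$. $B'$ has the Radon–Nikodým property with respect to $(\Omega,\mathcal F,P)$ if every $P$-continuous countably additive vector measure $\mu:\mathcal F\to B'$ of bounded variation is of the form $\mu(A)=\int_A h\,dP$ for some Bochner integrable $h:\Omega\to B'$. *)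

theory Defs
  imports "HOL-Probability.Probability" "HOL-Algebra.Module" "HOL-Algebra.Lattice"
begin

section \<open>Scalars and normed spaces\<close>

text \<open>The scalar field \<open>K\<close>: up to an isometric isomorphism of real algebras, members of this
  class are exactly the reals and the complex numbers.\<close>

class real_or_complex = real_normed_field + euclidean_space +
  assumes real_or_complex:
    "\<exists>\<phi> :: 'a \<Rightarrow> complex.
       (\<forall>x y. \<phi> (x + y) = \<phi> x + \<phi> y) \<and> (\<forall>x y. \<phi> (x * y) = \<phi> x * \<phi> y) \<and>
       (\<forall>r x. \<phi> (r *\<^sub>R x) = r *\<^sub>R \<phi> x) \<and> (\<forall>x. cmod (\<phi> x) = norm x) \<and>
       (range \<phi> = \<real> \<or> range \<phi> = UNIV)"

instance real :: real_or_complex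
  by standard (rule exI[of _ complex_of_real], auto simp: Reals_def scaleR_conv_of_real)

instance complex :: real_or_complex
  by standard (rule exI[of _ id], auto)

text \<open>A normed space over \<open>K\<close>. The type class supplies the norm and the restriction of the scalars
  to the reals, so a normed space over \<open>K\<close> is determined by its multiplication by scalars in \<open>K\<close>.\<close>

locale K_normed_space = vector_space scl
  for scl :: "'k::real_or_complex \<Rightarrow> 'b::real_normed_vector \<Rightarrow> 'b" +
  assumes scl_of_real: "scl (of_real r) x = r *\<^sub>R x"
    and norm_scl: "norm (scl a x) = norm a * norm x"

text \<open>\<open>B'\<close>, as a subspace of the bounded real-linear maps \<open>B \<Rightarrow> K\<close> with the operator norm.\<close>

definition dual_space ::
    "('k::real_or_complex \<Rightarrow> 'b::real_normed_vector \<Rightarrow> 'b) \<Rightarrow> ('b \<Rightarrow>\<^sub>L 'k) set" where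
  "dual_space scl = {f. \<forall>a x. blinfun_apply f (scl a x) = a * blinfun_apply f x}"

definition dual_scl :: "'k::real_or_complex \<Rightarrow> ('b::real_normed_vector \<Rightarrow>\<^sub>L 'k) \<Rightarrow> 'b \<Rightarrow>\<^sub>L 'k" where
  "dual_scl a f = blinfun_mult_right a o\<^sub>L f"

section \<open>Random variables and their equivalence classes\<close>

text \<open>Random variables are total functions whose values outside \<^term>\<open>space M\<close> are irrelevant. Elements
  of the various \<open>L\<^sup>0\<close> spaces are equivalence classes, i.e. sets of functions, and pointwise operations
  are transferred to classes by applying them to all representatives.\<close>

definition ae_rel :: "'w measure \<Rightarrow> ('w \<Rightarrow> 'x) set \<Rightarrow> (('w \<Rightarrow> 'x) \<times> ('w \<Rightarrow> 'x)) set" where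
  "ae_rel M S = {(f, g). f \<in> S \<and> g \<in> S \<and> (AE \<omega> in M. f \<omega> = g \<omega>)}"

definition lift1 :: "(('w \<Rightarrow> 'z) \<times> ('w \<Rightarrow> 'z)) set \<Rightarrow> ('x \<Rightarrow> 'z) \<Rightarrow> ('w \<Rightarrow> 'x) set \<Rightarrow> ('w \<Rightarrow> 'z) set" where
  "lift1 R op X = (\<Union>x\<in>X. R `` {\<lambda>\<omega>. op (x \<omega>)})"

definition lift2 :: "(('w \<Rightarrow> 'z) \<times> ('w \<Rightarrow> 'z)) set \<Rightarrow> ('x \<Rightarrow> 'y \<Rightarrow> 'z) \<Rightarrow>
    ('w \<Rightarrow> 'x) set \<Rightarrow> ('w \<Rightarrow> 'y) set \<Rightarrow> ('w \<Rightarrow> 'z) set" where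
  "lift2 R op X Y = (\<Union>x\<in>X. \<Union>y\<in>Y. R `` {\<lambda>\<omega>. op (x \<omega>) (y \<omega>)})"

abbreviation L0_rel :: "'w measure \<Rightarrow> (('w \<Rightarrow> 'k) \<times> ('w \<Rightarrow> 'k::real_normed_field)) set" where
  "L0_rel M \<equiv> ae_rel M (borel_measurable M)"

definition L0_ring :: "'w measure \<Rightarrow> ('w \<Rightarrow> 'k::real_normed_field) set ring" where
  "L0_ring M =
    \<lparr>carrier = borel_measurable M // L0_rel M,
     mult = lift2 (L0_rel M) (*),
     one = L0_rel M `` {\<lambda>_. 1},
     zero = L0_rel M `` {\<lambda>_. 0},
     add = lift2 (L0_rel M) (+)\<rparr>"

definition L0_order :: "'w measure \<Rightarrow> ('w \<Rightarrow> real) set gorder" where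
  "L0_order M =
    \<lparr>carrier = borel_measurable M // L0_rel M,
     eq = (=),
     le = (\<lambda>X Y. \<exists>x\<in>X. \<exists>y\<in>Y. AE \<omega> in M. x \<omega> \<le> y \<omega>)\<rparr>"

definition L0_nonneg :: "'w measure \<Rightarrow> ('w \<Rightarrow> real) set set" where
  "L0_nonneg M = {\<xi> \<in> carrier (L0_order M). \<zero>\<^bsub>L0_ring M\<^esub> \<sqsubseteq>\<^bsub>L0_order M\<^esub> \<xi>}"

definition L0_abs :: "'w measure \<Rightarrow> ('w \<Rightarrow> 'k::real_normed_field) set \<Rightarrow> ('w \<Rightarrow> real) set" where
  "L0_abs M = lift1 (L0_rel M) norm"

section \<open>Random normed modules and random conjugate spaces\<close>

text \<open>The fields \<open>mult\<close> and \<open>one\<close> that module records inherit from ring records are never used.\<close>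

record ('w, 'k, 'e) rn_module = "(('w \<Rightarrow> 'k) set, 'e) module" +
  rnorm :: "'e \<Rightarrow> ('w \<Rightarrow> real) set"

definition random_normed_module ::
    "'w measure \<Rightarrow> ('w, 'k::real_or_complex, 'e) rn_module \<Rightarrow> bool" where
  "random_normed_module M E \<longleftrightarrow>
    Module.module (L0_ring M) E \<and>
    rnorm E \<in> carrier E \<rightarrow> L0_nonneg M \<and>
    (\<forall>\<xi>\<in>carrier (L0_ring M). \<forall>x\<in>carrier E.
      rnorm E (\<xi> \<odot>\<^bsub>E\<^esub> x) = L0_abs M \<xi> \<otimes>\<^bsub>L0_ring M\<^esub> rnorm E x) \<and>
    (\<forall>x\<in>carrier E. \<forall>y\<in>carrier E.
      rnorm E (x \<oplus>\<^bsub>E\<^esub> y) \<sqsubseteq>\<^bsub>L0_order M\<^esub> rnorm E x \<oplus>\<^bsub>L0_ring M\<^esub> rnorm E y) \<and>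
    (\<forall>x\<in>carrier E. rnorm E x = \<zero>\<^bsub>L0_ring M\<^esub> \<longleftrightarrow> x = \<zero>\<^bsub>E\<^esub>)"

definition dual_bounds ::
    "'w measure \<Rightarrow> ('w, 'k::real_or_complex, 'e) rn_module \<Rightarrow> ('e \<Rightarrow> ('w \<Rightarrow> 'k) set) \<Rightarrow>
     ('w \<Rightarrow> real) set set" where
  "dual_bounds M E f =
    {\<xi> \<in> L0_nonneg M. \<forall>x\<in>carrier E.
       L0_abs M (f x) \<sqsubseteq>\<^bsub>L0_order M\<^esub> \<xi> \<otimes>\<^bsub>L0_ring M\<^esub> rnorm E x}"

text \<open>Homomorphisms are extensional functions on \<^term>\<open>carrier E\<close>, so that equality of functions is
  equality on the module.\<close>

definition random_conjugate ::
    "'w measure \<Rightarrow> ('w, 'k::real_or_complex, 'e) rn_module \<Rightarrow>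
     ('w, 'k, 'e \<Rightarrow> ('w \<Rightarrow> 'k) set) rn_module" where
  "random_conjugate M E =
    \<lparr>carrier = {f \<in> carrier E \<rightarrow>\<^sub>E carrier (L0_ring M).
       (\<forall>x\<in>carrier E. \<forall>y\<in>carrier E. f (x \<oplus>\<^bsub>E\<^esub> y) = f x \<oplus>\<^bsub>L0_ring M\<^esub> f y) \<and>
       (\<forall>\<xi>\<in>carrier (L0_ring M). \<forall>x\<in>carrier E. f (\<xi> \<odot>\<^bsub>E\<^esub> x) = \<xi> \<otimes>\<^bsub>L0_ring M\<^esub> f x) \<and>
       dual_bounds M E f \<noteq> {}},
     mult = undefined, one = undefined,
     zero = (\<lambda>x\<in>carrier E. \<zero>\<^bsub>L0_ring M\<^esub>),
     add = (\<lambda>f g. \<lambda>x\<in>carrier E. f x \<oplus>\<^bsub>L0_ring M\<^esub> g x),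
     smult = (\<lambda>\<xi> f. \<lambda>x\<in>carrier E. \<xi> \<otimes>\<^bsub>L0_ring M\<^esub> f x),
     rnorm = (\<lambda>f. \<Sqinter>\<^bsub>L0_order M\<^esub> (dual_bounds M E f))\<rparr>"

definition rn_isomorphism ::
    "'w measure \<Rightarrow> ('w, 'k::real_or_complex, 'e) rn_module \<Rightarrow> ('w, 'k, 'f) rn_module \<Rightarrow>
     ('e \<Rightarrow> 'f) \<Rightarrow> bool" where
  "rn_isomorphism M E F T \<longleftrightarrow>
    random_normed_module M E \<and> random_normed_module M F \<and>
    bij_betw T (carrier E) (carrier F) \<and>
    (\<forall>x\<in>carrier E. \<forall>y\<in>carrier E. T (x \<oplus>\<^bsub>E\<^esub> y) = T x \<oplus>\<^bsub>F\<^esub> T y) \<and>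
    (\<forall>\<xi>\<in>carrier (L0_ring M). \<forall>x\<in>carrier E. T (\<xi> \<odot>\<^bsub>E\<^esub> x) = \<xi> \<odot>\<^bsub>F\<^esub> T x) \<and>
    (\<forall>x\<in>carrier E. rnorm F (T x) = rnorm E x)"

section \<open>Spaces of vector-valued random variables\<close>

text \<open>\<open>V\<close>-valued random variables, for a linear subspace \<open>V\<close> of a normed space.\<close>

definition random_variables :: "'w measure \<Rightarrow> 'x::real_normed_vector set \<Rightarrow> ('w \<Rightarrow> 'x) set" where
  "random_variables M V =
    {f \<in> space M \<rightarrow> V. \<exists>s. (\<forall>n::nat. simple_function M (s n) \<and> s n \<in> space M \<rightarrow> V) \<and>
       (\<forall>\<omega>\<in>space M. (\<lambda>n. s n \<omega>) \<longlonglongrightarrow> f \<omega>)}"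

definition L0_space ::
    "'w measure \<Rightarrow> ('k::real_or_complex \<Rightarrow> 'x \<Rightarrow> 'x) \<Rightarrow> 'x::real_normed_vector set \<Rightarrow>
     ('w, 'k, ('w \<Rightarrow> 'x) set) rn_module" where
  "L0_space M scl V =
    (let R = ae_rel M (random_variables M V) in
     \<lparr>carrier = random_variables M V // R,
      mult = undefined, one = undefined,
      zero = R `` {\<lambda>_. 0},
      add = lift2 R (+),
      smult = lift2 R scl,
      rnorm = lift1 (L0_rel M) norm\<rparr>)"

definition wstar_random_variables ::
    "'w measure \<Rightarrow> ('k::real_or_complex \<Rightarrow> 'b::real_normed_vector \<Rightarrow> 'b) \<Rightarrow>
     ('w \<Rightarrow> 'b \<Rightarrow>\<^sub>L 'k) set" where
  "wstar_random_variables M scl =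
    {q \<in> space M \<rightarrow> dual_space scl. \<forall>b. (\<lambda>\<omega>. blinfun_apply (q \<omega>) b) \<in> borel_measurable M}"

definition wstar_rel ::
    "'w measure \<Rightarrow> ('k::real_or_complex \<Rightarrow> 'b::real_normed_vector \<Rightarrow> 'b) \<Rightarrow>
     (('w \<Rightarrow> 'b \<Rightarrow>\<^sub>L 'k) \<times> ('w \<Rightarrow> 'b \<Rightarrow>\<^sub>L 'k)) set" where
  "wstar_rel M scl =
    {(p, q). p \<in> wstar_random_variables M scl \<and> q \<in> wstar_random_variables M scl \<and>
       (\<forall>b. AE \<omega> in M. blinfun_apply (p \<omega>) b = blinfun_apply (q \<omega>) b)}"

text \<open>The essential supremum of a family of random variables is the supremum of their classes in the
  lattice \<open>L\<^sup>0(\<F>, \<real>)\<close>; it does not depend on the representative \<open>q\<close>.\<close>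

definition L0_wstar ::
    "'w measure \<Rightarrow> ('k::real_or_complex \<Rightarrow> 'b::real_normed_vector \<Rightarrow> 'b) \<Rightarrow>
     ('w, 'k, ('w \<Rightarrow> 'b \<Rightarrow>\<^sub>L 'k) set) rn_module" where
  "L0_wstar M scl =
    (let R = wstar_rel M scl in
     \<lparr>carrier = wstar_random_variables M scl // R,
      mult = undefined, one = undefined,
      zero = R `` {\<lambda>_. 0},
      add = lift2 R (+),
      smult = lift2 R dual_scl,
      rnorm = (\<lambda>f. \<Union>q\<in>f. \<Squnion>\<^bsub>L0_order M\<^esub>
        ((\<lambda>b. L0_rel M `` {\<lambda>\<omega>. norm (blinfun_apply (q \<omega>) b)}) ` {b. norm b \<le> 1}))\<rparr>)"

definition L0_pairing ::
    "'w measure \<Rightarrow> ('w \<Rightarrow> 'b::real_normed_vector) set \<Rightarrow> ('w \<Rightarrow> 'b \<Rightarrow>\<^sub>L 'k) set \<Rightarrow>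
     ('w \<Rightarrow> 'k::real_or_complex) set" where
  "L0_pairing M = lift2 (L0_rel M) (\<lambda>b b'. blinfun_apply b' b)"

definition canonical_map ::
    "'w measure \<Rightarrow> ('k::real_or_complex \<Rightarrow> 'b::real_normed_vector \<Rightarrow> 'b) \<Rightarrow>
     ('w \<Rightarrow> 'b \<Rightarrow>\<^sub>L 'k) set \<Rightarrow> ('w \<Rightarrow> 'b) set \<Rightarrow> ('w \<Rightarrow> 'k) set" where
  "canonical_map M scl f = (\<lambda>g\<in>carrier (L0_space M scl UNIV). L0_pairing M g f)"

section \<open>The Radon--Nikodym property\<close>

text \<open>The Bochner integral of the library requires a second countable type, hence this definition. The
  simple functions may leave the subspace \<open>V\<close> in which \<open>h\<close> takes its values, which changes neither
  integrability nor the integral when \<open>V\<close> is closed.\<close>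

definition has_vector_integral ::
    "'w measure \<Rightarrow> ('w \<Rightarrow> 'x) \<Rightarrow> 'x::real_normed_vector \<Rightarrow> bool" where
  "has_vector_integral M h x \<longleftrightarrow>
    h \<in> random_variables M UNIV \<and>
    (\<exists>s. (\<forall>n::nat. Bochner_Integration.simple_bochner_integrable M (s n)) \<and>
       (\<lambda>n. \<integral>\<^sup>+\<omega>. norm (h \<omega> - s n \<omega>) \<partial>M) \<longlonglongrightarrow> 0 \<and>
       (\<lambda>n. Bochner_Integration.simple_bochner_integral M (s n)) \<longlonglongrightarrow> x)"

definition countably_additive_vm :: "'w measure \<Rightarrow> ('w set \<Rightarrow> 'x::real_normed_vector) \<Rightarrow> bool" where
  "countably_additive_vm M \<mu> \<longleftrightarrow>
    (\<forall>A :: nat \<Rightarrow> 'w set. range A \<subseteq> sets M \<longrightarrow> disjoint_family A \<longrightarrow>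
       (\<lambda>n. \<mu> (A n)) sums \<mu> (\<Union>n. A n))"

text \<open>For countably additive measures this is equivalent to vanishing on null sets.\<close>

definition continuous_vm :: "'w measure \<Rightarrow> ('w set \<Rightarrow> 'x::real_normed_vector) \<Rightarrow> bool" where
  "continuous_vm M \<mu> \<longleftrightarrow>
    (\<forall>\<epsilon>>0. \<exists>\<delta>>0. \<forall>A\<in>sets M. measure M A < \<delta> \<longrightarrow> norm (\<mu> A) < \<epsilon>)"

definition bounded_variation_vm :: "'w measure \<Rightarrow> ('w set \<Rightarrow> 'x::real_normed_vector) \<Rightarrow> bool" where
  "bounded_variation_vm M \<mu> \<longleftrightarrow>
    (\<exists>C. \<forall>\<pi>. finite \<pi> \<longrightarrow> \<pi> \<subseteq> sets M \<longrightarrow> partition_on (space M) \<pi> \<longrightarrow> (\<Sum>A\<in>\<pi>. norm (\<mu> A)) \<le> C)"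

definition radon_nikodym_property :: "'w measure \<Rightarrow> 'x::real_normed_vector set \<Rightarrow> bool" where
  "radon_nikodym_property M V \<longleftrightarrow>
    (\<forall>\<mu>. \<mu> \<in> sets M \<rightarrow> V \<longrightarrow> countably_additive_vm M \<mu> \<longrightarrow> continuous_vm M \<mu> \<longrightarrow>
       bounded_variation_vm M \<mu> \<longrightarrow>
       (\<exists>h \<in> space M \<rightarrow> V. \<forall>A\<in>sets M.
          has_vector_integral M (\<lambda>\<omega>. indicator A \<omega> *\<^sub>R h \<omega>) (\<mu> A)))"

end

theory Submission
  imports Defs
begin

text \<open>
  Surjectivity of the canonical map rests on the lifting theorem: a complete probability space has a
  linear positive lifting \<open>\<rho>\<close> of the essentially bounded functions. It is built by Zorn's lemma on
  sub-\<open>\<sigma>\<close>-algebras; an increasing sequence of partial liftings is extended by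
  \<open>\<rho> f = lim\<^sub>U \<rho>\<^sub>n (E[f | F\<^sub>n])\<close> along a filter \<open>U\<close> on the naturals, where martingale convergence gives
  \<open>\<rho> f = f\<close> a.e. If \<open>F\<close> is in the random conjugate space with bound \<open>\<xi>\<close>, then
  \<open>q(\<omega>)(b) = (1 + \<xi>(\<omega>)) \<rho>(F(b) / (1 + \<xi>))(\<omega>)\<close> is linear and bounded in \<open>b\<close> for every \<open>\<omega>\<close> and
  represents \<open>F\<close> on constants, hence everywhere by approximation.

  On \<open>L\<^sup>0(\<F>, B')\<close> the canonical map factors through the isometric embedding into
  \<open>L\<^sup>0(\<F>, B', w\<^sup>*)\<close>, so it is an isomorphism iff every \<open>w\<^sup>*\<close>-random variable has a strongly measurable
  version. Given the Radon--Nikodym property, such a version of \<open>q\<close> is obtained from the density of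
  \<open>A \<mapsto> \<integral>\<^sub>A q / (1 + \<parallel>q\<parallel>) dP\<close>. Conversely, the scalar densities of \<open>A \<mapsto> \<mu>(A)(b)\<close> are dominated by the
  density of the variation of \<open>\<mu>\<close> and assemble, again by the lifting, to a \<open>w\<^sup>*\<close>-random variable whose
  strongly measurable version is a density of \<open>\<mu>\<close>.
\<close>

section \<open>Convergence of conditional expectations\<close>

text \<open>The obstacle is that \<open>B\<close> need not be separable. Additivity, homogeneity and
  the bound of \<open>b \<mapsto> F(b)\<close> hold off null sets that depend on \<open>b\<close>,
  and uncountably many of these cannot be united. A lifting turns each a.e. relation into one valid
  at every point. It acts on essentially bounded functions, hence the divisor
  \<open>1 + \<xi>\<close>, which makes the quotient bounded by the norm of \<open>b\<close>.
  Completeness of \<open>P\<close> enters because lifted functions are only known to agree a.e. with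
  measurable ones. Inside the construction of the lifting, the union of an increasing sequence of
  \<sigma>-algebras is in general no \<sigma>-algebra, so functions measurable for the generated one
  must be reached as limits. Martingale convergence is silent on a null set; a filter along which
  all bounded sequences converge supplies values there too, and does so linearly. Strongly
  measurable variables, in contrast, are governed by the countably many values of their simple
  approximations, so null sets can be united. This gives uniqueness and the isometry on the strong
  space.\<close>

lemma (in prob_space) sigma_finite_subalgebraI:
  assumes "subalgebra M F"
  shows "sigma_finite_subalgebra M F"
  using assms finite_measure_axioms finite_measure_subalgebra_is_sigma_finite
    finite_measure_subalgebra.intro finite_measure_subalgebra_axioms.intro by blast

text \<open>Dominated convergence: by disjointness each partial sum is \<open>f\<close> cut down to
  a finite union, so \<open>f\<close> on the whole union dominates.\<close>

lemma set_integral_sums: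
  fixes f :: "'w \<Rightarrow> 'x::{banach, second_countable_topology}"
  assumes A: "\<And>n::nat. A n \<in> sets M" "disjoint_family A" and f: "set_integrable M (\<Union>n. A n) f"
  shows "(\<lambda>n. \<integral>x\<in>A n. f x \<partial>M) sums (\<integral>x\<in>(\<Union>n. A n). f x \<partial>M)"
proof -
  have i: "integrable M (\<lambda>x. indicat_real (A n) x *\<^sub>R f x)" for n
    using set_integrable_subset[OF f, of "A n"] A(1) by (auto simp: set_integrable_def)
  have "(\<lambda>n. \<integral>x. (\<Sum>i<n. indicat_real (A i) x *\<^sub>R f x) \<partial>M) \<longlonglongrightarrow>
      (\<integral>x. indicator (\<Union>n. A n) x *\<^sub>R f x \<partial>M)"
  proof (rule integral_dominated_convergence[where w = "\<lambda>x. norm (indicat_real (\<Union>n. A n) x *\<^sub>R f x)"])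
    show "integrable M (\<lambda>x. norm (indicat_real (\<Union>n. A n) x *\<^sub>R f x))"
      using f unfolding set_integrable_def by (rule integrable_norm)
    show "AE x in M. (\<lambda>n. \<Sum>i<n. indicat_real (A i) x *\<^sub>R f x) \<longlonglongrightarrow>
        indicator (\<Union>n. A n) x *\<^sub>R f x"
    proof (rule AE_I2)
      fix x
      have "(\<lambda>i. indicat_real (A i) x *\<^sub>R f x) sums (indicator (\<Union>n. A n) x *\<^sub>R f x)"
        using A(2) by (intro sums_scaleR_left indicator_sums) (auto simp: disjoint_family_on_def)
      then show "(\<lambda>n. \<Sum>i<n. indicat_real (A i) x *\<^sub>R f x) \<longlonglongrightarrow>
          indicator (\<Union>n. A n) x *\<^sub>R f x" by (simp only: sums_def)
    qed
    show "AE x in M. norm (\<Sum>i<n. indicat_real (A i) x *\<^sub>R f x) \<le>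
        norm (indicat_real (\<Union>n. A n) x *\<^sub>R f x)" for n
    proof (rule AE_I2)
      fix x
      have "(\<Sum>i<n. indicat_real (A i) x *\<^sub>R f x) = indicat_real (\<Union>i\<in>{..<n}. A i) x *\<^sub>R f x"
        using A(2) by (subst indicator_UN_disjoint)
          (auto simp: disjoint_family_on_def scaleR_left.sum)
      then show "norm (\<Sum>i<n. indicat_real (A i) x *\<^sub>R f x) \<le> norm (indicat_real (\<Union>n. A n) x *\<^sub>R f x)"
        by (auto simp: indicator_def)
    qed
    show "(\<lambda>x. indicator (\<Union>n. A n) x *\<^sub>R f x) \<in> borel_measurable M"
      using f unfolding set_integrable_def by (rule borel_measurable_integrable)
    show "(\<lambda>x. \<Sum>i<n. indicat_real (A i) x *\<^sub>R f x) \<in> borel_measurable M" for n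
      by (rule borel_measurable_sum) (rule borel_measurable_integrable[OF i])
  qed
  moreover have "(\<integral>x. (\<Sum>i<n. indicat_real (A i) x *\<^sub>R f x) \<partial>M) = (\<Sum>i<n. \<integral>x\<in>A i. f x \<partial>M)" for n
    unfolding set_lebesgue_integral_def by (rule Bochner_Integration.integral_sum) (rule i)
  ultimately show ?thesis by (simp only: sums_def set_lebesgue_integral_def)
qed

locale subalgebra_filtration = prob_space M for M :: "'w measure" +
  fixes F :: "nat \<Rightarrow> 'w measure"
  assumes subalg: "subalgebra M (F n)"
    and sets_mono: "m \<le> n \<Longrightarrow> sets (F m) \<subseteq> sets (F n)"
begin

text \<open>The terminal \<sigma>-algebra of the filtration; the union itself is in general only an
  algebra.\<close>

definition G :: "'w measure" where "G = sigma (space M) (\<Union>n. sets (F n))"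

lemma space_F [simp]: "space (F n) = space M"
  using subalg[of n] by (simp add: subalgebra_def)

lemma sets_F_sub: "sets (F n) \<subseteq> sets M"
  using subalg[of n] by (simp add: subalgebra_def)

lemma union_sub_Pow: "(\<Union>n. sets (F n)) \<subseteq> Pow (space M)"
  using sets_F_sub sets.space_closed by blast

lemma space_G [simp]: "space G = space M"
  unfolding G_def by (rule space_measure_of[OF union_sub_Pow])

lemma sets_G: "sets G = sigma_sets (space M) (\<Union>n. sets (F n))"
  unfolding G_def by (rule sets_measure_of[OF union_sub_Pow])

lemma subalg_G: "subalgebra M G"
  unfolding subalgebra_def sets_G using sets_F_sub by (auto intro!: sets.sigma_sets_subset)

lemma sigma_finite_F: "sigma_finite_subalgebra M (F n)"
  by (rule sigma_finite_subalgebraI[OF subalg])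

lemma F_measurable_mono:
  assumes "f \<in> borel_measurable (F m)" "m \<le> n"
  shows "f \<in> borel_measurable (F n)"
  using assms sets_mono[OF assms(2)] unfolding measurable_def by auto

text \<open>Split the event according to the first index at which the threshold is exceeded.\<close>

lemma maximal_inequality:
  fixes g :: "'w \<Rightarrow> real"
  assumes g: "integrable M g" and g0: "AE x in M. 0 \<le> g x" and e: "0 < e"
  shows "e * measure M {x \<in> space M. \<exists>n. real_cond_exp M (F n) g x > e} \<le> (\<integral>x. g x \<partial>M)"
proof -
  define D where "D n = {x \<in> space M. real_cond_exp M (F n) g x > e}" for n
  have DF: "D n \<in> sets (F n)" for n
  proof -
    have "{x \<in> space (F n). real_cond_exp M (F n) g x > e} \<in> sets (F n)" by measurable
    then show ?thesis by (simp add: D_def)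
  qed
  \<comment> \<open>First-exceedance events stay adapted: \<open>disjointed D n\<close> involves
    only events with index at most \<open>n\<close>.\<close>
  have dF: "disjointed D n \<in> sets (F n)" for n
  proof -
    have "(\<Union>i\<in>{0..<n}. D i) \<in> sets (F n)"
      using DF sets_mono[OF less_imp_le] by (intro sets.finite_UN) fastforce+
    then show ?thesis using DF unfolding disjointed_def by auto
  qed
  have dM: "disjointed D n \<in> sets M" for n using dF sets_F_sub by blast
  have gm [measurable]: "g \<in> borel_measurable M" using g by auto
  have each: "e * measure M (disjointed D n) \<le> (\<integral>x\<in>disjointed D n. g x \<partial>M)" for n
  proof -
    interpret S: sigma_finite_subalgebra M "F n" by (rule sigma_finite_F)
    have i: "integrable M (real_cond_exp M (F n) g)" using S.real_cond_exp_int g by blast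
    have "e * measure M (disjointed D n) = (\<integral>x\<in>disjointed D n. e \<partial>M)"
      using dM by (simp add: set_lebesgue_integral_def)
    also have "\<dots> \<le> (\<integral>x\<in>disjointed D n. real_cond_exp M (F n) g x \<partial>M)"
    proof (rule set_integral_mono)
      show "set_integrable M (disjointed D n) (\<lambda>x. e)"
        using dM by (auto simp: set_integrable_def integrable_indicator_iff less_top[symmetric])
      show "set_integrable M (disjointed D n) (real_cond_exp M (F n) g)"
        unfolding set_integrable_def using i dM by (rule integrable_mult_indicator[rotated])
      show "x \<in> disjointed D n \<Longrightarrow> e \<le> real_cond_exp M (F n) g x" for x
        using disjointed_subset[of D n] by (auto simp: D_def)
    qed
    \<comment> \<open>The event belongs to \<open>F n\<close>, so integration over it does not
      distinguish \<open>g\<close> from its conditional expectation.\<close>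
    also have "\<dots> = (\<integral>x\<in>disjointed D n. g x \<partial>M)"
      using S.real_cond_exp_intA[OF g dF] by simp
    finally show ?thesis .
  qed
  have eqU: "{x \<in> space M. \<exists>n. real_cond_exp M (F n) g x > e} = (\<Union>n. disjointed D n)"
    unfolding UN_disjointed_eq by (auto simp: D_def)
  have si: "set_integrable M (\<Union>n. disjointed D n) g"
    unfolding set_integrable_def using g dM by (intro integrable_mult_indicator) auto
  have s1: "(\<lambda>n. \<integral>x\<in>disjointed D n. g x \<partial>M) sums (\<integral>x\<in>(\<Union>n. disjointed D n). g x \<partial>M)"
    using set_integral_sums[OF dM disjoint_family_disjointed si] .
  have s2: "(\<lambda>n. measure M (disjointed D n)) sums measure M (\<Union>n. disjointed D n)"
    using dM disjoint_family_disjointed[of D] by (intro finite_measure_UNION) auto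
  have "e * measure M (\<Union>n. disjointed D n) \<le> (\<integral>x\<in>(\<Union>n. disjointed D n). g x \<partial>M)"
    by (rule sums_le[OF each sums_mult[OF s2] s1])
  also have "\<dots> \<le> (\<integral>x. g x \<partial>M)"
    unfolding set_lebesgue_integral_def
    by (rule integral_mono_AE)
       (use g0 g si in \<open>auto simp: set_integrable_def indicator_def elim!: eventually_mono\<close>)
  finally show ?thesis unfolding eqU .
qed

text \<open>The sets approximable in measure from the union of the \<open>F m\<close> form a
  \<sigma>-algebra: complements keep the symmetric difference, and a countable union is cut off at a
  finite stage by continuity of the measure.\<close>

lemma sets_approx:
  assumes "A \<in> sets G" "0 < e"
  shows "\<exists>m. \<exists>B\<in>sets (F m). measure M ((A - B) \<union> (B - A)) < e"
  using assms(1)[unfolded sets_G] assms(2)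
proof (induction arbitrary: e rule: sigma_sets.induct)
  case (Basic a)
  then obtain m where "a \<in> sets (F m)" by auto
  then show ?case using Basic.prems by (intro exI[of _ m] bexI[of _ a]) auto
next
  case Empty
  then show ?case by (intro exI[of _ 0] bexI[of _ "{}"]) auto
next
  case (Compl a)
  have aM: "a \<subseteq> space M"
    using Compl.hyps sigma_sets_into_sp[OF union_sub_Pow] by blast
  obtain m B where B: "B \<in> sets (F m)" "measure M ((a - B) \<union> (B - a)) < e"
    using Compl.IH[OF Compl.prems] by blast
  have BM: "B \<subseteq> space M" using B(1) sets.sets_into_space by fastforce
  have "(space M - a - (space M - B)) \<union> (space M - B - (space M - a)) = (a - B) \<union> (B - a)"
    using aM BM by blast
  moreover have "space M - B \<in> sets (F m)" using B(1) sets.compl_sets[of B "F m"] by simp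
  ultimately show ?case using B(2) by (intro exI[of _ m] bexI[of _ "space M - B"]) auto
next
  case (Union a)
  have aG: "a i \<in> sets M" for i
    using Union.hyps[of i] subalg_G unfolding subalgebra_def sets_G by blast
  have "(\<lambda>n. measure M ((\<Union>i. a i) - (\<Union>i\<in>{..<n}. a i))) \<longlonglongrightarrow>
      measure M (\<Inter>n. (\<Union>i. a i) - (\<Union>i\<in>{..<n}. a i))"
    using aG by (intro finite_Lim_measure_decseq) (auto simp: decseq_def)
  also have "(\<Inter>n. (\<Union>i. a i) - (\<Union>i\<in>{..<n}. a i)) = {}" by blast
  finally have lim: "(\<lambda>n. measure M ((\<Union>i. a i) - (\<Union>i\<in>{..<n}. a i))) \<longlonglongrightarrow> 0" by simp
  have "eventually (\<lambda>n. measure M ((\<Union>i. a i) - (\<Union>i\<in>{..<n}. a i)) < e / 2) sequentially"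
    using order_tendstoD(2)[OF lim, of "e/2"] Union.prems by simp
  then obtain n where n: "measure M ((\<Union>i. a i) - (\<Union>i\<in>{..<n}. a i)) < e / 2"
    by (auto simp: eventually_sequentially)
  \<comment> \<open>Half of \<open>e\<close> is spent on the tail of the union, the other half is
    shared by \<open>n\<close> sets; the summand 1 keeps the denominator positive when
    \<open>n = 0\<close>.\<close>
  define d where "d = e / (2 * (real n + 1))"
  have d0: "0 < d" using Union.prems by (simp add: d_def)
  have "\<forall>i. \<exists>m. \<exists>B\<in>sets (F m). measure M ((a i - B) \<union> (B - a i)) < d"
    using Union.IH[OF d0] by blast
  then obtain mm B where B: "\<And>i. B i \<in> sets (F (mm i))"
    "\<And>i. measure M ((a i - B i) \<union> (B i - a i)) < d" by metis
  \<comment> \<open>One \<sigma>-algebra must contain all \<open>B i\<close> with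
    \<open>i < n\<close>; the range \<open>{..n}\<close> avoids the maximum of an empty set when
    \<open>n = 0\<close>.\<close>
  define m where "m = Max (mm ` {..n})"
  have "B i \<in> sets (F m)" if "i < n" for i
    using B(1)[of i] sets_mono[of "mm i" m] that by (auto simp: m_def)
  then have BF: "(\<Union>i\<in>{..<n}. B i) \<in> sets (F m)" by auto
  have BM: "B i \<in> sets M" for i using B(1) sets_F_sub by blast
  let ?U = "\<Union>i. a i" and ?V = "\<Union>i\<in>{..<n}. B i"
  let ?E = "\<lambda>i. (a i - B i) \<union> (B i - a i)"
  have "measure M ((?U - ?V) \<union> (?V - ?U)) \<le>
      measure M ((?U - (\<Union>i\<in>{..<n}. a i)) \<union> (\<Union>i\<in>{..<n}. ?E i))"
    using aG BM by (intro finite_measure_mono sets.Un sets.Diff sets.finite_UN sets.countable_UN) auto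
  also have "\<dots> \<le> measure M (?U - (\<Union>i\<in>{..<n}. a i)) + measure M (\<Union>i\<in>{..<n}. ?E i)"
    using aG BM by (intro measure_subadditive sets.Un sets.Diff sets.finite_UN sets.countable_UN) auto
  also have "measure M (\<Union>i\<in>{..<n}. ?E i) \<le> (\<Sum>i<n. measure M (?E i))"
    using aG BM by (intro finite_measure_subadditive_finite) auto
  also have "\<dots> \<le> (\<Sum>i<n. d)" by (intro sum_mono less_imp_le B(2))
  also have "\<dots> \<le> e / 2"
    using Union.prems by (simp add: d_def field_simps)
  finally have "measure M ((?U - ?V) \<union> (?V - ?U)) < e" using n by linarith
  then show ?case using BF by blast
qed

text \<open>Induction over integrable functions, carried out in the restriction of \<open>M\<close>
  to \<open>G\<close>, so that the indicators of the base case come from sets of \<open>G\<close>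
  and \<open>sets_approx\<close> applies.\<close>

lemma L1_approx:
  fixes f :: "'w \<Rightarrow> real"
  assumes "integrable M f" "f \<in> borel_measurable G" "0 < e"
  shows "\<exists>m h. integrable M h \<and> h \<in> borel_measurable (F m) \<and> (\<integral>x. \<bar>f x - h x\<bar> \<partial>M) < e"
proof -
  have "integrable (restr_to_subalg M G) f"
    using integrable_in_subalg[OF subalg_G] assms by blast
  then show ?thesis using assms(3)
  proof (induction arbitrary: e rule: integrable_induct)
    case (base A c)
    then have A: "A \<in> sets G" by (simp add: sets_restr_to_subalg[OF subalg_G])
    have AM: "A \<in> sets M" using A subalg_G by (auto simp: subalgebra_def)
    obtain m B where B: "B \<in> sets (F m)" "measure M ((A - B) \<union> (B - A)) < e / (\<bar>c\<bar> + 1)"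
      using sets_approx[OF A, of "e / (\<bar>c\<bar> + 1)"] base.prems by auto
    have BM: "B \<in> sets M" using B(1) sets_F_sub by blast
    have "\<bar>indicator A x *\<^sub>R c - indicator B x *\<^sub>R c\<bar> = \<bar>c\<bar> * indicator ((A - B) \<union> (B - A)) x" for x
      by (auto simp: indicator_def)
    then have "(\<integral>x. \<bar>indicator A x *\<^sub>R c - indicator B x *\<^sub>R c\<bar> \<partial>M) =
        \<bar>c\<bar> * measure M ((A - B) \<union> (B - A))"
      using AM BM by simp
    also have "\<dots> \<le> (\<bar>c\<bar> + 1) * measure M ((A - B) \<union> (B - A))"
      by (simp add: mult_right_mono)
    also have "\<dots> < e" using B(2) by (simp add: field_simps)
    finally have lt: "(\<integral>x. \<bar>indicator A x *\<^sub>R c - indicator B x *\<^sub>R c\<bar> \<partial>M) < e" .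
    have "integrable M (\<lambda>x. indicator B x *\<^sub>R c)"
      using BM by (intro integrable_scaleR_left) (auto simp: integrable_indicator_iff less_top[symmetric])
    then show ?case using B(1) lt
      by (intro exI[of _ m] exI[of _ "\<lambda>x. indicator B x *\<^sub>R c"]) auto
  next
    case (add f g)
    obtain m h where h: "integrable M h" "h \<in> borel_measurable (F m)" "(\<integral>x. \<bar>f x - h x\<bar> \<partial>M) < e/2"
      using add.IH(1)[of "e/2"] add.prems by auto
    obtain m' h' where h': "integrable M h'" "h' \<in> borel_measurable (F m')" "(\<integral>x. \<bar>g x - h' x\<bar> \<partial>M) < e/2"
      using add.IH(2)[of "e/2"] add.prems by auto
    have fg: "integrable M f" "integrable M g"
      using integrable_from_subalg[OF subalg_G] add.hyps by auto
    have "(\<integral>x. \<bar>(f x + g x) - (h x + h' x)\<bar> \<partial>M) \<le> (\<integral>x. \<bar>f x - h x\<bar> + \<bar>g x - h' x\<bar> \<partial>M)"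
      using fg h(1) h'(1) by (intro integral_mono) auto
    also have "\<dots> = (\<integral>x. \<bar>f x - h x\<bar> \<partial>M) + (\<integral>x. \<bar>g x - h' x\<bar> \<partial>M)"
      using fg h(1) h'(1) by (intro Bochner_Integration.integral_add) auto
    also have "\<dots> < e" using h(3) h'(3) by linarith
    finally have lt: "(\<integral>x. \<bar>(f x + g x) - (h x + h' x)\<bar> \<partial>M) < e" .
    have "(\<lambda>x. h x + h' x) \<in> borel_measurable (F (max m m'))"
      using F_measurable_mono[OF h(2)] F_measurable_mono[OF h'(2)] by auto
    then show ?case using lt h(1) h'(1)
      by (intro exI[of _ "max m m'"] exI[of _ "\<lambda>x. h x + h' x"]) auto
  next
    case (lim f s)
    have fM: "integrable M f" "\<And>i. integrable M (s i)"
      using integrable_from_subalg[OF subalg_G] lim.hyps by auto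
    have "(\<lambda>i. \<integral>x. \<bar>f x - s i x\<bar> \<partial>M) \<longlonglongrightarrow> (\<integral>x. 0 \<partial>M)"
    proof (rule integral_dominated_convergence[where w = "\<lambda>x. 3 * \<bar>f x\<bar>"])
      show "AE x in M. (\<lambda>i. \<bar>f x - s i x\<bar>) \<longlonglongrightarrow> 0"
      proof (rule AE_I2)
        fix x assume "x \<in> space M"
        then have "(\<lambda>i. s i x) \<longlonglongrightarrow> f x" using lim.hyps by (auto simp: space_restr_to_subalg)
        then have "(\<lambda>i. \<bar>f x - s i x\<bar>) \<longlonglongrightarrow> \<bar>f x - f x\<bar>" by (intro tendsto_intros)
        then show "(\<lambda>i. \<bar>f x - s i x\<bar>) \<longlonglongrightarrow> 0" by simp
      qed
      show "AE x in M. norm \<bar>f x - s i x\<bar> \<le> 3 * \<bar>f x\<bar>" for i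
      proof (rule AE_I2)
        fix x assume "x \<in> space M"
        then have "norm (s i x) \<le> 2 * norm (f x)" using lim.hyps by (auto simp: space_restr_to_subalg)
        then show "norm \<bar>f x - s i x\<bar> \<le> 3 * \<bar>f x\<bar>" by simp
      qed
    qed (use fM in auto)
    then have "(\<lambda>i. \<integral>x. \<bar>f x - s i x\<bar> \<partial>M) \<longlonglongrightarrow> 0" by simp
    then have "eventually (\<lambda>i. (\<integral>x. \<bar>f x - s i x\<bar> \<partial>M) < e/2) sequentially"
      using order_tendstoD(2)[of _ 0 sequentially "e/2"] lim.prems by simp
    then obtain i where i: "(\<integral>x. \<bar>f x - s i x\<bar> \<partial>M) < e/2" by (auto simp: eventually_sequentially)
    obtain m h where h: "integrable M h" "h \<in> borel_measurable (F m)" "(\<integral>x. \<bar>s i x - h x\<bar> \<partial>M) < e/2"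
      using lim.IH[of "e/2" i] lim.prems by auto
    have "(\<integral>x. \<bar>f x - h x\<bar> \<partial>M) \<le> (\<integral>x. \<bar>f x - s i x\<bar> + \<bar>s i x - h x\<bar> \<partial>M)"
      using fM h(1) by (intro integral_mono) auto
    also have "\<dots> = (\<integral>x. \<bar>f x - s i x\<bar> \<partial>M) + (\<integral>x. \<bar>s i x - h x\<bar> \<partial>M)"
      using fM h(1) by (intro Bochner_Integration.integral_add) auto
    also have "\<dots> < e" using i h(3) by linarith
    finally show ?case using h by blast
  qed
qed

text \<open>For \<open>h\<close> measurable with respect to \<open>F m\<close> the conditional
  expectations are stationary from \<open>m\<close> on, so with \<open>g = \<bar>f - h\<bar>\<close>
  the error is at most the conditional expectation of \<open>g\<close> plus \<open>g\<close>. The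
  maximal inequality and Markov's inequality make this small off a small set once \<open>h\<close>
  is close to \<open>f\<close> in the L1 norm.\<close>

theorem real_cond_exp_tendsto:
  fixes f :: "'w \<Rightarrow> real"
  assumes f: "integrable M f" "f \<in> borel_measurable G"
  shows "AE x in M. (\<lambda>n. real_cond_exp M (F n) f x) \<longlonglongrightarrow> f x"
proof -
  have fm [measurable]: "f \<in> borel_measurable M" using f(1) by auto
  \<comment> \<open>The points where the error exceeds \<open>d\<close> infinitely often;
    convergence can fail only on the union of these sets over \<open>d > 0\<close>.\<close>
  define Bad where "Bad d = {x \<in> space M. \<forall>m. \<exists>n\<ge>m. \<bar>real_cond_exp M (F n) f x - f x\<bar> > d}" for d
  have BadM: "Bad d \<in> sets M" for d
    unfolding Bad_def by measurable
  have null: "Bad (2 * d) \<in> null_sets M" if d: "0 < d" for d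
  proof -
    have le: "measure M (Bad (2 * d)) \<le> e" if e: "0 < e" for e
    proof -
      \<comment> \<open>Each of the two tail bounds will be at most the integral of \<open>g\<close>
        divided by \<open>d\<close>, so this tolerance makes their sum at most
        \<open>e\<close>.\<close>
      obtain m h where h: "integrable M h" "h \<in> borel_measurable (F m)"
          "(\<integral>x. \<bar>f x - h x\<bar> \<partial>M) < e * d / 2"
        using L1_approx[OF f, of "e * d / 2"] e d by auto
      define g where "g x = \<bar>f x - h x\<bar>" for x
      have gi: "integrable M g" unfolding g_def using f(1) h(1) by auto
      have [measurable]: "h \<in> borel_measurable M" "g \<in> borel_measurable M" using h(1) gi by auto
      define A where "A = {x \<in> space M. \<exists>n. real_cond_exp M (F n) g x > d}"
      define C where "C = {x \<in> space M. g x \<ge> d}"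
      have AM: "A \<in> sets M" unfolding A_def by measurable
      have CM: "C \<in> sets M" unfolding C_def by measurable
      have "AE x in M. \<forall>n\<ge>m. \<bar>real_cond_exp M (F n) f x - f x\<bar> \<le> real_cond_exp M (F n) g x + g x"
      proof -
        have "AE x in M. n \<ge> m \<longrightarrow> \<bar>real_cond_exp M (F n) f x - f x\<bar> \<le> real_cond_exp M (F n) g x + g x" for n
        proof (cases "n \<ge> m")
          case True
          interpret S: sigma_finite_subalgebra M "F n" by (rule sigma_finite_F)
          have hF: "h \<in> borel_measurable (F n)" by (rule F_measurable_mono[OF h(2) True])
          have 1: "AE x in M. real_cond_exp M (F n) h x = h x"
            using S.real_cond_exp_F_meas h(1) hF by blast
          have 2: "AE x in M. real_cond_exp M (F n) f x \<le> real_cond_exp M (F n) (\<lambda>x. h x + g x) x"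
            by (rule S.real_cond_exp_mono) (use f(1) h(1) gi in \<open>auto simp: g_def\<close>)
          have 3: "AE x in M. real_cond_exp M (F n) (\<lambda>x. h x - g x) x \<le> real_cond_exp M (F n) f x"
            by (rule S.real_cond_exp_mono) (use f(1) h(1) gi in \<open>auto simp: g_def\<close>)
          have 4: "AE x in M. real_cond_exp M (F n) (\<lambda>x. h x + g x) x =
              real_cond_exp M (F n) h x + real_cond_exp M (F n) g x"
            by (rule S.real_cond_exp_add[OF h(1) gi])
          have 5: "AE x in M. real_cond_exp M (F n) (\<lambda>x. h x - g x) x =
              real_cond_exp M (F n) h x - real_cond_exp M (F n) g x"
            by (rule S.real_cond_exp_diff[OF h(1) gi])
          from 1 2 3 4 5 show ?thesis
          proof eventually_elim
            case (elim x)
            have "\<bar>f x - h x\<bar> = g x" by (simp add: g_def)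
            then show ?case using elim by linarith
          qed
        qed simp
        then show ?thesis unfolding AE_all_countable by blast
      qed
      then have sub: "AE x in M. x \<in> Bad (2 * d) \<longrightarrow> x \<in> A \<union> C"
      proof eventually_elim
        case (elim x)
        show ?case
        proof
          assume x: "x \<in> Bad (2 * d)"
          then obtain n where n: "n \<ge> m" "\<bar>real_cond_exp M (F n) f x - f x\<bar> > 2 * d"
            unfolding Bad_def by blast
          then have "real_cond_exp M (F n) g x + g x > 2 * d" using elim by fastforce
          then have "real_cond_exp M (F n) g x > d \<or> g x \<ge> d" by linarith
          then show "x \<in> A \<union> C" using x by (auto simp: A_def C_def Bad_def)
        qed
      qed
      have A: "d * measure M A \<le> (\<integral>x. g x \<partial>M)"
        unfolding A_def by (rule maximal_inequality[OF gi _ d]) (simp add: g_def)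
      have C: "measure M C \<le> (\<integral>x. g x \<partial>M) / d"
        unfolding C_def by (rule integral_Markov_inequality_measure[where A = "{}"])
          (use f(1) h(1) d in \<open>auto simp: g_def\<close>)
      have "measure M (Bad (2 * d)) \<le> measure M (A \<union> C)"
        by (rule finite_measure_mono_AE) (use sub AM CM in auto)
      also have "\<dots> \<le> measure M A + measure M C" using AM CM by (rule measure_subadditive) auto
      also have "\<dots> \<le> (\<integral>x. g x \<partial>M) / d + (\<integral>x. g x \<partial>M) / d"
        using A C d by (simp add: field_simps)
      also have "\<dots> \<le> e" using h(3) d unfolding g_def by (simp add: field_simps)
      finally show ?thesis .
    qed
    have "measure M (Bad (2 * d)) \<le> 0" by (rule field_le_epsilon) (use le in auto)
    then have "measure M (Bad (2 * d)) = 0" using measure_nonneg[of M "Bad (2*d)"] by linarith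
    then show ?thesis using BadM by (simp add: null_sets_def emeasure_eq_measure)
  qed
  \<comment> \<open>Countably many thresholds suffice, and their null sets can be united.\<close>
  have "AE x in M. \<forall>k::nat. x \<notin> Bad (2 * (1 / (real k + 1)))"
    by (subst AE_all_countable) (intro allI AE_not_in null, simp)
  moreover have "AE x in M. x \<in> space M" by simp
  ultimately show ?thesis
  proof eventually_elim
    case (elim x)
    show ?case
    proof (rule LIMSEQ_I)
      fix r :: real assume r: "0 < r"
      obtain k :: nat where k: "2 / r < real k" using reals_Archimedean2 by blast
      have "2 * (1 / (real k + 1)) < r" using k r by (simp add: field_simps)
      moreover obtain m where "\<forall>n\<ge>m. \<bar>real_cond_exp M (F n) f x - f x\<bar> \<le> 2 * (1 / (real k + 1))"
        using elim(1)[rule_format, of k] elim(2) unfolding Bad_def by (auto simp: not_less)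
      ultimately show "\<exists>no. \<forall>n\<ge>no. norm (real_cond_exp M (F n) f x - f x) < r"
        by (intro exI[of _ m]) (auto intro: le_less_trans)
    qed
  qed
qed

end

text \<open>A cluster point of the sequence of evaluations in the compact product of the intervals
  \<open>[-C x, C x]\<close> gives a filter along which all bounded sequences converge.\<close>

lemma bounded_limit_filter_exists:
  "\<exists>U. U \<le> sequentially \<and> U \<noteq> bot \<and> (\<forall>x :: nat \<Rightarrow> real. Bseq x \<longrightarrow> (\<exists>l. (x \<longlongrightarrow> l) U))"
proof -
  \<comment> \<open>The box has to be compact in every coordinate, also in those of unbounded
    sequences; there both \<open>K\<close> and the evaluation \<open>e\<close> are set to 0.\<close>
  define K :: "(nat \<Rightarrow> real) \<Rightarrow> real" where "K x = (if Bseq x then SOME c. \<forall>n. \<bar>x n\<bar> \<le> c else 0)" for x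
  have K: "\<bar>x n\<bar> \<le> K x" if "Bseq x" for x n
  proof -
    have "\<exists>c. \<forall>n. \<bar>x n\<bar> \<le> c" using that by (auto simp: Bseq_def)
    then have "\<forall>n. \<bar>x n\<bar> \<le> (SOME c. \<forall>n. \<bar>x n\<bar> \<le> c)" by (rule someI_ex)
    then show ?thesis using that by (simp add: K_def)
  qed
  define e where "e n = (\<lambda>x. if Bseq x then x n else 0 :: real)" for n :: nat
  have "compactin (product_topology (\<lambda>_. euclidean) UNIV) (PiE UNIV (\<lambda>x. {- K x .. K x}))"
    by (subst compactin_PiE) (auto simp: compactin_euclidean_iff)
  then have cpt: "compact (PiE UNIV (\<lambda>x. {- K x .. K x}))"
    by (simp add: euclidean_product_topology compactin_euclidean_iff)
  have "eventually (\<lambda>y. y \<in> PiE UNIV (\<lambda>x. {- K x .. K x})) (filtermap e sequentially)"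
  proof -
    have "e n x \<in> {- K x .. K x}" for n x
      using K[of x n] by (cases "Bseq x") (auto simp: e_def abs_le_iff K_def)
    then show ?thesis by (simp add: eventually_filtermap PiE_UNIV_domain)
  qed
  moreover have "filtermap e sequentially \<noteq> bot" by (simp add: filtermap_bot_iff)
  ultimately obtain L where L: "inf (nhds L) (filtermap e sequentially) \<noteq> bot"
    using cpt[unfolded compact_filter] by blast
  \<comment> \<open>A cluster point yields convergence along a finer filter only: indices whose
    evaluations are close to \<open>L\<close>, intersected with tails. That this filter is proper is
    exactly the cluster property.\<close>
  define U where "U = inf (filtercomap e (nhds L)) sequentially"
  have "filtermap e U \<noteq> bot"
  proof
    assume "filtermap e U = bot"
    then have "eventually (\<lambda>_. False) (inf (filtercomap e (nhds L)) sequentially)"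
      by (simp add: U_def filtermap_bot_iff)
    then obtain P Q where PQ: "eventually P (filtercomap e (nhds L))" "eventually Q sequentially"
        "\<And>n. P n \<Longrightarrow> Q n \<Longrightarrow> False"
      unfolding eventually_inf by blast
    obtain P' where P': "eventually P' (nhds L)" "\<And>n. P' (e n) \<Longrightarrow> P n"
      using PQ(1) unfolding eventually_filtercomap by blast
    have "eventually (\<lambda>y. \<not> P' y) (filtermap e sequentially)"
      unfolding eventually_filtermap by (rule eventually_mono[OF PQ(2)]) (use PQ(3) P'(2) in blast)
    then have "eventually (\<lambda>_. False) (inf (nhds L) (filtermap e sequentially))"
      unfolding eventually_inf using P'(1) by blast
    then show False using L by (simp add: trivial_limit_def)
  qed
  then have "U \<noteq> bot" by (simp add: filtermap_bot_iff)
  moreover have "U \<le> sequentially" by (simp add: U_def)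
  moreover have "(x \<longlongrightarrow> L x) U" if "Bseq x" for x
  proof -
    have lim: "filterlim e (nhds L) U"
      unfolding U_def by (rule filterlim_mono[OF filterlim_filtercomap]) auto
    have "((\<lambda>n. e n x) \<longlongrightarrow> L x) U"
    proof (rule topological_tendstoI)
      fix S :: "real set" assume S: "open S" "L x \<in> S"
      have "open ((\<lambda>y :: (nat \<Rightarrow> real) \<Rightarrow> real. y x) -` S)"
        by (rule open_vimage[OF S(1) continuous_on_product_coordinates])
      then have "eventually (\<lambda>y. y x \<in> S) (nhds L)"
        using S(2) unfolding eventually_nhds by (intro exI[of _ "(\<lambda>y. y x) -` S"]) auto
      with lim show "eventually (\<lambda>n. e n x \<in> S) U" unfolding filterlim_iff by blast
    qed
    then show ?thesis using that by (simp add: e_def)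
  qed
  ultimately show ?thesis by blast
qed

section \<open>Linear liftings\<close>

text \<open>Each level set of a simple approximation is replaced by a set of \<open>N\<close> with
  the same trace on \<open>A\<close>. The modified functions agree with the original ones on
  \<open>A\<close>, and so do the limits.\<close>

lemma trace_measurable_ex:
  fixes f :: "'w \<Rightarrow> real"
  assumes sp: "space N' = space N"
    and tr: "\<And>B. B \<in> sets N' \<Longrightarrow> \<exists>E\<in>sets N. B \<inter> A = E \<inter> A"
    and f: "f \<in> borel_measurable N'"
  shows "\<exists>g\<in>borel_measurable N. \<forall>x\<in>space N \<inter> A. f x = g x"
proof -
  obtain s where s: "\<And>i. simple_function N' (s i)" "\<And>x. x \<in> space N' \<Longrightarrow> (\<lambda>i. s i x) \<longlonglongrightarrow> f x"
    using borel_measurable_implies_sequence_metric[OF f] by metis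
  have "\<exists>g\<in>borel_measurable N. \<forall>x\<in>space N \<inter> A. s i x = g x" for i
  proof -
    have "\<exists>E\<in>sets N. (s i -` {y} \<inter> space N') \<inter> A = E \<inter> A" for y
      using tr simple_functionD(2)[OF s(1)] by blast
    then obtain E where E: "\<And>y. E y \<in> sets N" "\<And>y. (s i -` {y} \<inter> space N') \<inter> A = E y \<inter> A" by metis
    \<comment> \<open>Off \<open>A\<close> the sets \<open>E y\<close> may overlap or leave gaps; at
      a point of \<open>A\<close> exactly one of them is hit.\<close>
    define g where "g x = (\<Sum>y\<in>s i ` space N'. y * indicator (E y) x)" for x
    have fin: "finite (s i ` space N')" using s(1) by (rule simple_functionD)
    have "g \<in> borel_measurable N" unfolding g_def using E(1) by measurable
    moreover have "s i x = g x" if x: "x \<in> space N \<inter> A" for x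
    proof -
      have "g x = (\<Sum>y\<in>s i ` space N'. if y = s i x then y else 0)"
        unfolding g_def
      proof (rule sum.cong[OF refl])
        fix y
        have "x \<in> E y \<longleftrightarrow> s i x = y" using E(2)[of y] x sp by auto
        then show "y * indicator (E y) x = (if y = s i x then y else 0)" by (auto simp: indicator_def)
      qed
      also have "\<dots> = s i x" using fin x sp by (subst sum.delta) auto
      finally show ?thesis by simp
    qed
    ultimately show ?thesis by blast
  qed
  then obtain g where g: "\<And>i. g i \<in> borel_measurable N" "\<And>i x. x \<in> space N \<inter> A \<Longrightarrow> s i x = g i x"
    by metis
  have "f x = lim (\<lambda>i. g i x)" if "x \<in> space N \<inter> A" for x
    using s(2)[of x] g(2)[OF that] that sp by (simp add: limI)
  \<comment> \<open>\<open>lim\<close> is measurable whether or not the sequence converges, so its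
    arbitrary values off \<open>A\<close> do no harm.\<close>
  moreover have "(\<lambda>x. lim (\<lambda>i. g i x)) \<in> borel_measurable N"
    by (rule borel_measurable_lim_metric[where f = g, OF g(1)])
  ultimately show ?thesis by (intro bexI[of _ "\<lambda>x. lim (\<lambda>i. g i x)"] ballI)
qed

text \<open>Boundedness is essential with respect to the null sets of \<open>M\<close>, which may
  lie outside \<open>S\<close>. A bare family \<open>S\<close> in place of a measure lets partial
  liftings be ordered by inclusion.\<close>

definition bdd_fns :: "'w measure \<Rightarrow> 'w set set \<Rightarrow> ('w \<Rightarrow> real) set" where
  "bdd_fns M S = {f \<in> borel_measurable (sigma (space M) S). \<exists>C. AE x in M. \<bar>f x\<bar> \<le> C}"

text \<open>Positivity refers to functions that are nonnegative only a.e.; with linearity this makes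
  \<open>\<rho> f\<close> depend on the a.e. class of \<open>f\<close> alone. Extensionality gives
  antisymmetry of \<open>lifting_le\<close>, on which Zorn's lemma relies.\<close>

definition lifting_on :: "'w measure \<Rightarrow> 'w set set \<times> (('w \<Rightarrow> real) \<Rightarrow> 'w \<Rightarrow> real) \<Rightarrow> bool" where
  "lifting_on M = (\<lambda>(S, \<rho>).
    sigma_algebra (space M) S \<and> S \<subseteq> sets M \<and> \<rho> \<in> extensional (bdd_fns M S) \<and>
    (\<forall>f\<in>bdd_fns M S. AE x in M. \<rho> f x = f x) \<and>
    (\<forall>f\<in>bdd_fns M S. \<forall>g\<in>bdd_fns M S. \<rho> (\<lambda>x. f x + g x) = (\<lambda>x. \<rho> f x + \<rho> g x)) \<and>
    (\<forall>c. \<forall>f\<in>bdd_fns M S. \<rho> (\<lambda>x. c * f x) = (\<lambda>x. c * \<rho> f x)) \<and>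
    (\<forall>f\<in>bdd_fns M S. (AE x in M. 0 \<le> f x) \<longrightarrow> (\<forall>x. 0 \<le> \<rho> f x)) \<and>
    \<rho> (\<lambda>_. 1) = (\<lambda>_. 1))"

definition lifting_le :: "'w measure \<Rightarrow> 'w set set \<times> (('w \<Rightarrow> real) \<Rightarrow> 'w \<Rightarrow> real) \<Rightarrow>
    'w set set \<times> (('w \<Rightarrow> real) \<Rightarrow> 'w \<Rightarrow> real) \<Rightarrow> bool" where
  "lifting_le M = (\<lambda>(S, \<rho>) (S', \<rho>'). S \<subseteq> S' \<and> (\<forall>f\<in>bdd_fns M S. \<rho>' f = \<rho> f))"

context prob_space
begin

lemma bdd_fns_add: "f \<in> bdd_fns M S \<Longrightarrow> g \<in> bdd_fns M S \<Longrightarrow> (\<lambda>x. f x + g x) \<in> bdd_fns M S"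
proof -
  assume f: "f \<in> bdd_fns M S" and g: "g \<in> bdd_fns M S"
  obtain C D where "AE x in M. \<bar>f x\<bar> \<le> C" "AE x in M. \<bar>g x\<bar> \<le> D" using f g by (auto simp: bdd_fns_def)
  then have "AE x in M. \<bar>f x + g x\<bar> \<le> C + D" by eventually_elim linarith
  then show ?thesis using f g by (auto simp: bdd_fns_def)
qed

lemma bdd_fns_cmult: "f \<in> bdd_fns M S \<Longrightarrow> (\<lambda>x. c * f x) \<in> bdd_fns M S"
proof -
  assume f: "f \<in> bdd_fns M S"
  obtain C where "AE x in M. \<bar>f x\<bar> \<le> C" using f by (auto simp: bdd_fns_def)
  then have "AE x in M. \<bar>c * f x\<bar> \<le> \<bar>c\<bar> * C" by eventually_elim (simp add: abs_mult mult_left_mono)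
  then show ?thesis using f by (auto simp: bdd_fns_def)
qed

lemma bdd_fns_const: "(\<lambda>_. c) \<in> bdd_fns M S"
  by (auto simp: bdd_fns_def)

lemma subalgebra_sigma:
  assumes "sigma_algebra (space M) S" "S \<subseteq> sets M"
  shows "sets (sigma (space M) S) = S" "space (sigma (space M) S) = space M"
    "subalgebra M (sigma (space M) S)"
  using sigma_algebra.sets_measure_of_eq[OF assms(1)] sigma_algebra.space_measure_of_eq[OF assms(1)] assms(2)
  by (auto simp: subalgebra_def)

lemma bdd_fns_mono:
  assumes "sigma_algebra (space M) S" "S \<subseteq> sets M" "sigma_algebra (space M) S'" "S' \<subseteq> sets M" "S \<subseteq> S'"
  shows "bdd_fns M S \<subseteq> bdd_fns M S'"
  using subalgebra_sigma[OF assms(1,2)] subalgebra_sigma[OF assms(3,4)] assms(5)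
  by (auto simp: bdd_fns_def measurable_def)

lemma bdd_fns_integrable:
  assumes "f \<in> bdd_fns M S" "sigma_algebra (space M) S" "S \<subseteq> sets M"
  shows "integrable M f"
proof -
  obtain C where C: "AE x in M. norm (f x) \<le> C" using assms(1) by (auto simp: bdd_fns_def)
  have "f \<in> borel_measurable M"
    using assms(1) measurable_from_subalg[OF subalgebra_sigma(3)[OF assms(2,3)]] by (auto simp: bdd_fns_def)
  then show ?thesis by (rule integrable_const_bound[OF C])
qed

lemma lifting_onD:
  assumes "lifting_on M (S, \<rho>)"
  shows "sigma_algebra (space M) S" "S \<subseteq> sets M" "\<rho> \<in> extensional (bdd_fns M S)"
    "f \<in> bdd_fns M S \<Longrightarrow> AE x in M. \<rho> f x = f x"
    "f \<in> bdd_fns M S \<Longrightarrow> g \<in> bdd_fns M S \<Longrightarrow> \<rho> (\<lambda>x. f x + g x) = (\<lambda>x. \<rho> f x + \<rho> g x)"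
    "f \<in> bdd_fns M S \<Longrightarrow> \<rho> (\<lambda>x. c * f x) = (\<lambda>x. c * \<rho> f x)"
    "f \<in> bdd_fns M S \<Longrightarrow> AE x in M. 0 \<le> f x \<Longrightarrow> 0 \<le> \<rho> f x"
    "\<rho> (\<lambda>_. 1) = (\<lambda>_. 1)"
  using assms unfolding lifting_on_def prod.case by blast+

lemma lifting_on_mono:
  assumes L: "lifting_on M (S, \<rho>)" and f: "f \<in> bdd_fns M S" and g: "g \<in> bdd_fns M S"
    and le: "AE x in M. f x \<le> g x"
  shows "\<rho> f x \<le> \<rho> g x"
proof -
  have "0 \<le> \<rho> (\<lambda>x. g x + (-1) * f x) x"
    by (rule lifting_onD(7)[OF L bdd_fns_add[OF g bdd_fns_cmult[OF f]]]) (use le in auto)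
  also have "\<rho> (\<lambda>x. g x + (-1) * f x) = (\<lambda>x. \<rho> g x + \<rho> (\<lambda>x. (-1) * f x) x)"
    by (rule lifting_onD(5)[OF L g bdd_fns_cmult[OF f]])
  also have "\<rho> (\<lambda>x. (-1) * f x) = (\<lambda>x. (-1) * \<rho> f x)"
    by (rule lifting_onD(6)[OF L f])
  finally show ?thesis by simp
qed

lemma lifting_on_cong:
  assumes L: "lifting_on M (S, \<rho>)" and f: "f \<in> bdd_fns M S" and g: "g \<in> bdd_fns M S"
    and eq: "AE x in M. f x = g x"
  shows "\<rho> f = \<rho> g"
  by (intro ext antisym lifting_on_mono[OF L f g] lifting_on_mono[OF L g f]) (use eq in auto)

lemma lifting_on_const:
  assumes L: "lifting_on M (S, \<rho>)" shows "\<rho> (\<lambda>_. c) = (\<lambda>_. c)"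
  using lifting_onD(6)[OF L bdd_fns_const, of c 1] lifting_onD(8)[OF L] by simp

text \<open>Positivity and normalization turn an a.e. bound into one valid at every point. It later
  bounds both the sequences fed to the limit filter and the selected functionals.\<close>

lemma lifting_on_bound:
  assumes L: "lifting_on M (S, \<rho>)" and f: "f \<in> bdd_fns M S" and C: "AE x in M. \<bar>f x\<bar> \<le> C"
  shows "\<bar>\<rho> f x\<bar> \<le> C"
proof -
  have "\<rho> f x \<le> \<rho> (\<lambda>_. C) x"
    by (rule lifting_on_mono[OF L f bdd_fns_const]) (use C in auto)
  moreover have "\<rho> (\<lambda>_. - C) x \<le> \<rho> f x"
    by (rule lifting_on_mono[OF L bdd_fns_const f]) (use C in \<open>auto elim!: eventually_mono\<close>)
  ultimately show ?thesis by (simp add: lifting_on_const[OF L])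
qed

lemma lifting_onI:
  assumes "sigma_algebra (space M) S" "S \<subseteq> sets M"
    "\<And>f. f \<in> bdd_fns M S \<Longrightarrow> AE x in M. \<rho> f x = f x"
    "\<And>f g x. f \<in> bdd_fns M S \<Longrightarrow> g \<in> bdd_fns M S \<Longrightarrow> \<rho> (\<lambda>x. f x + g x) x = \<rho> f x + \<rho> g x"
    "\<And>f c x. f \<in> bdd_fns M S \<Longrightarrow> \<rho> (\<lambda>x. c * f x) x = c * \<rho> f x"
    "\<And>f x. f \<in> bdd_fns M S \<Longrightarrow> AE x in M. 0 \<le> f x \<Longrightarrow> 0 \<le> \<rho> f x"
    "\<And>x. \<rho> (\<lambda>_. 1) x = 1"
  shows "lifting_on M (S, restrict \<rho> (bdd_fns M S))"
  unfolding lifting_on_def prod.case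
proof (intro conjI ballI allI impI)
  show "restrict \<rho> (bdd_fns M S) \<in> extensional (bdd_fns M S)" by simp
  show "restrict \<rho> (bdd_fns M S) (\<lambda>_. 1) = (\<lambda>_. 1)"
    using assms(7) bdd_fns_const by (simp add: fun_eq_iff)
  fix f assume f: "f \<in> bdd_fns M S"
  show "AE x in M. restrict \<rho> (bdd_fns M S) f x = f x" using assms(3)[OF f] f by simp
  show "0 \<le> restrict \<rho> (bdd_fns M S) f x" if "AE x in M. 0 \<le> f x" for x
    using assms(6)[OF f that] f by simp
  show "restrict \<rho> (bdd_fns M S) (\<lambda>x. c * f x) = (\<lambda>x. c * restrict \<rho> (bdd_fns M S) f x)" for c
    using assms(5)[OF f] f bdd_fns_cmult[OF f] by (simp add: fun_eq_iff)
  fix g assume g: "g \<in> bdd_fns M S"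
  show "restrict \<rho> (bdd_fns M S) (\<lambda>x. f x + g x) =
      (\<lambda>x. restrict \<rho> (bdd_fns M S) f x + restrict \<rho> (bdd_fns M S) g x)"
    using assms(4)[OF f g] f g bdd_fns_add[OF f g] by (simp add: fun_eq_iff)
qed (use assms(1,2) in auto)

text \<open>A function measurable for the trivial \<sigma>-algebra is constant on the space, and its
  expectation is that constant. This bounds the empty chain in Zorn's lemma.\<close>

lemma lifting_trivial: "\<exists>\<rho>. lifting_on M ({{}, space M}, \<rho>)"
proof -
  let ?S = "{{}, space M}"
  have sa: "sigma_algebra (space M) ?S" by (rule sigma_algebra_trivial)
  have sub: "?S \<subseteq> sets M" by auto
  note N = subalgebra_sigma[OF sa sub]
  have "lifting_on M (?S, restrict (\<lambda>f _. \<integral>x. f x \<partial>M) (bdd_fns M ?S))"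
  proof (rule lifting_onI[OF sa sub])
    fix f assume f: "f \<in> bdd_fns M ?S"
    obtain x0 where x0: "x0 \<in> space M" using not_empty by blast
    have fm: "f \<in> borel_measurable (sigma (space M) ?S)" using f by (simp add: bdd_fns_def)
    have "f -` {f x0} \<inter> space M \<in> ?S"
      using measurable_sets[OF fm, of "{f x0}"] by (simp only: N) auto
    then have "f -` {f x0} \<inter> space M = space M" using x0 by auto
    then have c: "f x = f x0" if "x \<in> space M" for x using that by auto
    have "(\<integral>x. f x \<partial>M) = (\<integral>x. f x0 \<partial>M)" by (rule Bochner_Integration.integral_cong) (use c in auto)
    then have "(\<integral>x. f x \<partial>M) = f x0" by (simp add: prob_space)
    then show "AE x in M. (\<integral>x. f x \<partial>M) = f x" using c by auto
  next
    fix f g assume f: "f \<in> bdd_fns M ?S" and g: "g \<in> bdd_fns M ?S"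
    show "(\<integral>x. f x + g x \<partial>M) = (\<integral>x. f x \<partial>M) + (\<integral>x. g x \<partial>M)"
      by (rule Bochner_Integration.integral_add[OF bdd_fns_integrable[OF f sa sub] bdd_fns_integrable[OF g sa sub]])
  qed (simp_all add: prob_space integral_nonneg_AE)
  then show ?thesis by blast
qed

end

section \<open>Extension of a lifting by one set\<close>

context prob_space
begin

text \<open>The conditional expectation given a \<open>\<sigma>\<close>-algebra \<open>N\<close> with respect to \<open>P(\<cdot> | A)\<close>; the second
  summand repairs it outside the \<open>N\<close>-measurable hull of \<open>A\<close>, where the first one is \<open>0 / 0 = 0\<close>.\<close>

definition trace_exp :: "'a measure \<Rightarrow> 'a set \<Rightarrow> ('a \<Rightarrow> real) \<Rightarrow> 'a \<Rightarrow> real" where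
  "trace_exp N A f x = real_cond_exp M N (\<lambda>x. indicator A x * f x) x / real_cond_exp M N (indicator A) x +
    (if real_cond_exp M N (indicator A) x = 0
     then real_cond_exp M N (\<lambda>x. indicator (space M - A) x * f x) x /
       real_cond_exp M N (indicator (space M - A)) x else 0)"

context
  fixes N A
  assumes N: "subalgebra M N" and A: "A \<in> sets M"
begin

interpretation sigma_finite_subalgebra M N by (rule sigma_finite_subalgebraI[OF N])

lemma integrable_indicator_cmult:
  fixes f :: "'a \<Rightarrow> real"
  shows "integrable M f \<Longrightarrow> B \<in> sets M \<Longrightarrow> integrable M (\<lambda>x. indicator B x * f x)"
  using integrable_mult_indicator[of B M f] by simp

lemma trace_exp_add:
  assumes "integrable M f" "integrable M g"
  shows "AE x in M. trace_exp N A (\<lambda>x. f x + g x) x = trace_exp N A f x + trace_exp N A g x"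
proof -
  have "AE x in M. real_cond_exp M N (\<lambda>x. indicator B x * (f x + g x)) x =
      real_cond_exp M N (\<lambda>x. indicator B x * f x) x + real_cond_exp M N (\<lambda>x. indicator B x * g x) x"
    if "B \<in> sets M" for B
    using real_cond_exp_add[OF integrable_indicator_cmult[OF assms(1) that] integrable_indicator_cmult[OF assms(2) that]]
    by (simp add: distrib_left)
  from this[OF A] this[OF sets.compl_sets[OF A]] show ?thesis
    by eventually_elim (simp add: trace_exp_def add_divide_distrib)
qed

lemma trace_exp_cmult:
  assumes "integrable M f"
  shows "AE x in M. trace_exp N A (\<lambda>x. c * f x) x = c * trace_exp N A f x"
proof -
  have "AE x in M. real_cond_exp M N (\<lambda>x. indicator B x * (c * f x)) x =
      c * real_cond_exp M N (\<lambda>x. indicator B x * f x) x"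
    if "B \<in> sets M" for B
    using real_cond_exp_cmult[OF integrable_indicator_cmult[OF assms that], of c]
    by (simp add: mult.left_commute)
  from this[OF A] this[OF sets.compl_sets[OF A]] show ?thesis
    by eventually_elim (simp add: trace_exp_def distrib_left)
qed

lemma cond_prob_nonneg: "B \<in> sets M \<Longrightarrow> AE x in M. 0 \<le> real_cond_exp M N (indicator B) x"
  by (rule real_cond_exp_pos) auto

lemma trace_exp_nonneg:
  assumes "integrable M f" "AE x in M. 0 \<le> f x"
  shows "AE x in M. 0 \<le> trace_exp N A f x"
proof -
  have "AE x in M. 0 \<le> real_cond_exp M N (\<lambda>x. indicator B x * f x) x" if "B \<in> sets M" for B
    by (rule real_cond_exp_pos)
      (use assms that in \<open>auto intro!: borel_measurable_integrable integrable_indicator_cmult elim!: eventually_mono\<close>)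
  from this[OF A] this[OF sets.compl_sets[OF A]] cond_prob_nonneg[OF A] cond_prob_nonneg[OF sets.compl_sets[OF A]]
  show ?thesis by eventually_elim (simp add: trace_exp_def)
qed

lemma trace_exp_measurable [measurable]: "trace_exp N A f \<in> borel_measurable N"
  unfolding trace_exp_def[abs_def] by measurable

lemma integrable_indicat: "B \<in> sets M \<Longrightarrow> integrable M (indicat_real B)"
  by (simp add: integrable_indicator_iff less_top[symmetric])

text \<open>Prevents the two denominators in \<open>trace_exp\<close> from vanishing
  together.\<close>

lemma cond_prob_compl:
  "AE x in M. real_cond_exp M N (indicator A) x + real_cond_exp M N (indicator (space M - A)) x = 1"
proof -
  have "AE x in M. real_cond_exp M N (\<lambda>x. indicator A x + indicator (space M - A) x) x =
      real_cond_exp M N (indicator A) x + real_cond_exp M N (indicator (space M - A)) x"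
    using A by (intro real_cond_exp_add integrable_indicat) auto
  moreover have "AE x in M. real_cond_exp M N (\<lambda>x. indicator A x + indicator (space M - A) x) x =
      real_cond_exp M N (\<lambda>x. 1) x"
    using A by (intro real_cond_exp_cong AE_I2) (auto simp: indicator_def)
  moreover have "AE x in M. real_cond_exp M N (\<lambda>x. 1) x = 1"
    by (rule real_cond_exp_F_meas) auto
  ultimately show ?thesis by eventually_elim simp
qed

text \<open>A factor measurable for \<open>N\<close> comes out of both quotients. Where the first
  denominator vanishes, the second is 1 by \<open>cond_prob_compl\<close>, so the value is
  \<open>f\<close> there too.\<close>

lemma trace_exp_subalgebra:
  assumes f: "integrable M f" "f \<in> borel_measurable N"
  shows "AE x in M. trace_exp N A f x = f x"
proof -
  have "AE x in M. real_cond_exp M N (\<lambda>x. indicator B x * f x) x = f x * real_cond_exp M N (indicator B) x"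
    if "B \<in> sets M" for B
    using real_cond_exp_mult[OF f(2), of "indicator B"] integrable_indicator_cmult[OF f(1) that] that
    by (simp add: mult.commute)
  from this[OF A] this[OF sets.compl_sets[OF A]] cond_prob_compl
  show ?thesis by eventually_elim (auto simp: trace_exp_def)
qed

text \<open>Over the set of \<open>N\<close> where the conditional probability is not positive, its
  integral is the measure of the part of \<open>A\<close> inside, which is therefore 0.\<close>

lemma cond_prob_pos: "AE x in M. x \<in> A \<longrightarrow> real_cond_exp M N (indicator A) x > 0"
proof -
  define Z where "Z = {x \<in> space N. real_cond_exp M N (indicator A) x \<le> 0}"
  have Z: "Z \<in> sets N" unfolding Z_def by measurable
  have ZM: "Z \<in> sets M" using Z N by (auto simp: subalgebra_def)
  have "measure M (A \<inter> Z) = (\<integral>x\<in>Z. indicator A x \<partial>M)"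
    using A ZM by (simp add: set_lebesgue_integral_def indicator_inter_arith[symmetric] Int_commute)
  also have "\<dots> = (\<integral>x\<in>Z. real_cond_exp M N (indicator A) x \<partial>M)"
    by (rule real_cond_exp_intA[OF integrable_indicat[OF A] Z])
  also have "\<dots> \<le> 0"
  proof -
    have "0 \<le> (\<integral>x. - (indicat_real Z x *\<^sub>R real_cond_exp M N (indicator A) x) \<partial>M)"
      by (rule integral_nonneg_AE) (auto simp: Z_def indicator_def)
    then show ?thesis by (simp add: set_lebesgue_integral_def)
  qed
  finally have "measure M (A \<inter> Z) = 0" using measure_nonneg[of M "A \<inter> Z"] by linarith
  then have "A \<inter> Z \<in> null_sets M" using A ZM by (simp add: null_sets_def emeasure_eq_measure)
  from AE_not_in[OF this] AE_space show ?thesis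
    by eventually_elim (use N in \<open>auto simp: Z_def subalgebra_def\<close>)
qed

text \<open>On \<open>A\<close> the function may be replaced by \<open>g\<close>, which comes out of
  the conditional expectation; the denominator that remains is positive a.e. on
  \<open>A\<close>.\<close>

lemma trace_exp_on:
  assumes f: "integrable M f" and g: "g \<in> borel_measurable N" and eq: "\<forall>x\<in>space M \<inter> A. f x = g x"
  shows "AE x in M. x \<in> A \<longrightarrow> trace_exp N A f x = f x"
proof -
  have [measurable]: "f \<in> borel_measurable M" using f by auto
  have [measurable]: "g \<in> borel_measurable M" using g N by (rule measurable_from_subalg[rotated])
  have i: "integrable M (\<lambda>x. g x * indicator A x)"
  proof -
    have "integrable M (\<lambda>x. g x * indicator A x) = integrable M (\<lambda>x. indicator A x * f x)"
      by (rule Bochner_Integration.integrable_cong) (use eq in \<open>auto simp: indicator_def\<close>)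
    then show ?thesis using integrable_indicator_cmult[OF f A] by simp
  qed
  have "AE x in M. real_cond_exp M N (\<lambda>x. g x * indicator A x) x = g x * real_cond_exp M N (indicator A) x"
    by (rule real_cond_exp_mult) (use g i A in auto)
  moreover have "AE x in M. real_cond_exp M N (\<lambda>x. indicator A x * f x) x = real_cond_exp M N (\<lambda>x. g x * indicator A x) x"
    by (rule real_cond_exp_cong) (use eq A in \<open>auto simp: indicator_def\<close>)
  ultimately show ?thesis using cond_prob_pos AE_space
    by eventually_elim (use eq in \<open>auto simp: trace_exp_def\<close>)
qed

end

text \<open>A positive linear operator that fixes constants preserves bounds: apply it to
  \<open>C - f\<close> and \<open>C + f\<close>.\<close>

lemma trace_exp_bdd_fns:
  assumes "sigma_algebra (space M) S" "S \<subseteq> sets M" "A \<in> sets M"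
    and f: "integrable M f" and C: "AE x in M. \<bar>f x\<bar> \<le> C"
  shows "trace_exp (sigma (space M) S) A f \<in> bdd_fns M S"
proof -
  let ?N = "sigma (space M) S"
  have N: "subalgebra M ?N" by (rule subalgebra_sigma(3)[OF assms(1,2)])
  have c: "integrable M (\<lambda>_. C)" by simp
  have 0: "integrable M (\<lambda>x. - 1 * f x)" using f by auto
  have "AE x in M. 0 \<le> trace_exp ?N A (\<lambda>x. C + - 1 * f x) x"
    by (rule trace_exp_nonneg[OF N assms(3)]) (use f C in \<open>auto elim!: eventually_mono\<close>)
  moreover have "AE x in M. 0 \<le> trace_exp ?N A (\<lambda>x. C + f x) x"
    by (rule trace_exp_nonneg[OF N assms(3)]) (use f C in \<open>auto elim!: eventually_mono\<close>)
  moreover note trace_exp_add[OF N assms(3) c f] trace_exp_add[OF N assms(3) c 0]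
    trace_exp_cmult[OF N assms(3) f, of "-1"]
  moreover have "AE x in M. trace_exp ?N A (\<lambda>_. C) x = C"
    by (rule trace_exp_subalgebra[OF N assms(3)]) auto
  ultimately have "AE x in M. \<bar>trace_exp ?N A f x\<bar> \<le> C"
    by eventually_elim linarith
  then show ?thesis using trace_exp_measurable[OF N assms(3)] by (auto simp: bdd_fns_def)
qed

text \<open>On \<open>A\<close> and on its complement separately, every set of the enlarged
  \<sigma>-algebra has the trace of an old set. A new function is thus an old one on each half;
  \<open>trace_exp\<close> finds it, and the old lifting is applied to both.\<close>

lemma lifting_extend:
  assumes L: "lifting_on M (S, \<rho>)" and A: "A \<in> sets M"
  shows "\<exists>S' \<rho>'. lifting_on M (S', \<rho>') \<and> lifting_le M (S, \<rho>) (S', \<rho>') \<and> A \<in> S'"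
proof -
  note S = lifting_onD(1,2)[OF L]
  let ?N = "sigma (space M) S"
  note N = subalgebra_sigma[OF S]
  have AsM: "A \<subseteq> space M" using A by (rule sets.sets_into_space)
  define S' where "S' = sigma_sets (space M) (insert A S)"
  have pow: "insert A S \<subseteq> Pow (space M)" using A S(2) sets.space_closed by blast
  have sa: "sigma_algebra (space M) S'" unfolding S'_def by (rule sigma_algebra_sigma_sets[OF pow])
  have sub: "S' \<subseteq> sets M" unfolding S'_def using A S(2) by (intro sets.sigma_sets_subset) auto
  have SS': "S \<subseteq> S'" and AS': "A \<in> S'" unfolding S'_def by auto
  note N' = subalgebra_sigma[OF sa sub]
  define Ac where "Ac = space M - A"
  have Ac: "Ac \<in> sets M" using A by (auto simp: Ac_def)
  \<comment> \<open>The sets with this property form a \<sigma>-algebra; \<open>A\<close> itself has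
    the trace of \<open>space M\<close> on \<open>A\<close> and that of the empty set on the
    complement.\<close>
  have tr: "\<exists>E\<in>S. B \<inter> D = E \<inter> D" if "B \<in> S'" "D \<in> {A, Ac}" for B D
    using that(1) unfolding S'_def
  proof (induction rule: sigma_sets.induct)
    case (Basic a)
    have e: "{} \<in> S" "space M \<in> S" using S(1) by (auto simp: sigma_algebra_iff2)
    show ?case
    proof (cases "a = A")
      case True
      show ?thesis using that(2) e AsM unfolding True Ac_def
        by (cases "D = A") (auto intro: bexI[of _ "space M"] bexI[of _ "{}"])
    next
      case False
      then show ?thesis using Basic by blast
    qed
  next
    case Empty
    then show ?case using S(1) by (auto simp: sigma_algebra_iff2)
  next
    case (Compl a)
    then obtain E where E: "E \<in> S" "a \<inter> D = E \<inter> D" by blast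
    have "space M - E \<in> S" using S(1) E(1) by (auto simp: sigma_algebra_iff2)
    moreover have "(space M - a) \<inter> D = (space M - E) \<inter> D" using E(2) by blast
    ultimately show ?case by blast
  next
    case (Union a)
    then obtain E where E: "\<And>i. E i \<in> S" "\<And>i. a i \<inter> D = E i \<inter> D" by metis
    have "range E \<subseteq> S" using E(1) by blast
    then have "(\<Union>i. E i) \<in> S" using S(1) by (auto simp: sigma_algebra_iff2)
    moreover have "(\<Union>i. a i) \<inter> D = (\<Union>i. E i) \<inter> D" using E(2) by blast
    ultimately show ?case by blast
  qed
  have ex_g: "\<exists>g\<in>borel_measurable ?N. \<forall>x\<in>space M \<inter> D. f x = g x"
    if f: "f \<in> bdd_fns M S'" and D: "D \<in> {A, Ac}" for f D
    using trace_measurable_ex[of "sigma (space M) S'" ?N D f] tr[OF _ D] f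
    unfolding N N' bdd_fns_def by auto
  define R where "R f x = (if x \<in> A then \<rho> (trace_exp ?N A f) x else \<rho> (trace_exp ?N Ac f) x)" for f x
  have int: "integrable M f" if "f \<in> bdd_fns M S'" for f by (rule bdd_fns_integrable[OF that sa sub])
  have tb: "trace_exp ?N D f \<in> bdd_fns M S" if f: "f \<in> bdd_fns M S'" and D: "D \<in> {A, Ac}" for f D
  proof -
    obtain C where "AE x in M. \<bar>f x\<bar> \<le> C" using f by (auto simp: bdd_fns_def)
    then show ?thesis using D A Ac by (intro trace_exp_bdd_fns[OF S _ int[OF f]]) auto
  qed
  \<comment> \<open>Agreement is required at every point, so \<open>trace_exp\<close> has to return
    an old function a.e. on the whole space and not just on \<open>D\<close>. The second summand in
    its definition serves this purpose.\<close>
  have le: "R f = \<rho> f" if f: "f \<in> bdd_fns M S" for f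
  proof -
    have f': "f \<in> bdd_fns M S'" using bdd_fns_mono[OF S sa sub SS'] f by blast
    have "\<rho> (trace_exp ?N D f) = \<rho> f" if D: "D \<in> {A, Ac}" for D
    proof (rule lifting_on_cong[OF L tb[OF f' D] f])
      have "D \<in> sets M" using D A Ac by blast
      moreover have "f \<in> borel_measurable ?N" using f unfolding bdd_fns_def by blast
      ultimately show "AE x in M. trace_exp ?N D f x = f x" using trace_exp_subalgebra[OF N(3)] int[OF f'] by blast
    qed
    from this[of A] this[of Ac] show ?thesis by (simp add: R_def fun_eq_iff)
  qed
  have R_on: "lifting_on M (S', restrict R (bdd_fns M S'))"
  proof (rule lifting_onI[OF sa sub])
    fix f assume f: "f \<in> bdd_fns M S'"
    have 1: "AE x in M. x \<in> D \<longrightarrow> \<rho> (trace_exp ?N D f) x = f x" if D: "D \<in> {A, Ac}" for D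
    proof -
      obtain g where "g \<in> borel_measurable ?N" "\<forall>x\<in>space M \<inter> D. f x = g x" using ex_g[OF f D] by blast
      then have "AE x in M. x \<in> D \<longrightarrow> trace_exp ?N D f x = f x"
        using D A Ac by (intro trace_exp_on[OF N(3) _ int[OF f]]) auto
      with lifting_onD(4)[OF L tb[OF f D]] show ?thesis by eventually_elim auto
    qed
    from 1[of A] 1[of Ac] AE_space show "AE x in M. R f x = f x"
      by (auto simp: R_def Ac_def elim!: eventually_mono)
  next
    fix f g x assume f: "f \<in> bdd_fns M S'" and g: "g \<in> bdd_fns M S'"
    have "\<rho> (trace_exp ?N D (\<lambda>x. f x + g x)) = (\<lambda>x. \<rho> (trace_exp ?N D f) x + \<rho> (trace_exp ?N D g) x)"
      if D: "D \<in> {A, Ac}" for D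
    proof -
      have "\<rho> (trace_exp ?N D (\<lambda>x. f x + g x)) = \<rho> (\<lambda>x. trace_exp ?N D f x + trace_exp ?N D g x)"
        by (rule lifting_on_cong[OF L tb[OF bdd_fns_add[OF f g] D] bdd_fns_add[OF tb[OF f D] tb[OF g D]]
          trace_exp_add[OF N(3) _ int[OF f] int[OF g]]]) (use D A Ac in auto)
      then show ?thesis using lifting_onD(5)[OF L tb[OF f D] tb[OF g D]] by simp
    qed
    from this[of A] this[of Ac] show "R (\<lambda>x. f x + g x) x = R f x + R g x" by (simp add: R_def)
  next
    fix f c x assume f: "f \<in> bdd_fns M S'"
    have "\<rho> (trace_exp ?N D (\<lambda>x. c * f x)) = (\<lambda>x. c * \<rho> (trace_exp ?N D f) x)"
      if D: "D \<in> {A, Ac}" for D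
    proof -
      have "\<rho> (trace_exp ?N D (\<lambda>x. c * f x)) = \<rho> (\<lambda>x. c * trace_exp ?N D f x)"
        by (rule lifting_on_cong[OF L tb[OF bdd_fns_cmult[OF f] D] bdd_fns_cmult[OF tb[OF f D]]
          trace_exp_cmult[OF N(3) _ int[OF f]]]) (use D A Ac in auto)
      then show ?thesis using lifting_onD(6)[OF L tb[OF f D]] by simp
    qed
    from this[of A] this[of Ac] show "R (\<lambda>x. c * f x) x = c * R f x" by (simp add: R_def)
  next
    fix f x assume f: "f \<in> bdd_fns M S'" and pos: "AE x in M. 0 \<le> f x"
    have "0 \<le> \<rho> (trace_exp ?N D f) x" if D: "D \<in> {A, Ac}" for D
      by (rule lifting_onD(7)[OF L tb[OF f D] trace_exp_nonneg[OF N(3) _ int[OF f] pos]]) (use D A Ac in auto)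
    from this[of A] this[of Ac] show "0 \<le> R f x" by (simp add: R_def)
  next
    show "R (\<lambda>_. 1) x = 1" for x
      using le[OF bdd_fns_const, of 1] lifting_onD(8)[OF L] by simp
  qed
  moreover have "lifting_le M (S, \<rho>) (S', restrict R (bdd_fns M S'))"
    using le bdd_fns_mono[OF S sa sub SS'] SS' unfolding lifting_le_def by auto
  ultimately show ?thesis using AS' by blast
qed

end

section \<open>Chains of liftings and Zorn's lemma\<close>

context prob_space
begin

lemma lifting_le_refl: "lifting_le M a a"
  by (simp add: lifting_le_def split_beta)

lemma lifting_le_trans:
  assumes "lifting_on M a" "lifting_on M b" "lifting_on M c" "lifting_le M a b" "lifting_le M b c"
  shows "lifting_le M a c"
proof -
  obtain S \<rho> S' \<rho>' S'' \<rho>'' where [simp]: "a = (S, \<rho>)" "b = (S', \<rho>')" "c = (S'', \<rho>'')"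
    by (metis surj_pair)
  have "bdd_fns M S \<subseteq> bdd_fns M S'"
    using assms lifting_onD(1,2) by (intro bdd_fns_mono) (auto simp: lifting_le_def)
  then show ?thesis using assms(4,5) by (auto simp: lifting_le_def)
qed

lemma lifting_le_antisym:
  assumes "lifting_on M a" "lifting_on M b" "lifting_le M a b" "lifting_le M b a"
  shows "a = b"
proof -
  obtain S \<rho> S' \<rho>' where [simp]: "a = (S, \<rho>)" "b = (S', \<rho>')" by (metis surj_pair)
  have eq: "S = S'" using assms(3,4) by (auto simp: lifting_le_def)
  have "\<rho> = \<rho>'"
  proof (rule extensionalityI)
    show "\<rho> \<in> extensional (bdd_fns M S)" "\<rho>' \<in> extensional (bdd_fns M S)"
      using lifting_onD(3)[of S \<rho>] lifting_onD(3)[of S' \<rho>'] assms(1,2) eq by auto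
    show "f \<in> bdd_fns M S \<Longrightarrow> \<rho> f = \<rho>' f" for f using assms(3) by (auto simp: lifting_le_def)
  qed
  then show ?thesis using eq by simp
qed

text \<open>Conditioning on \<open>S n\<close> brings a function of the generated \<sigma>-algebra
  into the domain of \<open>\<rho> n\<close>. A function from stage \<open>m\<close> gives a
  constant sequence from \<open>m\<close> on, so the limit extends \<open>\<rho> m\<close>;
  linearity and positivity survive limits along one fixed filter.\<close>

lemma lifting_sequence:
  fixes S :: "nat \<Rightarrow> 'a set set" and \<rho> :: "nat \<Rightarrow> ('a \<Rightarrow> real) \<Rightarrow> 'a \<Rightarrow> real"
  assumes L: "\<And>n. lifting_on M (S n, \<rho> n)"
    and le: "\<And>m n. m \<le> n \<Longrightarrow> lifting_le M (S m, \<rho> m) (S n, \<rho> n)"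
  shows "\<exists>u. lifting_on M u \<and> (\<forall>n. lifting_le M (S n, \<rho> n) u)"
proof -
  let ?F = "\<lambda>n. sigma (space M) (S n)"
  have S: "sigma_algebra (space M) (S n)" "S n \<subseteq> sets M" for n
    using lifting_onD(1,2)[OF L[of n]] by auto
  have N: "sets (?F n) = S n" "space (?F n) = space M" "subalgebra M (?F n)" for n
    using subalgebra_sigma[OF S] by auto
  interpret subalgebra_filtration M ?F
    by unfold_locales (use N le in \<open>auto simp: lifting_le_def\<close>)
  \<comment> \<open>The martingale may diverge on a null set, where a value is required
    nevertheless; \<open>U\<close> provides one for every bounded sequence, consistently for sums
    and multiples.\<close>
  obtain U where U: "U \<le> sequentially" "U \<noteq> bot" "\<And>x :: nat \<Rightarrow> real. Bseq x \<Longrightarrow> \<exists>l. (x \<longlongrightarrow> l) U"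
    using bounded_limit_filter_exists by blast
  define T where "T = sets G"
  have sa: "sigma_algebra (space M) T"
    unfolding T_def using sets.sigma_algebra_axioms[of G] by simp
  have sub: "T \<subseteq> sets M" unfolding T_def using subalg_G by (simp add: subalgebra_def)
  have ST: "S n \<subseteq> T" for n unfolding T_def sets_G using N(1) by auto
  have bT: "f \<in> borel_measurable G" if "f \<in> bdd_fns M T" for f
    using that subalgebra_sigma[OF sa sub] by (simp add: bdd_fns_def measurable_def T_def)
  let ?E = "\<lambda>n. real_cond_exp M (?F n)"
  have int: "integrable M f" if "f \<in> bdd_fns M T" for f by (rule bdd_fns_integrable[OF that sa sub])
  have bound: "AE x in M. \<bar>?E n f x\<bar> \<le> C" if f: "f \<in> bdd_fns M T" and C: "AE x in M. \<bar>f x\<bar> \<le> C" for f n C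
  proof -
    interpret s: sigma_finite_subalgebra M "?F n" by (rule sigma_finite_F)
    have "AE x in M. ?E n f x \<le> C"
      by (rule s.real_cond_exp_le_c[OF int[OF f]]) (use C in auto)
    moreover have "AE x in M. ?E n f x \<ge> - C"
      by (rule s.real_cond_exp_ge_c[OF int[OF f]]) (use C in \<open>auto elim!: eventually_mono\<close>)
    ultimately show ?thesis by eventually_elim auto
  qed
  have Eb: "?E n f \<in> bdd_fns M (S n)" if f: "f \<in> bdd_fns M T" for f n
  proof -
    obtain C where "AE x in M. \<bar>f x\<bar> \<le> C" using f by (auto simp: bdd_fns_def)
    from bound[OF f this, of n] show ?thesis unfolding bdd_fns_def by auto
  qed
  define R where "R f x = Lim U (\<lambda>n. \<rho> n (?E n f) x)" for f x
  have R: "((\<lambda>n. \<rho> n (?E n f) x) \<longlongrightarrow> R f x) U" if f: "f \<in> bdd_fns M T" for f x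
  proof -
    obtain C where C: "AE x in M. \<bar>f x\<bar> \<le> C" using f by (auto simp: bdd_fns_def)
    have "\<bar>\<rho> n (?E n f) x\<bar> \<le> C" for n by (rule lifting_on_bound[OF L Eb[OF f] bound[OF f C]])
    then have "Bseq (\<lambda>n. \<rho> n (?E n f) x)" by (intro BseqI'[of _ C]) simp
    from U(3)[OF this] obtain l where l: "((\<lambda>n. \<rho> n (?E n f) x) \<longlongrightarrow> l) U" by (rule exE)
    then show ?thesis unfolding R_def tendsto_Lim[OF U(2) l] .
  qed
  have R_eq: "R f x = l" if "f \<in> bdd_fns M T" "((\<lambda>n. \<rho> n (?E n f) x) \<longlongrightarrow> l) U" for f x l
    using tendsto_unique[OF U(2) R[OF that(1)] that(2)] .
  have ext: "R f = \<rho> m f" if f: "f \<in> bdd_fns M (S m)" for f m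
  proof
    fix x
    have fT: "f \<in> bdd_fns M T" using bdd_fns_mono[OF S sa sub ST] f by blast
    have "\<rho> n (?E n f) = \<rho> m f" if n: "n \<ge> m" for n
    proof -
      interpret s: sigma_finite_subalgebra M "?F n" by (rule sigma_finite_F)
      have fn: "f \<in> bdd_fns M (S n)"
        using bdd_fns_mono[OF S S] le[OF n] f by (auto simp: lifting_le_def)
      have "AE x in M. ?E n f x = f x"
        by (rule s.real_cond_exp_F_meas[OF int[OF fT]]) (use fn in \<open>simp add: bdd_fns_def\<close>)
      then have "\<rho> n (?E n f) = \<rho> n f" by (rule lifting_on_cong[OF L Eb[OF fT] fn])
      then show ?thesis using le[OF n] f by (simp add: lifting_le_def)
    qed
    then have "eventually (\<lambda>n. \<rho> n (?E n f) x = \<rho> m f x) sequentially"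
      unfolding eventually_sequentially by (intro exI[of _ m] allI impI) simp
    then have "((\<lambda>n. \<rho> n (?E n f) x) \<longlongrightarrow> \<rho> m f x) sequentially" by (rule tendsto_eventually)
    then show "R f x = \<rho> m f x" by (intro R_eq[OF fT] tendsto_mono[OF U(1)])
  qed
  have "lifting_on M (T, restrict R (bdd_fns M T))"
  proof (rule lifting_onI[OF sa sub])
    fix f assume f: "f \<in> bdd_fns M T"
    have "AE x in M. \<forall>n. \<rho> n (?E n f) x = ?E n f x"
      unfolding AE_all_countable using lifting_onD(4)[OF L Eb[OF f]] by blast
    with real_cond_exp_tendsto[OF int[OF f] bT[OF f]] show "AE x in M. R f x = f x"
    proof eventually_elim
      case (elim x)
      then show ?case by (intro R_eq[OF f] tendsto_mono[OF U(1)]) simp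
    qed
  next
    fix f g x assume f: "f \<in> bdd_fns M T" and g: "g \<in> bdd_fns M T"
    have "\<rho> n (?E n (\<lambda>x. f x + g x)) x = \<rho> n (?E n f) x + \<rho> n (?E n g) x" for n
    proof -
      interpret s: sigma_finite_subalgebra M "?F n" by (rule sigma_finite_F)
      have "\<rho> n (?E n (\<lambda>x. f x + g x)) = \<rho> n (\<lambda>x. ?E n f x + ?E n g x)"
        by (rule lifting_on_cong[OF L Eb[OF bdd_fns_add[OF f g]] bdd_fns_add[OF Eb[OF f] Eb[OF g]]
          s.real_cond_exp_add[OF int[OF f] int[OF g]]])
      then show ?thesis using lifting_onD(5)[OF L Eb[OF f] Eb[OF g]] by simp
    qed
    then show "R (\<lambda>x. f x + g x) x = R f x + R g x"
      using tendsto_add[OF R[OF f] R[OF g]] by (intro R_eq[OF bdd_fns_add[OF f g]]) simp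
  next
    fix f c x assume f: "f \<in> bdd_fns M T"
    have "\<rho> n (?E n (\<lambda>x. c * f x)) x = c * \<rho> n (?E n f) x" for n
    proof -
      interpret s: sigma_finite_subalgebra M "?F n" by (rule sigma_finite_F)
      have "\<rho> n (?E n (\<lambda>x. c * f x)) = \<rho> n (\<lambda>x. c * ?E n f x)"
        by (rule lifting_on_cong[OF L Eb[OF bdd_fns_cmult[OF f]] bdd_fns_cmult[OF Eb[OF f]]
          s.real_cond_exp_cmult[OF int[OF f]]])
      then show ?thesis using lifting_onD(6)[OF L Eb[OF f]] by simp
    qed
    then show "R (\<lambda>x. c * f x) x = c * R f x"
      using tendsto_mult_left[OF R[OF f], of c] by (intro R_eq[OF bdd_fns_cmult[OF f]]) simp
  next
    fix f x assume f: "f \<in> bdd_fns M T" and pos: "AE x in M. 0 \<le> f x"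
    have "0 \<le> \<rho> n (?E n f) x" for n
    proof -
      interpret s: sigma_finite_subalgebra M "?F n" by (rule sigma_finite_F)
      have "AE x in M. 0 \<le> ?E n f x"
        by (rule s.real_cond_exp_pos[OF pos]) (use int[OF f] in auto)
      then show ?thesis by (rule lifting_onD(7)[OF L Eb[OF f]])
    qed
    then show "0 \<le> R f x" by (intro tendsto_lowerbound[OF R[OF f] _ U(2)]) auto
  next
    show "R (\<lambda>_. 1) x = 1" for x
      using ext[OF bdd_fns_const, of 1 0] lifting_onD(8)[OF L] by simp
  qed
  moreover have "lifting_le M (S n, \<rho> n) (T, restrict R (bdd_fns M T))" for n
    using ext ST[of n] bdd_fns_mono[OF S[of n] sa sub ST] unfolding lifting_le_def by auto
  ultimately show ?thesis by (intro exI[of _ "(T, restrict R (bdd_fns M T))"] conjI allI)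
qed

text \<open>In a chain without countable cofinal subset, countably many conditions are always met at a common
  stage, so that the union of the chain is already a lifting on a \<open>\<sigma>\<close>-algebra.\<close>

lemma lifting_union:
  assumes L: "\<And>a. a \<in> C \<Longrightarrow> lifting_on M a"
    and tot: "\<And>a b. a \<in> C \<Longrightarrow> b \<in> C \<Longrightarrow> lifting_le M a b \<or> lifting_le M b a"
    and ub: "\<And>D. countable D \<Longrightarrow> D \<subseteq> C \<Longrightarrow> \<exists>c\<in>C. \<forall>d\<in>D. lifting_le M d c"
  shows "\<exists>u. lifting_on M u \<and> (\<forall>a\<in>C. lifting_le M a u)"
proof -
  have L': "(S, \<rho>) \<in> C \<Longrightarrow> lifting_on M (S, \<rho>)" for S \<rho> using L by blast
  define T where "T = (\<Union>a\<in>C. fst a)"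
  have ne: "C \<noteq> {}" using ub[of "{}"] by auto
  have common: "\<exists>S \<rho>. (S, \<rho>) \<in> C \<and> range A \<subseteq> S" if A: "range A \<subseteq> T" for A :: "nat \<Rightarrow> 'a set"
  proof -
    have "\<forall>n. \<exists>a\<in>C. A n \<in> fst a" using A by (auto simp: T_def)
    then obtain a where a: "\<And>n. a n \<in> C" "\<And>n. A n \<in> fst (a n)" by metis
    have "countable (range a)" "range a \<subseteq> C" using a(1) by auto
    then obtain c where c: "c \<in> C" "\<forall>d\<in>range a. lifting_le M d c" using ub by blast
    have "A n \<in> fst c" for n using c(2) a(2)[of n] by (auto simp: lifting_le_def split_beta)
    then show ?thesis using c(1) by (intro exI[of _ "fst c"] exI[of _ "snd c"]) auto
  qed
  have inT: "x \<in> T" if "(S, \<rho>) \<in> C" "x \<in> S" for S \<rho> x using that by (force simp: T_def)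
  have sub: "T \<subseteq> sets M"
  proof
    fix x assume "x \<in> T"
    then obtain S \<rho> where a: "(S, \<rho>) \<in> C" "x \<in> S" by (auto simp: T_def)
    then show "x \<in> sets M" using lifting_onD(2)[OF L'[OF a(1)]] by blast
  qed
  have sa: "sigma_algebra (space M) T"
    unfolding sigma_algebra_iff2
  proof (intro conjI ballI allI impI)
    show "T \<subseteq> Pow (space M)" using sub sets.space_closed by blast
    obtain S \<rho> where a: "(S, \<rho>) \<in> C" using ne by auto
    have "{} \<in> S" using lifting_onD(1)[OF L'[OF a]] unfolding sigma_algebra_iff2 by blast
    then show "{} \<in> T" by (rule inT[OF a])
    show "space M - s \<in> T" if s: "s \<in> T" for s
    proof -
      obtain S \<rho> where a: "(S, \<rho>) \<in> C" "s \<in> S" using s by (auto simp: T_def)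
      have "space M - s \<in> S"
        using lifting_onD(1)[OF L'[OF a(1)]] a(2) unfolding sigma_algebra_iff2 by blast
      then show ?thesis by (rule inT[OF a(1)])
    qed
    show "\<Union> (range A) \<in> T" if A: "range A \<subseteq> T" for A :: "nat \<Rightarrow> 'a set"
    proof -
      obtain S \<rho> where a: "(S, \<rho>) \<in> C" "range A \<subseteq> S" using common[OF A] by blast
      have "\<Union> (range A) \<in> S"
        using lifting_onD(1)[OF L'[OF a(1)]] a(2) unfolding sigma_algebra_iff2 by blast
      then show ?thesis by (rule inT[OF a(1)])
    qed
  qed
  have stage: "\<exists>S \<rho>. (S, \<rho>) \<in> C \<and> f \<in> bdd_fns M S" if f: "f \<in> bdd_fns M T" for f
  proof -
    \<comment> \<open>Cuts of \<open>f\<close> at the rationals: these countably many sets lie in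
      one member of the chain, and they decide the measurability of \<open>f\<close>.\<close>
    define A where "A n = {x \<in> space M. f x < of_rat (from_nat n)}" for n
    have "A n \<in> T" for n
    proof -
      have "{x \<in> space (sigma (space M) T). f x < of_rat (from_nat n)} \<in> sets (sigma (space M) T)"
        by (rule borel_measurable_less) (use f in \<open>auto simp: bdd_fns_def\<close>)
      then show ?thesis unfolding subalgebra_sigma[OF sa sub] A_def .
    qed
    then obtain S \<rho> where S: "(S, \<rho>) \<in> C" "range A \<subseteq> S" using common[of A] by blast
    note sS = lifting_onD(1,2)[OF L'[OF S(1)]]
    have "f \<in> borel_measurable (sigma (space M) S)"
    proof (rule borel_measurableI_less)
      fix y :: real
      have "{x \<in> space M. f x < y} = (\<Union>n\<in>{n. of_rat (from_nat n) \<le> y}. A n)"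
      proof safe
        fix x assume x: "x \<in> space M" "f x < y"
        obtain q where q: "f x < of_rat q" "of_rat q < y" using of_rat_dense[OF x(2)] by blast
        then have "to_nat q \<in> {n. real_of_rat (from_nat n) \<le> y}" "x \<in> A (to_nat q)"
          using x(1) by (auto simp: A_def)
        then show "x \<in> (\<Union>n\<in>{n. of_rat (from_nat n) \<le> y}. A n)" by blast
      qed (auto simp: A_def)
      also have "\<dots> \<in> sets (sigma (space M) S)"
        using S(2) by (intro sets.countable_UN) (auto simp: subalgebra_sigma[OF sS])
      finally show "{x \<in> space (sigma (space M) S). f x < y} \<in> sets (sigma (space M) S)"
        by (simp only: subalgebra_sigma(2)[OF sS])
    qed
    then show ?thesis using S(1) f by (auto simp: bdd_fns_def)
  qed
  \<comment> \<open>Any stage that contains \<open>f\<close> may be chosen, since comparable stages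
    agree on it.\<close>
  define R where "R f = snd (SOME a. a \<in> C \<and> f \<in> bdd_fns M (fst a)) f" for f
  have R: "R f = \<rho> f" if a: "(S, \<rho>) \<in> C" and f: "f \<in> bdd_fns M S" for S \<rho> f
  proof -
    define b where "b = (SOME a. a \<in> C \<and> f \<in> bdd_fns M (fst a))"
    have b: "b \<in> C \<and> f \<in> bdd_fns M (fst b)"
      unfolding b_def by (rule someI[of _ "(S, \<rho>)"]) (use a f in auto)
    then show ?thesis using tot[OF a, of b] f by (auto simp: lifting_le_def split_beta R_def b_def)
  qed
  have stage2: "\<exists>S \<rho>. (S, \<rho>) \<in> C \<and> f \<in> bdd_fns M S \<and> g \<in> bdd_fns M S"
    if f: "f \<in> bdd_fns M T" and g: "g \<in> bdd_fns M T" for f g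
  proof -
    obtain S \<rho> where a: "(S, \<rho>) \<in> C" "f \<in> bdd_fns M S" using stage[OF f] by blast
    obtain S' \<rho>' where b: "(S', \<rho>') \<in> C" "g \<in> bdd_fns M S'" using stage[OF g] by blast
    note s = lifting_onD(1,2)[OF L'[OF a(1)]] lifting_onD(1,2)[OF L'[OF b(1)]]
    have "S \<subseteq> S' \<or> S' \<subseteq> S" using tot[OF a(1) b(1)] by (auto simp: lifting_le_def)
    then have "bdd_fns M S \<subseteq> bdd_fns M S' \<or> bdd_fns M S' \<subseteq> bdd_fns M S"
      using bdd_fns_mono[OF s] bdd_fns_mono[OF s(3,4) s(1,2)] by blast
    then show ?thesis using a b by blast
  qed
  have "lifting_on M (T, restrict R (bdd_fns M T))"
  proof (rule lifting_onI[OF sa sub])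
    fix f assume "f \<in> bdd_fns M T"
    then obtain S \<rho> where a: "(S, \<rho>) \<in> C" "f \<in> bdd_fns M S" using stage by blast
    show "AE x in M. R f x = f x" using lifting_onD(4)[OF L'[OF a(1)] a(2)] R[OF a] by simp
    show "R (\<lambda>x. c * f x) x = c * R f x" for c x
      using lifting_onD(6)[OF L'[OF a(1)] a(2), of c] R[OF a] R[OF a(1) bdd_fns_cmult[OF a(2)], of c] by simp
    show "0 \<le> R f x" if "AE x in M. 0 \<le> f x" for x
      using lifting_onD(7)[OF L'[OF a(1)] a(2) that] R[OF a] by simp
  next
    fix f g x assume "f \<in> bdd_fns M T" "g \<in> bdd_fns M T"
    then obtain S \<rho> where a: "(S, \<rho>) \<in> C" "f \<in> bdd_fns M S" "g \<in> bdd_fns M S" using stage2 by blast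
    show "R (\<lambda>x. f x + g x) x = R f x + R g x"
      using lifting_onD(5)[OF L'[OF a(1)] a(2,3)] R[OF a(1,2)] R[OF a(1,3)]
        R[OF a(1) bdd_fns_add[OF a(2,3)]] by simp
  next
    fix x
    obtain S \<rho> where a: "(S, \<rho>) \<in> C" using ne by auto
    show "R (\<lambda>_. 1) x = 1" using R[OF a bdd_fns_const, of 1] lifting_onD(8)[OF L'[OF a]] by simp
  qed
  moreover have "lifting_le M a (T, restrict R (bdd_fns M T))" if a: "a \<in> C" for a
  proof -
    obtain S \<rho> where [simp]: "a = (S, \<rho>)" by (metis surj_pair)
    have ST: "S \<subseteq> T" using a by (force simp: T_def)
    have "bdd_fns M S \<subseteq> bdd_fns M T"
      using lifting_onD(1,2)[OF L'[of S \<rho>]] a ST by (intro bdd_fns_mono sa sub) auto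
    then show ?thesis using ST R a by (auto simp: lifting_le_def)
  qed
  ultimately show ?thesis by (intro exI[of _ "(T, restrict R (bdd_fns M T))"] conjI ballI)
qed

text \<open>Either every countable part of the chain is bounded within the chain, and the union
  works, or some countable \<open>D\<close> is not. By totality such a \<open>D\<close> is cofinal,
  and an increasing sequence extracted from it reduces the claim to
  \<open>lifting_sequence\<close>.\<close>

lemma lifting_chain_ub:
  assumes ne: "C \<noteq> {}" and L: "\<And>a. a \<in> C \<Longrightarrow> lifting_on M a"
    and tot: "\<And>a b. a \<in> C \<Longrightarrow> b \<in> C \<Longrightarrow> lifting_le M a b \<or> lifting_le M b a"
  shows "\<exists>u. lifting_on M u \<and> (\<forall>a\<in>C. lifting_le M a u)"
proof (cases "\<forall>D. countable D \<longrightarrow> D \<subseteq> C \<longrightarrow> (\<exists>c\<in>C. \<forall>d\<in>D. lifting_le M d c)")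
  case True
  show ?thesis
  proof (rule lifting_union)
    show "lifting_on M a" if "a \<in> C" for a by (rule L[OF that])
    show "lifting_le M a b \<or> lifting_le M b a" if "a \<in> C" "b \<in> C" for a b by (rule tot[OF that])
    show "\<exists>c\<in>C. \<forall>d\<in>D. lifting_le M d c" if "countable D" "D \<subseteq> C" for D
      using True that by simp
  qed
next
  case False
  then obtain D where D: "countable D" "D \<subseteq> C" "\<forall>c\<in>C. \<exists>d\<in>D. \<not> lifting_le M d c"
    by (simp only: not_all not_imp bex_simps ball_simps) (elim exE conjE, rule that, simp_all)
  have cof: "\<exists>d\<in>D. lifting_le M c d" if c: "c \<in> C" for c
  proof -
    obtain d where "d \<in> D" "\<not> lifting_le M d c" using D(3) c by blast
    then show ?thesis using tot[OF c, of d] D(2) by auto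
  qed
  have Dne: "D \<noteq> {}" using cof ne by blast
  define d where "d = from_nat_into D"
  have dD: "d n \<in> D" for n unfolding d_def by (rule from_nat_into[OF Dne])
  then have dC: "d n \<in> C" for n using D(2) by blast
  \<comment> \<open>The running maximum of the enumeration \<open>d\<close>, which itself may fail
    to be monotone.\<close>
  define e where "e = rec_nat (d 0) (\<lambda>n x. if lifting_le M x (d (Suc n)) then d (Suc n) else x)"
  have e0: "e 0 = d 0" and eS: "e (Suc n) = (if lifting_le M (e n) (d (Suc n)) then d (Suc n) else e n)" for n
    by (simp_all add: e_def)
  have eC: "e n \<in> C" for n by (induction n) (auto simp: e0 eS dC)
  have e_step: "lifting_le M (e n) (e (Suc n))" for n by (simp add: eS lifting_le_refl)
  have emono: "lifting_le M (e m) (e n)" if "m \<le> n" for m n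
    using that
  proof (induction n rule: dec_induct)
    case (step n)
    show ?case by (rule lifting_le_trans[OF L[OF eC] L[OF eC] L[OF eC] step(3) e_step])
  qed (rule lifting_le_refl)
  have de: "lifting_le M (d n) (e n)" for n
    by (cases n) (use tot[OF eC dC] in \<open>auto simp: e0 eS lifting_le_refl\<close>)
  obtain u where u: "lifting_on M u" "\<And>n. lifting_le M (e n) u"
    using lifting_sequence[of "\<lambda>n. fst (e n)" "\<lambda>n. snd (e n)"] L[OF eC] emono by auto
  have "lifting_le M c u" if c: "c \<in> C" for c
  proof -
    obtain x where x: "x \<in> D" "lifting_le M c x" using cof[OF c] by blast
    obtain n where n: "x = d n" using from_nat_into_surj[OF D(1) x(1)] unfolding d_def by blast
    have "lifting_le M c (e n)"
      by (rule lifting_le_trans[OF L[OF c] L[OF dC] L[OF eC] _ de]) (use x(2) n in simp)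
    then show ?thesis by (rule lifting_le_trans[OF L[OF c] L[OF eC] u(1) _ u(2)])
  qed
  then show ?thesis using u(1) by blast
qed

text \<open>A maximal partial lifting already has every measurable set in its \<sigma>-algebra,
  since \<open>lifting_extend\<close> would enlarge it otherwise.\<close>

theorem linear_lifting_exists: "\<exists>\<rho>. lifting_on M (sets M, \<rho>)"
proof -
  let ?A = "Collect (lifting_on M)"
  have "\<exists>m\<in>?A. \<forall>a\<in>?A. lifting_le M m a \<longrightarrow> a = m"
  proof (rule predicate_Zorn)
    show "partial_order_on ?A (relation_of (lifting_le M) ?A)"
    proof (rule partial_order_on_relation_ofI)
      show "lifting_le M a a" for a by (rule lifting_le_refl)
      show "lifting_le M a c" if "a \<in> ?A" "b \<in> ?A" "c \<in> ?A" "lifting_le M a b" "lifting_le M b c" for a b c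
        using lifting_le_trans[of a b c] that by simp
      show "a = b" if "a \<in> ?A" "b \<in> ?A" "lifting_le M a b" "lifting_le M b a" for a b
        using lifting_le_antisym[of a b] that by simp
    qed
    fix C assume C: "C \<in> Chains (relation_of (lifting_le M) ?A)"
    have L: "lifting_on M a" if "a \<in> C" for a using C that by (auto simp: Chains_def relation_of_def)
    have tot: "lifting_le M a b \<or> lifting_le M b a" if "a \<in> C" "b \<in> C" for a b
      using C that by (auto simp: Chains_def relation_of_def)
    show "\<exists>u\<in>?A. \<forall>a\<in>C. lifting_le M a u"
    proof (cases "C = {}")
      case True
      then show ?thesis using lifting_trivial by auto
    next
      case False
      from lifting_chain_ub[OF this L tot] show ?thesis by auto
    qed
  qed
  then obtain S \<rho> where m: "lifting_on M (S, \<rho>)" "\<And>a. lifting_on M a \<Longrightarrow> lifting_le M (S, \<rho>) a \<Longrightarrow> a = (S, \<rho>)"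
    by auto
  have "A \<in> S" if "A \<in> sets M" for A using lifting_extend[OF m(1) that] m(2) by blast
  then have "S = sets M" using lifting_onD(2)[OF m(1)] by blast
  then show ?thesis using m(1) by blast
qed

end

text \<open>Preimages under \<open>f\<close> and \<open>g\<close> differ within a null set, and
  completeness makes them measurable together. This supplies the measurability of functions produced
  by a lifting.\<close>

lemma (in complete_measure) borel_measurable_AE_cong:
  fixes f g :: "'a \<Rightarrow> 'x::topological_space"
  assumes g: "g \<in> borel_measurable M" and eq: "AE x in M. f x = g x"
  shows "f \<in> borel_measurable M"
proof (rule measurableI)
  fix B :: "'x set" assume B: "B \<in> sets borel"
  show "f -` B \<inter> space M \<in> sets M"
  proof (rule in_sets_AE)
    show "g -` B \<inter> space M \<in> sets M" by (rule measurable_sets[OF g B])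
    show "AE x in M. x \<in> g -` B \<inter> space M \<longleftrightarrow> x \<in> f -` B \<inter> space M"
      using eq by eventually_elim auto
  qed auto
qed simp

section \<open>Linear selections from a.e. linear families\<close>

context prob_space
begin

lemma bdd_fns_sets: "f \<in> bdd_fns M (sets M) \<longleftrightarrow> f \<in> borel_measurable M \<and> (\<exists>C. AE x in M. \<bar>f x\<bar> \<le> C)"
  using subalgebra_sigma(1)[OF sets.sigma_algebra_axioms order_refl]
  by (simp add: bdd_fns_def measurable_def space_measure_of[OF sets.space_closed])

text \<open>Lets a lifting commute with real-linear functionals of finitely many
  coordinates.\<close>

lemma lifting_on_sum:
  assumes L: "lifting_on M (S, \<rho>)" and I: "finite I" and f: "\<And>i. i \<in> I \<Longrightarrow> f i \<in> bdd_fns M S"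
  shows "(\<lambda>x. \<Sum>i\<in>I. f i x * c i) \<in> bdd_fns M S \<and>
    \<rho> (\<lambda>x. \<Sum>i\<in>I. f i x * c i) = (\<lambda>x. \<Sum>i\<in>I. \<rho> (f i) x * c i)"
  using I f
proof (induction I rule: finite_induct)
  case empty
  then show ?case using lifting_on_const[OF L, of 0] bdd_fns_const[of 0 S] by simp
next
  case (insert j I)
  have IH: "(\<lambda>x. \<Sum>i\<in>I. f i x * c i) \<in> bdd_fns M S"
      "\<rho> (\<lambda>x. \<Sum>i\<in>I. f i x * c i) = (\<lambda>x. \<Sum>i\<in>I. \<rho> (f i) x * c i)"
    using insert.IH insert.prems by auto
  have j: "(\<lambda>x. c j * f j x) \<in> bdd_fns M S"
    by (rule bdd_fns_cmult) (simp add: insert.prems)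
  have "\<rho> (\<lambda>x. c j * f j x) = (\<lambda>x. c j * \<rho> (f j) x)"
    by (rule lifting_onD(6)[OF L]) (simp add: insert.prems)
  then have "\<rho> (\<lambda>x. c j * f j x + (\<Sum>i\<in>I. f i x * c i)) = (\<lambda>x. c j * \<rho> (f j) x + (\<Sum>i\<in>I. \<rho> (f i) x * c i))"
    using lifting_onD(5)[OF L j IH(1)] IH(2) by simp
  then show ?case using insert.hyps bdd_fns_add[OF j IH(1)] by (simp add: mult.commute)
qed

text \<open>Each instance of a hypothesis has its own null set; the lifting removes them all. It
  acts on real functions, so values in \<open>'k\<close> are lifted coordinatewise, and homogeneity
  over \<open>'k\<close> and the norm bound are recovered from real linearity.\<close>

theorem linear_selection:
  fixes u :: "'b::real_normed_vector \<Rightarrow> 'a \<Rightarrow> 'k::real_or_complex" and \<xi> :: "'a \<Rightarrow> real"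
  assumes cm: "complete_measure M" and K: "K_normed_space scl"
    and meas: "\<And>b. u b \<in> borel_measurable M"
    and add: "\<And>b c. AE x in M. u (b + c) x = u b x + u c x"
    and scl: "\<And>a b. AE x in M. u (scl a b) x = a * u b x"
    and \<xi> [measurable]: "\<xi> \<in> borel_measurable M"
    and bound: "\<And>b. AE x in M. norm (u b x) \<le> \<xi> x * norm b"
  shows "\<exists>q\<in>wstar_random_variables M scl. \<forall>b. AE x in M. blinfun_apply (q x) b = u b x"
proof -
  interpret complete_measure M by (rule cm)
  interpret K: K_normed_space scl by (rule K)
  obtain \<rho> where L: "lifting_on M (sets M, \<rho>)" using linear_lifting_exists by blast
  \<comment> \<open>The absolute value keeps the divisor positive at every point, also where
    \<open>\<xi>\<close> is negative.\<close>
  define d where "d x = 1 + \<bar>\<xi> x\<bar>" for x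
  have d0: "0 < d x" for x by (simp add: d_def add_pos_nonneg)
  define v where "v b x = u b x /\<^sub>R d x" for b x
  have [measurable]: "u b \<in> borel_measurable M" for b by (rule meas)
  have vm [measurable]: "v b \<in> borel_measurable M" for b
    unfolding v_def[abs_def] d_def[abs_def] by measurable
  have vb: "AE x in M. norm (v b x) \<le> norm b" for b
    using bound[of b]
  proof eventually_elim
    case (elim x)
    have "\<xi> x * norm b \<le> d x * norm b" by (intro mult_right_mono) (auto simp: d_def)
    then have "norm (u b x) \<le> d x * norm b" using elim by linarith
    then show ?case using d0[of x] by (simp add: v_def field_simps)
  qed
  have vin: "(\<lambda>x. v b x \<bullet> z) \<in> bdd_fns M (sets M)" for b z
  proof -
    have "AE x in M. \<bar>v b x \<bullet> z\<bar> \<le> norm b * norm z"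
      using vb[of b] by eventually_elim (meson Cauchy_Schwarz_ineq2 mult_right_mono norm_ge_zero order_trans)
    then show ?thesis unfolding bdd_fns_sets by auto
  qed
  define w where "w b x = (\<Sum>i\<in>Basis. \<rho> (\<lambda>x. v b x \<bullet> i) x *\<^sub>R i)" for b x
  \<comment> \<open>The coordinatewise lifting commutes with every real-linear functional, so
    multiplication by a fixed scalar and inner products can be moved through it.\<close>
  have w_lin: "(\<lambda>x. \<phi> (v b x)) \<in> bdd_fns M (sets M) \<and> \<rho> (\<lambda>x. \<phi> (v b x)) x = \<phi> (w b x)"
    if \<phi>: "linear \<phi>" for \<phi> :: "'k \<Rightarrow> real" and b x
  proof -
    have "\<phi> (v b x) = (\<Sum>i\<in>Basis. (v b x \<bullet> i) * \<phi> i)" for x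
      by (subst euclidean_representation[of "v b x", symmetric])
         (simp only: linear_sum[OF \<phi>] linear_scale[OF \<phi>] real_scaleR_def)
    moreover have "\<phi> (w b x) = (\<Sum>i\<in>Basis. \<rho> (\<lambda>x. v b x \<bullet> i) x * \<phi> i)" for x
      unfolding w_def by (simp only: linear_sum[OF \<phi>] linear_scale[OF \<phi>] real_scaleR_def)
    ultimately show ?thesis
      using lifting_on_sum[OF L finite_Basis, of "\<lambda>i x. v b x \<bullet> i" \<phi>] vin by simp
  qed
  have lin_inner: "linear (\<lambda>y. (a * y) \<bullet> z)" for a z :: 'k
    by (rule linearI) (simp_all add: distrib_left inner_add_left)
  have w_inner: "\<rho> (\<lambda>x. (a * v b x) \<bullet> z) x = (a * w b x) \<bullet> z"
    "(\<lambda>x. (a * v b x) \<bullet> z) \<in> bdd_fns M (sets M)" for a b z x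
    using w_lin[OF lin_inner[of a z]] by auto
  \<comment> \<open>The vector tested is \<open>w b x\<close> itself, frozen at the point
    \<open>x\<close>; bounding the coordinates one by one would lose a constant for complex
    scalars.\<close>
  have w_norm: "norm (w b x) \<le> norm b" for b x
  proof -
    have "norm (w b x) * norm (w b x) = \<rho> (\<lambda>y. v b y \<bullet> w b x) x"
      using w_inner(1)[of 1 b "w b x" x] by (simp add: power2_norm_eq_inner[symmetric] power2_eq_square[symmetric])
    also have "\<dots> \<le> \<bar>\<rho> (\<lambda>y. v b y \<bullet> w b x) x\<bar>" by simp
    also have "\<dots> \<le> norm b * norm (w b x)"
    proof (rule lifting_on_bound[OF L vin])
      show "AE y in M. \<bar>v b y \<bullet> w b x\<bar> \<le> norm b * norm (w b x)"
        using vb[of b] by eventually_elim (meson Cauchy_Schwarz_ineq2 mult_right_mono norm_ge_zero order_trans)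
    qed
    finally show ?thesis by (cases "w b x = 0") (simp_all add: mult_le_cancel_right)
  qed
  have w_add: "w (b + c) x = w b x + w c x" for b c x
  proof (rule euclidean_eqI)
    fix z :: 'k
    have "\<rho> (\<lambda>x. v (b + c) x \<bullet> z) = \<rho> (\<lambda>x. v b x \<bullet> z + v c x \<bullet> z)"
      using add[of b c]
      by (intro lifting_on_cong[OF L vin bdd_fns_add[OF vin vin]])
         (auto elim!: eventually_mono simp: v_def inner_add_left distrib_left)
    then show "w (b + c) x \<bullet> z = (w b x + w c x) \<bullet> z"
      using lifting_onD(5)[OF L vin vin, of b z c z] w_inner(1)[of 1 b z x] w_inner(1)[of 1 c z x]
        w_inner(1)[of 1 "b + c" z x] by (simp add: inner_add_left)
  qed
  have w_scl: "w (scl a b) x = a * w b x" for a b x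
  proof (rule euclidean_eqI)
    fix z :: 'k
    have "\<rho> (\<lambda>x. v (scl a b) x \<bullet> z) = \<rho> (\<lambda>x. (a * v b x) \<bullet> z)"
      using scl[of a b]
      by (intro lifting_on_cong[OF L vin w_inner(2)]) (auto elim!: eventually_mono simp: v_def)
    then show "w (scl a b) x \<bullet> z = (a * w b x) \<bullet> z"
      using w_inner(1)[of 1 "scl a b" z x] w_inner(1)[of a b z x] by simp
  qed
  define q where "q x = Blinfun (\<lambda>b. d x *\<^sub>R w b x)" for x
  have bl: "bounded_linear (\<lambda>b. d x *\<^sub>R w b x)" for x
  proof (rule bounded_linear_intro)
    show "d x *\<^sub>R w (b + c) x = d x *\<^sub>R w b x + d x *\<^sub>R w c x" for b c
      by (simp add: w_add scaleR_add_right)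
    show "d x *\<^sub>R w (r *\<^sub>R b) x = r *\<^sub>R d x *\<^sub>R w b x" for r b
      using w_scl[of "of_real r" b x] by (simp add: K.scl_of_real scaleR_conv_of_real)
    show "norm (d x *\<^sub>R w b x) \<le> norm b * d x" for b
      using w_norm[of b x] d0[of x] by (simp add: mult.commute mult_right_mono)
  qed
  have q: "blinfun_apply (q x) b = d x *\<^sub>R w b x" for x b
    unfolding q_def by (simp add: bounded_linear_Blinfun_apply[OF bl])
  have AEq: "AE x in M. blinfun_apply (q x) b = u b x" for b
  proof -
    have "AE x in M. \<forall>i\<in>Basis. \<rho> (\<lambda>x. v b x \<bullet> i) x = v b x \<bullet> i"
      by (subst AE_finite_all) (use lifting_onD(4)[OF L vin] in auto)
    then show ?thesis
    proof eventually_elim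
      case (elim x)
      have "w b x = (\<Sum>i\<in>Basis. (v b x \<bullet> i) *\<^sub>R i)"
        unfolding w_def by (rule sum.cong) (use elim in auto)
      then have "w b x = v b x" by (simp add: euclidean_representation)
      then show ?case using d0[of x] by (simp add: q v_def)
    qed
  qed
  have "q \<in> wstar_random_variables M scl"
    unfolding wstar_random_variables_def dual_space_def
    using borel_measurable_AE_cong[OF meas AEq]
    by (auto simp: q w_scl)
  then show ?thesis using AEq by blast
qed

end

section \<open>Essential suprema\<close>

text \<open>Exhaustion: choose a countable subfamily whose supremum \<open>s\<close> maximizes \<open>\<integral> arctan s\<close>.\<close>

lemma (in prob_space) ess_sup_exists:
  fixes U :: "('a \<Rightarrow> real) set"
  assumes ne: "U \<noteq> {}" and meas: "U \<subseteq> borel_measurable M"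
    and h: "\<And>u x. u \<in> U \<Longrightarrow> x \<in> space M \<Longrightarrow> u x \<le> h x"
  shows "\<exists>\<eta>\<in>borel_measurable M. (\<forall>u\<in>U. AE x in M. u x \<le> \<eta> x) \<and>
    (\<forall>\<zeta>. (\<forall>u\<in>U. AE x in M. u x \<le> \<zeta> x) \<longrightarrow> (AE x in M. \<eta> x \<le> \<zeta> x))"
proof -
  define \<C> where "\<C> = {C. C \<subseteq> U \<and> countable C \<and> C \<noteq> {}}"
  define s where "s C x = (SUP u\<in>C. u x)" for C :: "('a \<Rightarrow> real) set" and x
  have bdd: "bdd_above ((\<lambda>u. u x) ` C)" if "C \<in> \<C>" "x \<in> space M" for C x
    using h[OF _ that(2)] that(1) by (intro bdd_aboveI2[where M = "h x"]) (auto simp: \<C>_def)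
  have sm: "s C \<in> borel_measurable M" if C: "C \<in> \<C>" for C
    unfolding s_def[abs_def]
    by (rule borel_measurable_cSUP) (use C meas bdd[OF C] in \<open>auto simp: \<C>_def\<close>)
  have us: "u x \<le> s C x" if "C \<in> \<C>" "u \<in> C" "x \<in> space M" for C u x
    unfolding s_def by (rule cSUP_upper[OF that(2) bdd[OF that(1,3)]])
  have smono: "s C x \<le> s D x" if "C \<in> \<C>" "D \<in> \<C>" "C \<subseteq> D" "x \<in> space M" for C D x
    unfolding s_def by (rule cSUP_subset_mono) (use that bdd in \<open>auto simp: \<C>_def\<close>)
  \<comment> \<open>\<open>arctan\<close> is bounded and strictly increasing: all integrals exist,
    and comparable suprema with equal integrals agree a.e.\<close>
  define J where "J C = (\<integral>x. arctan (s C x) \<partial>M)" for C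
  have int: "integrable M (\<lambda>x. arctan (s C x))" if C: "C \<in> \<C>" for C
  proof (rule integrable_const_bound[of _ "pi/2"])
    show "AE x in M. norm (arctan (s C x)) \<le> pi / 2"
    proof (rule AE_I2)
      fix x show "norm (arctan (s C x)) \<le> pi / 2" using arctan_bounded[of "s C x"] unfolding real_norm_def by (intro abs_leI) linarith+
    qed
    show "(\<lambda>x. arctan (s C x)) \<in> borel_measurable M" using sm[OF C] by measurable
  qed
  have Jle: "J C \<le> pi / 2" if C: "C \<in> \<C>" for C
    unfolding J_def by (rule integral_le_const[OF int[OF C]]) (use arctan_ubound in \<open>auto intro!: less_imp_le\<close>)
  have Jmono: "J C \<le> J D" if "C \<in> \<C>" "D \<in> \<C>" "C \<subseteq> D" for C D
    unfolding J_def by (rule integral_mono[OF int int]) (use that smono[OF that] arctan_le_iff in auto)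
  define a where "a = (SUP C\<in>\<C>. J C)"
  obtain u0 where "u0 \<in> U" using ne by blast
  then have \<C>ne: "\<C> \<noteq> {}" by (auto simp: \<C>_def intro!: exI[of _ "{u0}"])
  have bJ: "bdd_above (J ` \<C>)" using Jle by (rule bdd_aboveI2)
  have "\<exists>C\<in>\<C>. a - 1 / (real n + 1) < J C" for n
    using less_cSUP_iff[OF \<C>ne bJ, of "a - 1 / (real n + 1)"] unfolding a_def[symmetric] by simp
  then obtain C where C: "\<And>n. C n \<in> \<C>" "\<And>n. a - 1 / (real n + 1) < J (C n)" by metis
  \<comment> \<open>A countable union of countable families is again admissible, so the supremum
    \<open>a\<close> is attained.\<close>
  define D where "D = (\<Union>n. C n)"
  have D: "D \<in> \<C>" using C(1) by (fastforce simp: D_def \<C>_def)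
  have "a \<le> J D"
  proof (rule field_le_epsilon)
    fix e :: real assume e: "0 < e"
    obtain n :: nat where n: "1 / e < real n" using reals_Archimedean2 by blast
    have "1 / (real n + 1) \<le> e" using n e by (simp add: field_simps)
    moreover have "J (C n) \<le> J D" by (rule Jmono[OF C(1) D]) (auto simp: D_def)
    ultimately show "a \<le> J D + e" using C(2)[of n] by linarith
  qed
  \<comment> \<open>Adjoining \<open>u\<close> to \<open>D\<close> cannot raise the integral above
    \<open>a\<close>, hence leaves the supremum unchanged a.e.\<close>
  have up: "AE x in M. u x \<le> s D x" if u: "u \<in> U" for u
  proof -
    have uD: "insert u D \<in> \<C>" using D u by (auto simp: \<C>_def)
    have "J (insert u D) \<le> a" unfolding a_def by (rule cSUP_upper[OF uD bJ])
    then have "(\<integral>x. arctan (s (insert u D) x) - arctan (s D x) \<partial>M) \<le> 0"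
      using \<open>a \<le> J D\<close> by (subst Bochner_Integration.integral_diff[OF int[OF uD] int[OF D]]) (simp add: J_def)
    moreover have nn: "AE x in M. 0 \<le> arctan (s (insert u D) x) - arctan (s D x)"
      using smono[OF D uD] by (intro AE_I2) (auto simp: arctan_le_iff)
    moreover have "integrable M (\<lambda>x. arctan (s (insert u D) x) - arctan (s D x))"
      by (rule Bochner_Integration.integrable_diff[OF int[OF uD] int[OF D]])
    ultimately have "AE x in M. arctan (s (insert u D) x) - arctan (s D x) = 0"
      using integral_nonneg_eq_0_iff_AE[of M "\<lambda>x. arctan (s (insert u D) x) - arctan (s D x)"]
        integral_nonneg_AE[OF nn] by linarith
    with AE_space show ?thesis
    proof eventually_elim
      case (elim x)
      then show ?case using us[OF uD, of u x] by (simp add: arctan_eq_iff)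
    qed
  qed
  have least: "AE x in M. s D x \<le> \<zeta> x" if \<zeta>: "\<forall>u\<in>U. AE x in M. u x \<le> \<zeta> x" for \<zeta>
  proof -
    have "AE x in M. \<forall>u\<in>D. u x \<le> \<zeta> x"
      using D \<zeta> by (subst AE_ball_countable) (auto simp: \<C>_def)
    then show ?thesis
      by eventually_elim (use D in \<open>auto simp: s_def \<C>_def intro!: cSUP_least\<close>)
  qed
  show ?thesis using sm[OF D] up least by blast
qed

section \<open>Vector measures of bounded variation\<close>

text \<open>The total variation. The disjoint families need not cover \<open>A\<close>, which makes
  monotonicity and superadditivity direct; values in \<open>ennreal\<close> allow the supremum
  before bounded variation is known.\<close>

definition variation_vm :: "'w measure \<Rightarrow> ('w set \<Rightarrow> 'x::real_normed_vector) \<Rightarrow> 'w set \<Rightarrow> ennreal" where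
  "variation_vm M \<mu> A = (SUP \<pi>\<in>{\<pi>. finite \<pi> \<and> \<pi> \<subseteq> sets M \<and> disjoint \<pi> \<and> \<Union>\<pi> \<subseteq> A}. \<Sum>B\<in>\<pi>. ennreal (norm (\<mu> B)))"

lemma ennreal_norm_sums_le:
  fixes f :: "nat \<Rightarrow> 'x::real_normed_vector"
  assumes "f sums s"
  shows "ennreal (norm s) \<le> (\<Sum>i. ennreal (norm (f i)))"
proof -
  have lim: "(\<lambda>n. ennreal (norm (\<Sum>i<n. f i))) \<longlonglongrightarrow> ennreal (norm s)"
    using assms unfolding sums_def by (intro tendsto_ennrealI tendsto_norm)
  have "ennreal (norm (\<Sum>i<n. f i)) \<le> (\<Sum>i. ennreal (norm (f i)))" for n
  proof -
    have "ennreal (norm (\<Sum>i<n. f i)) \<le> ennreal (\<Sum>i<n. norm (f i))"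
      by (intro ennreal_leI norm_sum)
    also have "\<dots> = (\<Sum>i<n. ennreal (norm (f i)))" by simp
    also have "\<dots> \<le> (\<Sum>i. ennreal (norm (f i)))" by (intro sum_le_suminf) auto
    finally show ?thesis .
  qed
  then show ?thesis by (intro LIMSEQ_le_const2[OF lim]) simp
qed

context
  fixes M :: "'w measure" and \<mu> :: "'w set \<Rightarrow> 'x::real_normed_vector"
  assumes ca: "countably_additive_vm M \<mu>"
begin

lemma vm_sums:
  "range A \<subseteq> sets M \<Longrightarrow> disjoint_family A \<Longrightarrow> (\<lambda>n::nat. \<mu> (A n)) sums \<mu> (\<Union>n. A n)"
  using ca unfolding countably_additive_vm_def by blast

lemma vm_empty [simp]: "\<mu> {} = 0"
proof -
  have "summable (\<lambda>n::nat. \<mu> {})"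
    using vm_sums[of "\<lambda>_. {}"] by (auto simp: disjoint_family_on_def sums_iff)
  then have "(\<lambda>n::nat. \<mu> {}) \<longlonglongrightarrow> 0" by (rule summable_LIMSEQ_zero)
  then show ?thesis by (simp add: LIMSEQ_const_iff)
qed

lemma variation_vm_upper:
  assumes "finite \<pi>" "\<pi> \<subseteq> sets M" "disjoint \<pi>" "\<Union>\<pi> \<subseteq> A"
  shows "(\<Sum>B\<in>\<pi>. ennreal (norm (\<mu> B))) \<le> variation_vm M \<mu> A"
  unfolding variation_vm_def by (rule SUP_upper) (use assms in auto)

lemma norm_le_variation_vm: "A \<in> sets M \<Longrightarrow> ennreal (norm (\<mu> A)) \<le> variation_vm M \<mu> A"
  using variation_vm_upper[of "{A}" A] by simp

lemma variation_vm_mono: "A \<subseteq> B \<Longrightarrow> variation_vm M \<mu> A \<le> variation_vm M \<mu> B"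
  unfolding variation_vm_def by (rule SUP_subset_mono) auto

lemma variation_vm_superadd:
  assumes "A \<inter> B = {}"
  shows "variation_vm M \<mu> A + variation_vm M \<mu> B \<le> variation_vm M \<mu> (A \<union> B)"
proof -
  let ?P = "\<lambda>A. {\<pi>. finite \<pi> \<and> \<pi> \<subseteq> sets M \<and> disjoint \<pi> \<and> \<Union>\<pi> \<subseteq> A}"
  let ?s = "\<lambda>\<pi>. \<Sum>B\<in>\<pi>. ennreal (norm (\<mu> B))"
  have ne: "?P A \<noteq> {}" for A by (auto intro!: exI[of _ "{}"])
  have "?s \<pi> + ?s \<pi>' \<le> variation_vm M \<mu> (A \<union> B)" if p: "\<pi> \<in> ?P A" "\<pi>' \<in> ?P B" for \<pi> \<pi>'
  proof -
    \<comment> \<open>The two families can share only the empty set, whose measure is 0, so nothing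
      is counted twice in their union.\<close>
    have sub: "\<pi> \<inter> \<pi>' \<subseteq> {{}}" using p assms by blast
    have "?s (\<pi> \<inter> \<pi>') = 0" using sub by (intro sum.neutral) auto
    then have "?s \<pi> + ?s \<pi>' = ?s (\<pi> \<union> \<pi>')"
      using sum.union_inter[of \<pi> \<pi>' "\<lambda>B. ennreal (norm (\<mu> B))"] p by simp
    also have "\<dots> \<le> variation_vm M \<mu> (A \<union> B)"
    proof (rule variation_vm_upper)
      show "disjoint (\<pi> \<union> \<pi>')"
        unfolding disjoint_def
      proof (intro ballI impI)
        fix a b assume ab: "a \<in> \<pi> \<union> \<pi>'" "b \<in> \<pi> \<union> \<pi>'" "a \<noteq> b"
        show "a \<inter> b = {}"
        proof (cases "(a \<in> \<pi> \<and> b \<in> \<pi>) \<or> (a \<in> \<pi>' \<and> b \<in> \<pi>')")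
          case True
          have "disjoint \<pi>" "disjoint \<pi>'" using p by auto
          with True show ?thesis using disjointD ab(3) by metis
        next
          case False
          then have "(a \<subseteq> A \<and> b \<subseteq> B) \<or> (a \<subseteq> B \<and> b \<subseteq> A)" using p ab by blast
          then show ?thesis using assms by blast
        qed
      qed
    qed (use p in auto)
    finally show ?thesis .
  qed
  note le = this
  have "(SUP \<pi>\<in>?P A. ?s \<pi>) + (SUP \<pi>\<in>?P B. ?s \<pi>) = (SUP \<pi>\<in>?P A. ?s \<pi> + (SUP \<pi>\<in>?P B. ?s \<pi>))"
    by (rule ennreal_SUP_add_left[OF ne, symmetric])
  also have "\<dots> \<le> variation_vm M \<mu> (A \<union> B)"
  proof (rule SUP_least)
    fix \<pi> assume p: "\<pi> \<in> ?P A"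
    have "?s \<pi> + (SUP \<pi>\<in>?P B. ?s \<pi>) = (SUP \<pi>'\<in>?P B. ?s \<pi> + ?s \<pi>')"
      by (rule ennreal_SUP_add_right[OF ne])
    also have "\<dots> \<le> variation_vm M \<mu> (A \<union> B)" by (rule SUP_least) (rule le[OF p])
    finally show "?s \<pi> + (SUP \<pi>\<in>?P B. ?s \<pi>) \<le> variation_vm M \<mu> (A \<union> B)" .
  qed
  finally show ?thesis unfolding variation_vm_def[of M \<mu> A] variation_vm_def[of M \<mu> B] .
qed

lemma variation_vm_empty [simp]: "variation_vm M \<mu> {} = 0"
proof -
  have "(\<Sum>B\<in>\<pi>. ennreal (norm (\<mu> B))) = 0" if "\<Union>\<pi> \<subseteq> {}" for \<pi>
  proof (rule sum.neutral, rule ballI)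
    fix B assume "B \<in> \<pi>"
    then have "B = {}" using that by blast
    then show "ennreal (norm (\<mu> B)) = 0" by simp
  qed
  then have "variation_vm M \<mu> {} \<le> 0" unfolding variation_vm_def by (intro SUP_least) simp
  then show ?thesis by simp
qed

text \<open>Superadditivity on finite unions gives one inequality. For the other, each member of a
  competing family is cut along the \<open>A i\<close>, and the countable triangle inequality sums
  the pieces.\<close>

lemma variation_vm_countably_additive: "countably_additive (sets M) (variation_vm M \<mu>)"
  unfolding countably_additive_def
proof (intro allI impI antisym)
  fix A :: "nat \<Rightarrow> 'w set" assume A: "range A \<subseteq> sets M" "disjoint_family A"
  show "(\<Sum>i. variation_vm M \<mu> (A i)) \<le> variation_vm M \<mu> (\<Union>i. A i)"
  proof (rule suminf_le_const[OF summableI])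
    fix n
    have "(\<Sum>i<n. variation_vm M \<mu> (A i)) \<le> variation_vm M \<mu> (\<Union>i<n. A i)"
    proof (induction n)
      case (Suc n)
      have "A i \<inter> A n = {}" if "i < n" for i
        using disjoint_family_onD[OF A(2), of i n] that by simp
      then have "(\<Union>i<n. A i) \<inter> A n = {}" by blast
      then have "variation_vm M \<mu> (\<Union>i<n. A i) + variation_vm M \<mu> (A n) \<le> variation_vm M \<mu> ((\<Union>i<n. A i) \<union> A n)"
        by (rule variation_vm_superadd)
      moreover have "(\<Union>i<n. A i) \<union> A n = (\<Union>i<Suc n. A i)" by (auto simp: lessThan_Suc)
      ultimately show ?case using Suc by (auto intro: order_trans add_right_mono)
    qed simp
    also have "\<dots> \<le> variation_vm M \<mu> (\<Union>i. A i)" by (rule variation_vm_mono) auto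
    finally show "(\<Sum>i<n. variation_vm M \<mu> (A i)) \<le> variation_vm M \<mu> (\<Union>i. A i)" .
  qed
  show "variation_vm M \<mu> (\<Union>i. A i) \<le> (\<Sum>i. variation_vm M \<mu> (A i))"
    unfolding variation_vm_def[of M \<mu> "\<Union>i. A i"]
  proof (rule SUP_least)
    fix \<pi> assume "\<pi> \<in> {\<pi>. finite \<pi> \<and> \<pi> \<subseteq> sets M \<and> disjoint \<pi> \<and> \<Union>\<pi> \<subseteq> (\<Union>i. A i)}"
    then have p: "finite \<pi>" "\<pi> \<subseteq> sets M" "disjoint \<pi>" "\<Union>\<pi> \<subseteq> (\<Union>i. A i)" by auto
    have "(\<Sum>B\<in>\<pi>. ennreal (norm (\<mu> B))) \<le> (\<Sum>B\<in>\<pi>. \<Sum>i. ennreal (norm (\<mu> (B \<inter> A i))))"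
    proof (rule sum_mono)
      fix B assume B: "B \<in> \<pi>"
      have "(\<lambda>i. \<mu> (B \<inter> A i)) sums \<mu> (\<Union>i. B \<inter> A i)"
        using A B p(2) by (intro vm_sums) (auto simp: disjoint_family_on_def)
      also have "(\<Union>i. B \<inter> A i) = B" using B p(4) by auto
      finally show "ennreal (norm (\<mu> B)) \<le> (\<Sum>i. ennreal (norm (\<mu> (B \<inter> A i))))"
        by (rule ennreal_norm_sums_le)
    qed
    also have "\<dots> = (\<Sum>i. \<Sum>B\<in>\<pi>. ennreal (norm (\<mu> (B \<inter> A i))))"
      by (rule suminf_sum[symmetric]) (rule summableI)
    also have "\<dots> \<le> (\<Sum>i. variation_vm M \<mu> (A i))"
    proof (intro suminf_le summableI)
      fix i
      \<comment> \<open>Distinct members with the same trace have an empty one by disjointness, so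
        passing to the image family drops only zero terms.\<close>
      have "(\<Sum>B\<in>\<pi>. ennreal (norm (\<mu> (B \<inter> A i)))) = (\<Sum>B\<in>(\<lambda>B. B \<inter> A i) ` \<pi>. ennreal (norm (\<mu> B)))"
      proof (subst sum.reindex_nontrivial[OF p(1)])
        fix B C assume "B \<in> \<pi>" "C \<in> \<pi>" "B \<noteq> C" "B \<inter> A i = C \<inter> A i"
        then have "B \<inter> A i = {}" using disjointD[OF p(3)] by blast
        then show "ennreal (norm (\<mu> (B \<inter> A i))) = 0" by simp
      qed simp
      also have "\<dots> \<le> variation_vm M \<mu> (A i)"
        using p A(1) by (intro variation_vm_upper) (auto simp: disjoint_def)
      finally show "(\<Sum>B\<in>\<pi>. ennreal (norm (\<mu> (B \<inter> A i)))) \<le> variation_vm M \<mu> (A i)" .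
    qed
    finally show "(\<Sum>B\<in>\<pi>. ennreal (norm (\<mu> B))) \<le> (\<Sum>i. variation_vm M \<mu> (A i))" .
  qed
qed

lemma variation_vm_bounded:
  assumes "bounded_variation_vm M \<mu>"
  shows "variation_vm M \<mu> (space M) < \<infinity>"
proof -
  obtain C where C: "\<And>\<pi>. finite \<pi> \<Longrightarrow> \<pi> \<subseteq> sets M \<Longrightarrow> partition_on (space M) \<pi> \<Longrightarrow> (\<Sum>A\<in>\<pi>. norm (\<mu> A)) \<le> C"
    using assms unfolding bounded_variation_vm_def by blast
  have "variation_vm M \<mu> (space M) \<le> ennreal C"
    unfolding variation_vm_def
  proof (rule SUP_least)
    fix \<pi> assume "\<pi> \<in> {\<pi>. finite \<pi> \<and> \<pi> \<subseteq> sets M \<and> disjoint \<pi> \<and> \<Union>\<pi> \<subseteq> space M}"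
    then have p: "finite \<pi>" "\<pi> \<subseteq> sets M" "disjoint \<pi>" "\<Union>\<pi> \<subseteq> space M" by auto
    define R where "R = space M - \<Union>\<pi>"
    have R: "R \<in> sets M" unfolding R_def using p by auto
    \<comment> \<open>The rest \<open>R\<close> completes the family to a partition; the empty set
      is removed because \<open>partition_on\<close> excludes it.\<close>
    have "partition_on (space M) (insert R \<pi> - {{}})"
    proof (rule partition_onI)
      show "\<Union>(insert R \<pi> - {{}}) = space M" using p(4) unfolding R_def by blast
      show "disjnt a b" if "a \<in> insert R \<pi> - {{}}" "b \<in> insert R \<pi> - {{}}" "a \<noteq> b" for a b
      proof -
        have "R \<inter> c = {}" if "c \<in> \<pi>" for c using that unfolding R_def by blast
        then show ?thesis using that disjointD[OF p(3), of a b] unfolding disjnt_def by blast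
      qed
    qed auto
    then have "(\<Sum>A\<in>insert R \<pi> - {{}}. norm (\<mu> A)) \<le> C" using p R by (intro C) auto
    moreover have "(\<Sum>A\<in>\<pi>. norm (\<mu> A)) \<le> (\<Sum>A\<in>insert R \<pi>. norm (\<mu> A))"
      using p(1) by (intro sum_mono2) auto
    moreover have "(\<Sum>A\<in>insert R \<pi> - {{}}. norm (\<mu> A)) = (\<Sum>A\<in>insert R \<pi>. norm (\<mu> A))"
      using p(1) by (intro sum.mono_neutral_left) auto
    ultimately have "(\<Sum>A\<in>\<pi>. norm (\<mu> A)) \<le> C" by linarith
    then show "(\<Sum>B\<in>\<pi>. ennreal (norm (\<mu> B))) \<le> ennreal C" by (simp add: ennreal_leI)
  qed
  then show ?thesis by (simp add: order_le_less_trans)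
qed

text \<open>\<open>W\<close> is the variation itself. It vanishes on null sets, because continuity
  forces \<open>\<mu>\<close> to vanish on all their measurable subsets.\<close>

lemma variation_vm_measure:
  assumes bv: "bounded_variation_vm M \<mu>" and cont: "continuous_vm M \<mu>"
  shows "\<exists>W. sets W = sets M \<and> finite_measure W \<and> absolutely_continuous M W \<and>
    (\<forall>A\<in>sets M. norm (\<mu> A) \<le> measure W A)"
proof -
  define W where "W = measure_of (space M) (sets M) (variation_vm M \<mu>)"
  have sets: "sets W = sets M" and space: "space W = space M" by (simp_all add: W_def)
  have em: "emeasure W A = variation_vm M \<mu> A" if "A \<in> sets M" for A
    by (rule emeasure_measure_of[OF W_def sets.space_closed])
      (use variation_vm_countably_additive that in \<open>auto simp: sets positive_def\<close>)
  have fin: "finite_measure W"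
    by (rule finite_measureI) (use variation_vm_bounded[OF bv] in \<open>simp add: space em\<close>)
  then interpret finite_measure W .
  have "norm (\<mu> A) \<le> measure W A" if A: "A \<in> sets M" for A
    using norm_le_variation_vm[OF A] unfolding em[OF A, symmetric] emeasure_eq_measure by simp
  moreover have "absolutely_continuous M W"
    unfolding absolutely_continuous_def
  proof
    fix A assume A: "A \<in> null_sets M"
    have 0: "\<mu> B = 0" if B: "B \<in> sets M" "B \<subseteq> A" for B
    proof -
      have "measure M B = 0"
        by (rule measure_eq_0_null_sets[OF null_sets_subset[OF A B]])
      have "norm (\<mu> B) < e" if e: "0 < e" for e
      proof -
        obtain d where "0 < d" "\<forall>A\<in>sets M. measure M A < d \<longrightarrow> norm (\<mu> A) < e"
          using cont e unfolding continuous_vm_def by blast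
        then show ?thesis using B(1) \<open>measure M B = 0\<close> by simp
      qed
      from this[of "norm (\<mu> B)"] show ?thesis by auto
    qed
    have "variation_vm M \<mu> A \<le> 0"
      unfolding variation_vm_def
    proof (rule SUP_least)
      fix \<pi> assume "\<pi> \<in> {\<pi>. finite \<pi> \<and> \<pi> \<subseteq> sets M \<and> disjoint \<pi> \<and> \<Union>\<pi> \<subseteq> A}"
      then have "\<forall>B\<in>\<pi>. ennreal (norm (\<mu> B)) = 0" using 0 by auto
      then show "(\<Sum>B\<in>\<pi>. ennreal (norm (\<mu> B))) \<le> 0" by simp
    qed
    then show "A \<in> null_sets W" using em[of A] A by (simp add: null_sets_def sets)
  qed
  ultimately show ?thesis using sets fin by blast
qed

end

section \<open>Densities of real measures and of functional-valued measures\<close>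

lemma AE_le_of_set_integrals:
  fixes f g :: "'w \<Rightarrow> real"
  assumes f: "integrable M f" and g: "integrable M g"
    and le: "\<And>A. A \<in> sets M \<Longrightarrow> (\<integral>x\<in>A. f x \<partial>M) \<le> (\<integral>x\<in>A. g x \<partial>M)"
  shows "AE x in M. f x \<le> g x"
proof -
  have [measurable]: "f \<in> borel_measurable M" "g \<in> borel_measurable M" using f g by auto
  \<comment> \<open>The set on which the claim fails is itself a test set.\<close>
  define A where "A = {x \<in> space M. g x < f x}"
  have A: "A \<in> sets M" unfolding A_def by measurable
  have i: "integrable M (\<lambda>x. indicator A x *\<^sub>R f x)" "integrable M (\<lambda>x. indicator A x *\<^sub>R g x)"
    by (rule integrable_mult_indicator[OF A f], rule integrable_mult_indicator[OF A g])
  have "(\<integral>x. indicator A x *\<^sub>R f x - indicator A x *\<^sub>R g x \<partial>M) \<le> 0"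
    using le[OF A] by (subst Bochner_Integration.integral_diff[OF i]) (simp add: set_lebesgue_integral_def)
  moreover have nn: "AE x in M. 0 \<le> indicator A x *\<^sub>R f x - indicator A x *\<^sub>R g x"
    by (intro AE_I2) (auto simp: A_def indicator_def)
  ultimately have "AE x in M. indicator A x *\<^sub>R f x - indicator A x *\<^sub>R g x = 0"
    using integral_nonneg_eq_0_iff_AE[OF Bochner_Integration.integrable_diff[OF i] nn] integral_nonneg_AE[OF nn]
    by linarith
  with AE_space show ?thesis
    by eventually_elim (auto simp: A_def indicator_def split: if_splits)
qed

lemma AE_eq_of_set_integrals:
  fixes f g :: "'w \<Rightarrow> 'k::euclidean_space"
  assumes f: "integrable M f" and g: "integrable M g"
    and eq: "\<And>A. A \<in> sets M \<Longrightarrow> (\<integral>x\<in>A. f x \<partial>M) = (\<integral>x\<in>A. g x \<partial>M)"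
  shows "AE x in M. f x = g x"
proof -
  have inner: "(\<integral>x\<in>A. f x \<bullet> i \<partial>M) = (\<integral>x\<in>A. f x \<partial>M) \<bullet> i" if "integrable M f" "A \<in> sets M"
    for f :: "'w \<Rightarrow> 'k" and A i
    using integral_inner_left[of i M "\<lambda>x. indicator A x *\<^sub>R f x"] integrable_mult_indicator[OF that(2,1)]
    by (simp add: set_lebesgue_integral_def)
  have "AE x in M. f x \<bullet> i = g x \<bullet> i" for i
  proof -
    have "AE x in M. f x \<bullet> i \<le> g x \<bullet> i"
      by (rule AE_le_of_set_integrals) (use f g eq in \<open>auto simp: inner\<close>)
    moreover have "AE x in M. g x \<bullet> i \<le> f x \<bullet> i"
      by (rule AE_le_of_set_integrals) (use f g eq in \<open>auto simp: inner\<close>)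
    ultimately show ?thesis by eventually_elim simp
  qed
  then have "AE x in M. \<forall>i\<in>Basis. f x \<bullet> i = g x \<bullet> i" by (subst AE_finite_all) auto
  then show ?thesis by eventually_elim (rule euclidean_eqI, blast)
qed

context prob_space
begin

text \<open>The Radon-Nikodym density is finite a.e. because \<open>N\<close> is finite, which
  allows a real-valued version that is nonnegative everywhere.\<close>

lemma finite_measure_density:
  assumes N: "finite_measure N" "sets N = sets M" "absolutely_continuous M N"
  shows "\<exists>f. integrable M f \<and> (\<forall>A\<in>sets M. measure N A = (\<integral>x\<in>A. f x \<partial>M)) \<and> (\<forall>x. 0 \<le> (f x :: real))"
proof -
  interpret N: finite_measure N by (rule N(1))
  obtain f where f [measurable]: "f \<in> borel_measurable M" and d: "density M f = N"
    using Radon_Nikodym[OF N(3,2)] by blast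
  have em: "emeasure N A = (\<integral>\<^sup>+x. f x * indicator A x \<partial>M)" if "A \<in> sets M" for A
    unfolding d[symmetric] by (rule emeasure_density[OF f that])
  have "(\<integral>\<^sup>+x. f x \<partial>M) = emeasure N (space M)"
    by (subst em) (auto intro!: nn_integral_cong)
  then have fin: "(\<integral>\<^sup>+x. f x \<partial>M) < \<infinity>" by (simp add: less_top[symmetric])
  then have AE: "AE x in M. f x \<noteq> \<infinity>" by (intro nn_integral_PInf_AE) auto
  have eq: "AE x in M. ennreal (enn2real (f x)) = f x" using AE by eventually_elim (simp add: less_top)
  have int: "integrable M (\<lambda>x. enn2real (f x))"
  proof (rule integrableI_bounded)
    have "(\<integral>\<^sup>+x. norm (enn2real (f x)) \<partial>M) = (\<integral>\<^sup>+x. f x \<partial>M)"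
      by (rule nn_integral_cong_AE) (use eq in \<open>auto elim!: eventually_mono\<close>)
    then show "(\<integral>\<^sup>+x. norm (enn2real (f x)) \<partial>M) < \<infinity>" using fin by simp
  qed measurable
  have "measure N A = (\<integral>x\<in>A. enn2real (f x) \<partial>M)" if A: "A \<in> sets M" for A
  proof -
    have "ennreal (measure N A) = (\<integral>\<^sup>+x. f x * indicator A x \<partial>M)"
      using em[OF A] by (simp add: N.emeasure_eq_measure)
    also have "\<dots> = (\<integral>\<^sup>+x. ennreal (indicator A x *\<^sub>R enn2real (f x)) \<partial>M)"
      by (rule nn_integral_cong_AE) (use eq in \<open>auto elim!: eventually_mono simp: indicator_def\<close>)
    also have "\<dots> = ennreal (\<integral>x\<in>A. enn2real (f x) \<partial>M)"
      unfolding set_lebesgue_integral_def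
      by (rule nn_integral_eq_integral) (use integrable_mult_indicator[OF A int] in \<open>auto simp: indicator_def\<close>)
    finally show ?thesis
      by (subst (asm) ennreal_inj) (auto simp: set_lebesgue_integral_def intro!: integral_nonneg_AE)
  qed
  then show ?thesis using int by (intro exI[of _ "\<lambda>x. enn2real (f x)"]) auto
qed

text \<open>The positive measure \<open>c W + \<nu>\<close> has a density, hence so has \<open>\<nu>\<close>.\<close>

lemma signed_density:
  fixes \<nu> :: "'a set \<Rightarrow> real"
  assumes W: "finite_measure W" "sets W = sets M" "absolutely_continuous M W"
    and \<xi>: "integrable M \<xi>" "\<And>A. A \<in> sets M \<Longrightarrow> measure W A = (\<integral>x\<in>A. \<xi> x \<partial>M)"
    and ca: "countably_additive_vm M \<nu>"
    and le: "\<And>A. A \<in> sets M \<Longrightarrow> \<bar>\<nu> A\<bar> \<le> c * measure W A"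
  shows "\<exists>u. integrable M u \<and> (\<forall>A\<in>sets M. \<nu> A = (\<integral>x\<in>A. u x \<partial>M)) \<and> (AE x in M. \<bar>u x\<bar> \<le> c * \<xi> x)"
proof -
  interpret W: finite_measure W by (rule W(1))
  define N where "N = measure_of (space M) (sets M) (\<lambda>A. ennreal (c * measure W A + \<nu> A))"
  have setsN: "sets N = sets M" and spaceN: "space N = space M" by (simp_all add: N_def)
  have spW: "space W = space M" using W(2) by (rule sets_eq_imp_space_eq)
  have nn: "0 \<le> c * measure W A + \<nu> A" if "A \<in> sets M" for A using le[OF that] by linarith
  have cadd: "countably_additive (sets M) (\<lambda>A. ennreal (c * measure W A + \<nu> A))"
    unfolding countably_additive_def
  proof (intro allI impI)
    fix A :: "nat \<Rightarrow> 'a set" assume A: "range A \<subseteq> sets M" "disjoint_family A"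
    have "(\<lambda>n. c * measure W (A n) + \<nu> (A n)) sums (c * measure W (\<Union>n. A n) + \<nu> (\<Union>n. A n))"
      using A by (intro sums_add sums_mult W.finite_measure_UNION vm_sums[OF ca]) (auto simp: W(2))
    then show "(\<Sum>n. ennreal (c * measure W (A n) + \<nu> (A n))) = ennreal (c * measure W (\<Union>n. A n) + \<nu> (\<Union>n. A n))"
      using A(1) nn by (intro suminf_ennreal_eq) auto
  qed
  have em: "emeasure N A = ennreal (c * measure W A + \<nu> A)" if "A \<in> sets M" for A
    by (rule emeasure_measure_of[OF N_def sets.space_closed, unfolded setsN, OF _ cadd that])
      (simp add: positive_def vm_empty[OF ca])
  have mN: "measure N A = c * measure W A + \<nu> A" if "A \<in> sets M" for A
    using em[OF that] nn[OF that] by (simp add: Sigma_Algebra.measure_def)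
  have finN: "finite_measure N" by (rule finite_measureI) (simp add: spaceN em)
  have acN: "absolutely_continuous M N"
    unfolding absolutely_continuous_def
  proof
    fix A assume A: "A \<in> null_sets M"
    then have "A \<in> null_sets W" using W(3) by (auto simp: absolutely_continuous_def)
    then have "measure W A = 0" by (rule measure_eq_0_null_sets)
    then have "\<nu> A = 0" using le[of A] A by auto
    then show "A \<in> null_sets N" using em[of A] A \<open>measure W A = 0\<close> by (auto simp: null_sets_def setsN)
  qed
  obtain f where f: "integrable M f" "\<And>A. A \<in> sets M \<Longrightarrow> measure N A = (\<integral>x\<in>A. f x \<partial>M)"
    using finite_measure_density[OF finN setsN acN] by blast
  define u where "u x = f x - c * \<xi> x" for x
  have ui: "integrable M u" unfolding u_def using f(1) \<xi>(1) by auto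
  have seti: "set_integrable M A g" if "integrable M g" "A \<in> sets M" for A and g :: "'a \<Rightarrow> real"
    unfolding set_integrable_def by (rule integrable_mult_indicator[OF that(2,1)])
  have u: "\<nu> A = (\<integral>x\<in>A. u x \<partial>M)" if A: "A \<in> sets M" for A
  proof -
    have "(\<integral>x\<in>A. u x \<partial>M) = (\<integral>x\<in>A. f x \<partial>M) - (\<integral>x\<in>A. c * \<xi> x \<partial>M)"
      unfolding u_def using A f(1) \<xi>(1) by (intro set_integral_diff seti) auto
    then show ?thesis using f(2)[OF A] mN[OF A] \<xi>(2)[OF A] by simp
  qed
  have "AE x in M. u x \<le> c * \<xi> x"
    by (rule AE_le_of_set_integrals) (use ui \<xi> le u in \<open>auto simp: abs_le_iff\<close>)
  moreover have "AE x in M. (- c) * \<xi> x \<le> u x"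
  proof (rule AE_le_of_set_integrals)
    fix A assume A: "A \<in> sets M"
    have "(\<integral>x\<in>A. (- c) * \<xi> x \<partial>M) = - (c * measure W A)"
      by (subst set_integral_mult_right) (simp add: \<xi>(2)[OF A])
    then show "(\<integral>x\<in>A. (- c) * \<xi> x \<partial>M) \<le> (\<integral>x\<in>A. u x \<partial>M)"
      using le[OF A] u[OF A] by linarith
  qed (use ui \<xi>(1) in auto)
  ultimately have "AE x in M. \<bar>u x\<bar> \<le> c * \<xi> x" by eventually_elim auto
  then show ?thesis using ui u by (intro exI[of _ u] conjI ballI)
qed

text \<open>Each coordinate of \<open>A \<mapsto> \<mu> A b\<close> is a real measure dominated by
  \<open>norm b\<close> times the variation, so a single \<open>\<xi>\<close> serves all
  \<open>b\<close>. This is the domination demanded by \<open>linear_selection\<close>.\<close>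

lemma blinfun_vm_density:
  fixes \<mu> :: "'a set \<Rightarrow> 'b::real_normed_vector \<Rightarrow>\<^sub>L 'k::real_or_complex"
  assumes ca: "countably_additive_vm M \<mu>" and cont: "continuous_vm M \<mu>" and bv: "bounded_variation_vm M \<mu>"
  shows "\<exists>u \<xi>. integrable M \<xi> \<and> (\<forall>b. integrable M (u b) \<and>
    (\<forall>A\<in>sets M. (\<integral>x\<in>A. u b x \<partial>M) = blinfun_apply (\<mu> A) b) \<and> (AE x in M. norm (u b x) \<le> \<xi> x * norm b))"
proof -
  obtain W where W: "finite_measure W" "sets W = sets M" "absolutely_continuous M W"
      "\<And>A. A \<in> sets M \<Longrightarrow> norm (\<mu> A) \<le> measure W A"
    using variation_vm_measure[OF ca bv cont] by blast
  obtain \<xi> where \<xi>: "integrable M \<xi>" "\<And>A. A \<in> sets M \<Longrightarrow> measure W A = (\<integral>x\<in>A. \<xi> x \<partial>M)" "\<And>x. 0 \<le> \<xi> x"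
    using finite_measure_density[OF W(1-3)] by blast
  have "\<exists>v. integrable M v \<and> (\<forall>A\<in>sets M. blinfun_apply (\<mu> A) b \<bullet> i = (\<integral>x\<in>A. v x \<partial>M)) \<and>
      (AE x in M. \<bar>v x\<bar> \<le> norm b * \<xi> x)" if i: "i \<in> Basis" for b and i :: 'k
  proof (rule signed_density[OF W(1-3) \<xi>(1,2)])
    have bl: "bounded_linear (\<lambda>f :: 'b \<Rightarrow>\<^sub>L 'k. blinfun_apply f b \<bullet> i)"
      by (intro bounded_linear_inner_left_comp blinfun.bounded_linear_left)
    show "countably_additive_vm M (\<lambda>A. blinfun_apply (\<mu> A) b \<bullet> i)"
      using ca bounded_linear.sums[OF bl] unfolding countably_additive_vm_def by blast
    show "\<bar>blinfun_apply (\<mu> A) b \<bullet> i\<bar> \<le> norm b * measure W A" if A: "A \<in> sets M" for A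
    proof -
      have "\<bar>blinfun_apply (\<mu> A) b \<bullet> i\<bar> \<le> norm (blinfun_apply (\<mu> A) b)" by (rule Basis_le_norm[OF i])
      also have "\<dots> \<le> norm (\<mu> A) * norm b" by (rule norm_blinfun)
      also have "\<dots> \<le> measure W A * norm b" using W(4)[OF A] by (rule mult_right_mono) simp
      finally show ?thesis by (simp add: mult.commute)
    qed
  qed
  then have "\<forall>b. \<forall>i\<in>Basis. \<exists>v. integrable M v \<and> (\<forall>A\<in>sets M. blinfun_apply (\<mu> A) b \<bullet> i = (\<integral>x\<in>A. v x \<partial>M)) \<and>
      (AE x in M. \<bar>v x\<bar> \<le> norm b * \<xi> x)" by blast
  then obtain v where v: "\<And>b i. i \<in> Basis \<Longrightarrow> integrable M (v b i)"
      "\<And>b i A. i \<in> Basis \<Longrightarrow> A \<in> sets M \<Longrightarrow> blinfun_apply (\<mu> A) b \<bullet> i = (\<integral>x\<in>A. v b i x \<partial>M)"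
      "\<And>b i. i \<in> Basis \<Longrightarrow> AE x in M. \<bar>v b i x\<bar> \<le> norm b * \<xi> x"
    by metis
  define u where "u b x = (\<Sum>i\<in>Basis. v b i x *\<^sub>R (i :: 'k))" for b x
  have int: "integrable M (u b)" for b
    unfolding u_def[abs_def] using v(1) by (intro Bochner_Integration.integrable_sum integrable_scaleR_left) auto
  have "(\<integral>x\<in>A. u b x \<partial>M) = blinfun_apply (\<mu> A) b" if A: "A \<in> sets M" for A b
  proof (rule euclidean_eqI)
    fix i :: 'k assume i: "i \<in> Basis"
    have "u b x \<bullet> i = v b i x" for x
      using i by (simp add: u_def inner_sum_left inner_Basis if_distrib sum.delta cong: if_cong)
    then have "(\<integral>x\<in>A. u b x \<partial>M) \<bullet> i = (\<integral>x\<in>A. v b i x \<partial>M)"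
      using integral_inner_left[of i M "\<lambda>x. indicator A x *\<^sub>R u b x"] integrable_mult_indicator[OF A int]
      by (simp add: set_lebesgue_integral_def)
    then show "(\<integral>x\<in>A. u b x \<partial>M) \<bullet> i = blinfun_apply (\<mu> A) b \<bullet> i" using v(2)[OF i A] by simp
  qed
  \<comment> \<open>Summing the coordinate bounds costs the factor \<open>DIM('k)\<close>, which is
    absorbed into the dominating function.\<close>
  moreover have "AE x in M. norm (u b x) \<le> (real DIM('k) * \<xi> x) * norm b" for b
  proof -
    have "AE x in M. \<forall>i\<in>Basis. \<bar>v b i x\<bar> \<le> norm b * \<xi> x" using v(3) by (subst AE_finite_all) auto
    then show ?thesis
    proof eventually_elim
      case (elim x)
      have "norm (u b x) \<le> (\<Sum>i\<in>Basis. norm (v b i x *\<^sub>R (i :: 'k)))" unfolding u_def by (rule norm_sum)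
      also have "\<dots> \<le> (\<Sum>i\<in>(Basis :: 'k set). norm b * \<xi> x)" using elim by (intro sum_mono) auto
      finally show ?case by (simp add: mult_ac)
    qed
  qed
  ultimately show ?thesis using int \<xi>(1)
    by (intro exI[of _ u] exI[of _ "\<lambda>x. real DIM('k) * \<xi> x"]) auto
qed

end

section \<open>Vector-valued random variables\<close>

lemma (in K_normed_space) bounded_bilinear_scl: "bounded_bilinear scl"
proof
  show "scl (a + a') b = scl a b + scl a' b" for a a' b by (rule scale_left_distrib)
  show "scl a (b + b') = scl a b + scl a b'" for a b b' by (rule scale_right_distrib)
  show "scl (r *\<^sub>R a) b = r *\<^sub>R scl a b" for r a b
    by (metis scale_scale scl_of_real scaleR_conv_of_real)
  show "scl a (r *\<^sub>R b) = r *\<^sub>R scl a b" for r a b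
    by (metis scale_scale scl_of_real mult.commute)
  show "\<exists>K. \<forall>a b. norm (scl a b) \<le> norm a * norm b * K"
    by (rule exI[of _ 1]) (simp add: norm_scl)
qed

lemma dual_scl_apply [simp]: "blinfun_apply (dual_scl a f) b = a * blinfun_apply f b"
  by (simp add: dual_scl_def)

lemma norm_dual_scl:
  fixes f :: "'b::real_normed_vector \<Rightarrow>\<^sub>L 'k::real_or_complex"
  shows "norm (dual_scl a f) = norm a * norm f"
proof -
  have le: "norm (dual_scl a f) \<le> norm a * norm f" for a and f :: "'b::real_normed_vector \<Rightarrow>\<^sub>L 'k::real_or_complex"
    by (rule norm_blinfun_bound) (auto simp: norm_mult mult.assoc intro!: mult_left_mono norm_blinfun)
  show ?thesis
  proof (cases "a = 0")
    case True
    then show ?thesis using le[of a f] by simp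
  next
    case False
    have "dual_scl (inverse a) (dual_scl a f) = f"
      by (rule blinfun_eqI) (simp add: False mult.assoc[symmetric])
    then have "norm f \<le> norm (inverse a) * norm (dual_scl a f)" using le[of "inverse a" "dual_scl a f"] by simp
    then have "norm a * norm f \<le> norm (dual_scl a f)" using False unfolding norm_inverse by (simp add: field_simps)
    with le[of a f] show ?thesis by linarith
  qed
qed

lemma K_normed_space_dual: "K_normed_space (dual_scl :: 'k::real_or_complex \<Rightarrow> ('b::real_normed_vector \<Rightarrow>\<^sub>L 'k) \<Rightarrow> _)"
  by unfold_locales
    (auto intro!: blinfun_eqI simp: blinfun.add_left blinfun.add_right distrib_left distrib_right
      blinfun.scaleR_left norm_dual_scl scaleR_conv_of_real mult.assoc)

lemma norm_blinfun_le_unit: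
  fixes f :: "'b::real_normed_vector \<Rightarrow>\<^sub>L 'k::real_normed_vector"
  assumes le: "\<And>b. norm b \<le> 1 \<Longrightarrow> norm (blinfun_apply f b) \<le> c"
  shows "norm f \<le> c"
proof (rule norm_blinfun_bound)
  show "0 \<le> c" using le[of 0] by simp
  fix b
  show "norm (blinfun_apply f b) \<le> c * norm b"
  proof (cases "b = 0")
    case False
    have "norm (blinfun_apply f (b /\<^sub>R norm b)) \<le> c" using False by (intro le) simp
    then show ?thesis using False by (simp add: blinfun.scaleR_right field_simps)
  qed simp
qed

section \<open>Strongly measurable variables, pairings and vector integrals\<close>

lemma rvI:
  assumes "\<And>\<omega>. \<omega> \<in> space M \<Longrightarrow> f \<omega> \<in> V"
    and "\<And>n::nat. simple_function M (s n)" "\<And>n \<omega>. \<omega> \<in> space M \<Longrightarrow> s n \<omega> \<in> V"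
    and "\<And>\<omega>. \<omega> \<in> space M \<Longrightarrow> (\<lambda>n. s n \<omega>) \<longlonglongrightarrow> f \<omega>"
  shows "f \<in> random_variables M V"
  using assms unfolding random_variables_def by blast

lemma rvE:
  assumes "f \<in> random_variables M V"
  obtains s where "\<And>n::nat. simple_function M (s n)" "\<And>n \<omega>. \<omega> \<in> space M \<Longrightarrow> s n \<omega> \<in> V"
    "\<And>\<omega>. \<omega> \<in> space M \<Longrightarrow> (\<lambda>n. s n \<omega>) \<longlonglongrightarrow> f \<omega>"
  using assms unfolding random_variables_def by blast

lemma rvD: "f \<in> random_variables M V \<Longrightarrow> \<omega> \<in> space M \<Longrightarrow> f \<omega> \<in> V"
  unfolding random_variables_def by blast

lemma rv_mono: "f \<in> random_variables M V \<Longrightarrow> V \<subseteq> V' \<Longrightarrow> f \<in> random_variables M V'"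
  unfolding random_variables_def by blast

lemma rv_const: "b \<in> V \<Longrightarrow> (\<lambda>_. b) \<in> random_variables M V"
  by (rule rvI[where s = "\<lambda>_ _. b"]) auto

lemma rv_simple: "simple_function M f \<Longrightarrow> (\<And>\<omega>. \<omega> \<in> space M \<Longrightarrow> f \<omega> \<in> V) \<Longrightarrow> f \<in> random_variables M V"
  by (rule rvI[where s = "\<lambda>_. f"]) auto

lemma rv_norm_measurable:
  assumes "f \<in> random_variables M V"
  shows "(\<lambda>\<omega>. norm (f \<omega>)) \<in> borel_measurable M"
proof -
  obtain s where s: "\<And>n::nat. simple_function M (s n)" "\<And>\<omega>. \<omega> \<in> space M \<Longrightarrow> (\<lambda>n. s n \<omega>) \<longlonglongrightarrow> f \<omega>"
    using assms by (rule rvE) (rule that, assumption+)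
  show ?thesis
  proof (rule borel_measurable_LIMSEQ_real)
    show "(\<lambda>n. norm (s n \<omega>)) \<longlonglongrightarrow> norm (f \<omega>)" if "\<omega> \<in> space M" for \<omega>
      using s(2)[OF that] by (rule tendsto_norm)
    show "(\<lambda>\<omega>. norm (s n \<omega>)) \<in> borel_measurable M" for n
      by (rule borel_measurable_simple_function, rule simple_function_compose1[OF s(1)])
  qed
qed

text \<open>One argument for sums, differences, scalar multiples and restrictions to sets: apply the
  operation to the simple approximations.\<close>

lemma rv_map2:
  assumes f: "f \<in> random_variables M V" and g: "g \<in> random_variables M V'"
    and lim: "\<And>a b x y. a \<longlonglongrightarrow> x \<Longrightarrow> b \<longlonglongrightarrow> y \<Longrightarrow> (\<lambda>n. op (a n) (b n)) \<longlonglongrightarrow> op x y"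
    and closed: "\<And>x y. x \<in> V \<Longrightarrow> y \<in> V' \<Longrightarrow> op x y \<in> U"
  shows "(\<lambda>\<omega>. op (f \<omega>) (g \<omega>)) \<in> random_variables M U"
proof -
  obtain s where s: "\<And>n::nat. simple_function M (s n)" "\<And>n \<omega>. \<omega> \<in> space M \<Longrightarrow> s n \<omega> \<in> V"
      "\<And>\<omega>. \<omega> \<in> space M \<Longrightarrow> (\<lambda>n. s n \<omega>) \<longlonglongrightarrow> f \<omega>" using f by (rule rvE) (rule that, assumption+)
  obtain t where t: "\<And>n::nat. simple_function M (t n)" "\<And>n \<omega>. \<omega> \<in> space M \<Longrightarrow> t n \<omega> \<in> V'"
      "\<And>\<omega>. \<omega> \<in> space M \<Longrightarrow> (\<lambda>n. t n \<omega>) \<longlonglongrightarrow> g \<omega>" using g by (rule rvE) (rule that, assumption+)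
  show ?thesis
    by (rule rvI[where s = "\<lambda>n \<omega>. op (s n \<omega>) (t n \<omega>)"])
      (intro simple_function_compose2[OF s(1) t(1)] lim closed s t rvD[OF f] rvD[OF g]; assumption)+
qed

lemma rv_add:
  assumes "f \<in> random_variables M V" "g \<in> random_variables M V"
    and "\<And>x y. x \<in> V \<Longrightarrow> y \<in> V \<Longrightarrow> x + y \<in> V"
  shows "(\<lambda>\<omega>. f \<omega> + g \<omega>) \<in> random_variables M V"
  using assms(1,2) tendsto_add assms(3) by (rule rv_map2)

lemma rv_diff:
  assumes "f \<in> random_variables M UNIV" "g \<in> random_variables M UNIV"
  shows "(\<lambda>\<omega>. f \<omega> - g \<omega>) \<in> random_variables M UNIV"
  using assms tendsto_diff UNIV_I by (rule rv_map2)

lemma borel_measurable_imp_rv: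
  fixes \<xi> :: "'w \<Rightarrow> 'k::euclidean_space"
  assumes "\<xi> \<in> borel_measurable M"
  shows "\<xi> \<in> random_variables M UNIV"
proof -
  obtain t where t: "\<And>n::nat. simple_function M (t n)" "\<And>\<omega>. \<omega> \<in> space M \<Longrightarrow> (\<lambda>n. t n \<omega>) \<longlonglongrightarrow> \<xi> \<omega>"
    using borel_measurable_implies_sequence_metric[OF assms] by metis
  show ?thesis by (rule rvI[OF UNIV_I t(1) UNIV_I t(2)])
qed

lemma (in K_normed_space) rv_scl:
  assumes "\<xi> \<in> borel_measurable M" "f \<in> random_variables M V"
    and "\<And>a x. x \<in> V \<Longrightarrow> scl a x \<in> V"
  shows "(\<lambda>\<omega>. scl (\<xi> \<omega>) (f \<omega>)) \<in> random_variables M V"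
  using borel_measurable_imp_rv[OF assms(1)] assms(2) bounded_bilinear.tendsto[OF bounded_bilinear_scl] assms(3)
  by (rule rv_map2)

lemma rv_indicator:
  assumes "f \<in> random_variables M V" "A \<in> sets M"
  shows "(\<lambda>\<omega>. indicat_real A \<omega> *\<^sub>R f \<omega>) \<in> random_variables M UNIV"
  using rv_simple[OF simple_function_indicator[OF assms(2)] UNIV_I] assms(1) tendsto_scaleR UNIV_I
  by (rule rv_map2)

lemma wstarD:
  assumes "q \<in> wstar_random_variables M scl"
  shows "\<omega> \<in> space M \<Longrightarrow> q \<omega> \<in> dual_space scl" "(\<lambda>\<omega>. blinfun_apply (q \<omega>) b) \<in> borel_measurable M"
  using assms unfolding wstar_random_variables_def by auto

text \<open>The hypothesis covers constant \<open>g\<close>; a simple \<open>g\<close> patches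
  finitely many constants, and a general one is a pointwise limit, along which each
  \<open>q \<omega>\<close> is continuous.\<close>

lemma pairing_measurable:
  fixes q :: "'w \<Rightarrow> 'b::real_normed_vector \<Rightarrow>\<^sub>L 'k::real_or_complex"
  assumes g: "g \<in> random_variables M V" and q: "\<And>b. (\<lambda>\<omega>. blinfun_apply (q \<omega>) b) \<in> borel_measurable M"
  shows "(\<lambda>\<omega>. blinfun_apply (q \<omega>) (g \<omega>)) \<in> borel_measurable M"
proof -
  obtain s where s: "\<And>n::nat. simple_function M (s n)" "\<And>\<omega>. \<omega> \<in> space M \<Longrightarrow> (\<lambda>n. s n \<omega>) \<longlonglongrightarrow> g \<omega>"
    using g by (rule rvE) (rule that, assumption+)
  show ?thesis
  proof (rule borel_measurable_LIMSEQ_metric)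
    show "(\<lambda>n. blinfun_apply (q \<omega>) (s n \<omega>)) \<longlonglongrightarrow> blinfun_apply (q \<omega>) (g \<omega>)" if "\<omega> \<in> space M" for \<omega>
      using s(2)[OF that] by (intro tendsto_intros)
    show "(\<lambda>\<omega>. blinfun_apply (q \<omega>) (s n \<omega>)) \<in> borel_measurable M" for n
    proof (rule measurable_compose_countable'[where I = "s n ` space M"])
      show "s n \<in> measurable M (count_space (s n ` space M))"
        using simple_functionD[OF s(1)] by (subst measurable_count_space_eq2) auto
      show "countable (s n ` space M)" using simple_functionD(1)[OF s(1)] by (rule countable_finite)
    qed (rule q)
  qed
qed

text \<open>The substitute for separability of \<open>B\<close>: all simple approximations together
  take countably many values, so the null sets that belong to single vectors can be united.\<close>

lemma AE_rv_approx:
  assumes s: "\<And>n::nat. simple_function M (s n)" and P: "\<And>b. AE \<omega> in M. P \<omega> b"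
  shows "AE \<omega> in M. \<forall>n. P \<omega> (s n \<omega>)"
proof -
  have "countable (\<Union>n. s n ` space M)"
    using simple_functionD(1)[OF s] by (intro countable_UN) (auto intro: countable_finite)
  then have "AE \<omega> in M. \<forall>b\<in>(\<Union>n. s n ` space M). P \<omega> b"
    using P by (subst AE_ball_countable) auto
  with AE_space show ?thesis by eventually_elim blast
qed

text \<open>After scaling, the bound holds for each fixed vector; it is inserted at the values of
  the simple approximations and passes to the limit.\<close>

lemma pairing_bound:
  fixes q :: "'w \<Rightarrow> 'b::real_normed_vector \<Rightarrow>\<^sub>L 'k::real_or_complex"
  assumes g: "g \<in> random_variables M V"
    and q: "\<And>b. norm b \<le> 1 \<Longrightarrow> AE \<omega> in M. norm (blinfun_apply (q \<omega>) b) \<le> \<eta> \<omega>"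
  shows "AE \<omega> in M. norm (blinfun_apply (q \<omega>) (g \<omega>)) \<le> \<eta> \<omega> * norm (g \<omega>)"
proof -
  obtain s where s: "\<And>n::nat. simple_function M (s n)" "\<And>\<omega>. \<omega> \<in> space M \<Longrightarrow> (\<lambda>n. s n \<omega>) \<longlonglongrightarrow> g \<omega>"
    using g by (rule rvE) (rule that, assumption+)
  have "AE \<omega> in M. norm (blinfun_apply (q \<omega>) b) \<le> \<eta> \<omega> * norm b" for b
  proof (cases "b = 0")
    case False
    then have "AE \<omega> in M. norm (blinfun_apply (q \<omega>) (b /\<^sub>R norm b)) \<le> \<eta> \<omega>" by (intro q) simp
    then show ?thesis
      by eventually_elim (use False in \<open>simp add: blinfun.scaleR_right field_simps\<close>)
  qed simp
  then have "AE \<omega> in M. \<forall>n. norm (blinfun_apply (q \<omega>) (s n \<omega>)) \<le> \<eta> \<omega> * norm (s n \<omega>)"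
    by (rule AE_rv_approx[OF s(1)])
  from this AE_space show ?thesis
  proof eventually_elim
    case (elim \<omega>)
    show ?case
    proof (rule LIMSEQ_le)
      show "(\<lambda>n. norm (blinfun_apply (q \<omega>) (s n \<omega>))) \<longlonglongrightarrow> norm (blinfun_apply (q \<omega>) (g \<omega>))"
        "(\<lambda>n. \<eta> \<omega> * norm (s n \<omega>)) \<longlonglongrightarrow> \<eta> \<omega> * norm (g \<omega>)"
        using s(2)[OF elim(2)] by (auto intro!: tendsto_intros)
    qed (use elim in auto)
  qed
qed

text \<open>\<open>pairing_bound\<close> for the difference \<open>q - q'\<close> with bound
  0.\<close>

lemma pairing_cong:
  fixes q q' :: "'w \<Rightarrow> 'b::real_normed_vector \<Rightarrow>\<^sub>L 'k::real_or_complex"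
  assumes g: "g \<in> random_variables M V"
    and q: "\<And>b. AE \<omega> in M. blinfun_apply (q \<omega>) b = blinfun_apply (q' \<omega>) b"
  shows "AE \<omega> in M. blinfun_apply (q \<omega>) (g \<omega>) = blinfun_apply (q' \<omega>) (g \<omega>)"
proof -
  have "AE \<omega> in M. norm (blinfun_apply (q \<omega> - q' \<omega>) (g \<omega>)) \<le> 0 * norm (g \<omega>)"
    by (rule pairing_bound[OF g]) (use q in \<open>auto simp: blinfun.diff_left\<close>)
  then show ?thesis by eventually_elim (simp add: blinfun.diff_left)
qed

lemma rv_apply_measurable:
  fixes p :: "'w \<Rightarrow> 'b::real_normed_vector \<Rightarrow>\<^sub>L 'k::real_or_complex"
  assumes "p \<in> random_variables M V"
  shows "(\<lambda>\<omega>. blinfun_apply (p \<omega>) b) \<in> borel_measurable M"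
proof -
  obtain s where s: "\<And>n::nat. simple_function M (s n)" "\<And>\<omega>. \<omega> \<in> space M \<Longrightarrow> (\<lambda>n. s n \<omega>) \<longlonglongrightarrow> p \<omega>"
    using assms by (rule rvE) (rule that, assumption+)
  show ?thesis
  proof (rule borel_measurable_LIMSEQ_metric)
    show "(\<lambda>n. blinfun_apply (s n \<omega>) b) \<longlonglongrightarrow> blinfun_apply (p \<omega>) b" if "\<omega> \<in> space M" for \<omega>
      using s(2)[OF that] by (intro tendsto_intros)
    show "(\<lambda>\<omega>. blinfun_apply (s n \<omega>) b) \<in> borel_measurable M" for n
      by (rule borel_measurable_simple_function, rule simple_function_compose1[OF s(1)])
  qed
qed

lemma strong_imp_wstar:
  "p \<in> random_variables M (dual_space scl) \<Longrightarrow> p \<in> wstar_random_variables M scl"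
  unfolding wstar_random_variables_def using rvD[of p M] rv_apply_measurable[of p M] by blast

text \<open>A strongly measurable functional is normed by countably many unit vectors, chosen almost
  optimally for each of the countably many values of its simple approximations.\<close>

lemma strong_norm_countable:
  fixes p :: "'w \<Rightarrow> 'b::real_normed_vector \<Rightarrow>\<^sub>L 'k::real_or_complex"
  assumes "p \<in> random_variables M V"
  shows "\<exists>D. countable D \<and> D \<subseteq> {b. norm b \<le> 1} \<and>
    (\<forall>\<omega>\<in>space M. \<forall>c. (\<forall>b\<in>D. norm (blinfun_apply (p \<omega>) b) \<le> c) \<longrightarrow> norm (p \<omega>) \<le> c)"
proof -
  obtain s where s: "\<And>n::nat. simple_function M (s n)" "\<And>\<omega>. \<omega> \<in> space M \<Longrightarrow> (\<lambda>n. s n \<omega>) \<longlonglongrightarrow> p \<omega>"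
    using assms by (rule rvE) (rule that, assumption+)
  define Q where "Q = (\<Union>n. s n ` space M)"
  have Q: "countable Q" unfolding Q_def
    using simple_functionD(1)[OF s(1)] by (intro countable_UN) (auto intro: countable_finite)
  have "\<exists>b. norm b \<le> 1 \<and> norm f - 1 / real (Suc k) < norm (blinfun_apply f b)" for f :: "'b \<Rightarrow>\<^sub>L 'k" and k
  proof (rule ccontr)
    assume "\<not> ?thesis"
    then have "norm f \<le> norm f - 1 / real (Suc k)" by (intro norm_blinfun_le_unit) (auto simp: not_less)
    then show False by simp
  qed
  then obtain B where B: "\<And>f k. norm (B f k) \<le> 1"
      "\<And>f k. norm f - 1 / real (Suc k) < norm (blinfun_apply (f :: 'b \<Rightarrow>\<^sub>L 'k) (B f k))" by metis
  define D where "D = (\<Union>f\<in>Q. range (B f))"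
  have "norm (p \<omega>) \<le> c" if w: "\<omega> \<in> space M" and c: "\<forall>b\<in>D. norm (blinfun_apply (p \<omega>) b) \<le> c" for \<omega> c
  proof (rule field_le_epsilon)
    fix e :: real assume e: "0 < e"
    \<comment> \<open>One third each for the norm of \<open>s n \<omega>\<close>, for evaluating it
      in place of \<open>p \<omega>\<close>, and for the almost optimal unit vector.\<close>
    obtain n where n: "norm (s n \<omega> - p \<omega>) < e / 3"
      using LIMSEQ_D[OF s(2)[OF w], of "e/3"] e by auto
    obtain k :: nat where k: "1 / real (Suc k) < e / 3" using nat_approx_posE[of "e/3"] e by auto
    let ?b = "B (s n \<omega>) k"
    have bD: "?b \<in> D" using w by (auto simp: D_def Q_def)
    have "norm (blinfun_apply (s n \<omega> - p \<omega>) ?b) \<le> norm (s n \<omega> - p \<omega>) * norm ?b" by (rule norm_blinfun)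
    also have "\<dots> \<le> norm (s n \<omega> - p \<omega>) * 1" using B(1) by (intro mult_left_mono) auto
    finally have "norm (blinfun_apply (s n \<omega>) ?b - blinfun_apply (p \<omega>) ?b) < e / 3"
      using n by (simp add: blinfun.diff_left)
    moreover have "norm (blinfun_apply (s n \<omega>) ?b) \<le>
        norm (blinfun_apply (s n \<omega>) ?b - blinfun_apply (p \<omega>) ?b) + norm (blinfun_apply (p \<omega>) ?b)"
      by (metis diff_add_cancel norm_triangle_ineq)
    moreover have "norm (p \<omega>) \<le> norm (s n \<omega>) + norm (s n \<omega> - p \<omega>)"
      by (metis add.commute diff_add_cancel norm_minus_commute norm_triangle_sub)
    ultimately show "norm (p \<omega>) \<le> c + e" using n k B(2)[of "s n \<omega>" k] c bD by fastforce
  qed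
  then show ?thesis using B(1) Q by (intro exI[of _ D]) (auto simp: D_def)
qed

text \<open>The countable norming set turns bounds on single vectors into a bound on the operator
  norm off one null set.\<close>

lemma strong_norm_AE_le:
  fixes p :: "'w \<Rightarrow> 'b::real_normed_vector \<Rightarrow>\<^sub>L 'k::real_or_complex"
  assumes p: "p \<in> random_variables M V"
    and le: "\<And>b. norm b \<le> 1 \<Longrightarrow> AE \<omega> in M. norm (blinfun_apply (p \<omega>) b) \<le> \<eta> \<omega>"
  shows "AE \<omega> in M. norm (p \<omega>) \<le> \<eta> \<omega>"
proof -
  obtain D where D: "countable D" "D \<subseteq> {b. norm b \<le> 1}"
    "\<forall>\<omega>\<in>space M. \<forall>c. (\<forall>b\<in>D. norm (blinfun_apply (p \<omega>) b) \<le> c) \<longrightarrow> norm (p \<omega>) \<le> c"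
    using strong_norm_countable[OF p] by (elim exE conjE) (rule that)
  have "AE \<omega> in M. \<forall>b\<in>D. norm (blinfun_apply (p \<omega>) b) \<le> \<eta> \<omega>"
    using D(1,2) le by (subst AE_ball_countable) auto
  with AE_space show ?thesis by eventually_elim (use D(3) in blast)
qed

lemma strong_AE_eq:
  fixes p p' :: "'w \<Rightarrow> 'b::real_normed_vector \<Rightarrow>\<^sub>L 'k::real_or_complex"
  assumes p: "p \<in> random_variables M V" "p' \<in> random_variables M V"
    and eq: "\<And>b. AE \<omega> in M. blinfun_apply (p \<omega>) b = blinfun_apply (p' \<omega>) b"
  shows "AE \<omega> in M. p \<omega> = p' \<omega>"
proof -
  have "AE \<omega> in M. norm (p \<omega> - p' \<omega>) \<le> 0"
    by (rule strong_norm_AE_le[OF rv_diff[OF rv_mono[OF p(1)] rv_mono[OF p(2)]]])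
      (use eq in \<open>auto simp: blinfun.diff_left\<close>)
  then show ?thesis by eventually_elim simp
qed

text \<open>Evaluation at \<open>b\<close> is linear and multiplies norms by at most
  \<open>norm b\<close>, so it carries approximating simple functions and their integrals to those
  of the scalar function.\<close>

lemma has_vector_integral_apply:
  fixes h :: "'w \<Rightarrow> 'b::real_normed_vector \<Rightarrow>\<^sub>L 'k::real_or_complex"
  assumes "has_vector_integral M h x"
  shows "has_bochner_integral M (\<lambda>\<omega>. blinfun_apply (h \<omega>) b) (blinfun_apply x b)"
proof -
  obtain s where s: "\<And>n::nat. Bochner_Integration.simple_bochner_integrable M (s n)"
      "(\<lambda>n. \<integral>\<^sup>+\<omega>. norm (h \<omega> - s n \<omega>) \<partial>M) \<longlonglongrightarrow> 0"
      "(\<lambda>n. Bochner_Integration.simple_bochner_integral M (s n)) \<longlonglongrightarrow> x" and h: "h \<in> random_variables M UNIV"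
    using assms unfolding has_vector_integral_def by blast
  have lin: "linear (\<lambda>f :: 'b \<Rightarrow>\<^sub>L 'k. blinfun_apply f b)"
    by (rule linearI) (simp_all add: blinfun.add_left blinfun.scaleR_left)
  show ?thesis
  proof (rule has_bochner_integral.intros)
    show "(\<lambda>\<omega>. blinfun_apply (h \<omega>) b) \<in> borel_measurable M" by (rule rv_apply_measurable[OF h])
    show "Bochner_Integration.simple_bochner_integrable M (\<lambda>\<omega>. blinfun_apply (s n \<omega>) b)" for n
      by (rule simple_bochner_integrable_compose2[OF _ s(1) s(1), of "\<lambda>f _. blinfun_apply f b"]) simp
    show "(\<lambda>n. \<integral>\<^sup>+\<omega>. norm (blinfun_apply (h \<omega>) b - blinfun_apply (s n \<omega>) b) \<partial>M) \<longlonglongrightarrow> 0"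
    proof (rule tendsto_sandwich[OF _ _ tendsto_const])
      show "\<forall>\<^sub>F n in sequentially. (\<integral>\<^sup>+\<omega>. norm (blinfun_apply (h \<omega>) b - blinfun_apply (s n \<omega>) b) \<partial>M) \<le>
          ennreal (norm b) * (\<integral>\<^sup>+\<omega>. norm (h \<omega> - s n \<omega>) \<partial>M)"
      proof (intro always_eventually allI)
        fix n
        have m: "(\<lambda>\<omega>. norm (h \<omega> - s n \<omega>)) \<in> borel_measurable M"
          using s(1)[of n] by (intro rv_norm_measurable[OF rv_diff[OF h rv_simple]])
            (auto elim: simple_bochner_integrable.cases)
        have "(\<integral>\<^sup>+\<omega>. norm (blinfun_apply (h \<omega>) b - blinfun_apply (s n \<omega>) b) \<partial>M) \<le>
            (\<integral>\<^sup>+\<omega>. ennreal (norm b) * norm (h \<omega> - s n \<omega>) \<partial>M)"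
          using norm_blinfun[of "h _ - s n _" b]
          by (intro nn_integral_mono) (auto simp: ennreal_mult[symmetric] blinfun.diff_left mult.commute intro!: ennreal_leI)
        also have "\<dots> = ennreal (norm b) * (\<integral>\<^sup>+\<omega>. norm (h \<omega> - s n \<omega>) \<partial>M)"
          by (rule nn_integral_cmult) (rule measurable_compose[OF m measurable_ennreal])
        finally show "(\<integral>\<^sup>+\<omega>. norm (blinfun_apply (h \<omega>) b - blinfun_apply (s n \<omega>) b) \<partial>M) \<le>
          ennreal (norm b) * (\<integral>\<^sup>+\<omega>. norm (h \<omega> - s n \<omega>) \<partial>M)" .
      qed
      have "(\<lambda>n. ennreal (norm b) * (\<integral>\<^sup>+\<omega>. norm (h \<omega> - s n \<omega>) \<partial>M)) \<longlonglongrightarrow> ennreal (norm b) * 0"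
        by (rule ennreal_tendsto_cmult[OF _ s(2)]) simp
      then show "(\<lambda>n. ennreal (norm b) * (\<integral>\<^sup>+\<omega>. norm (h \<omega> - s n \<omega>) \<partial>M)) \<longlonglongrightarrow> 0" by simp
    qed simp
    have "Bochner_Integration.simple_bochner_integral M (\<lambda>\<omega>. blinfun_apply (s n \<omega>) b) = blinfun_apply (Bochner_Integration.simple_bochner_integral M (s n)) b" for n
      by (rule simple_bochner_integral_linear[OF lin s(1)])
    then show "(\<lambda>n. Bochner_Integration.simple_bochner_integral M (\<lambda>\<omega>. blinfun_apply (s n \<omega>) b)) \<longlonglongrightarrow> blinfun_apply x b"
      using s(3) by (simp add: tendsto_intros)
  qed
qed

text \<open>Dominated convergence of truncated simple approximations. The candidate \<open>y\<close>
  is known through its evaluations, so the integrals of the approximations are compared with it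
  directly, on unit vectors.\<close>

lemma has_vector_integralI:
  fixes p :: "'w \<Rightarrow> 'b::real_normed_vector \<Rightarrow>\<^sub>L 'k::real_or_complex"
  assumes M: "finite_measure M" and p: "p \<in> random_variables M V" and A: "A \<in> sets M"
    and int: "integrable M (\<lambda>\<omega>. norm (p \<omega>))"
    and y: "\<And>b. (\<integral>\<omega>\<in>A. blinfun_apply (p \<omega>) b \<partial>M) = blinfun_apply y b"
  shows "has_vector_integral M (\<lambda>\<omega>. indicator A \<omega> *\<^sub>R p \<omega>) y"
proof -
  interpret finite_measure M by (rule M)
  let ?p = "\<lambda>\<omega>. indicat_real A \<omega> *\<^sub>R p \<omega>"
  have p': "?p \<in> random_variables M UNIV" by (rule rv_indicator[OF p A])
  obtain s where s: "\<And>n::nat. simple_function M (s n)" "\<And>\<omega>. \<omega> \<in> space M \<Longrightarrow> (\<lambda>n. s n \<omega>) \<longlonglongrightarrow> ?p \<omega>"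
    using p' by (rule rvE) (rule that, assumption+)
  have [measurable]: "(\<lambda>\<omega>. norm (?p \<omega>)) \<in> borel_measurable M" by (rule rv_norm_measurable[OF p'])
  have [measurable]: "(\<lambda>\<omega>. norm (s n \<omega>)) \<in> borel_measurable M" for n
    by (rule rv_norm_measurable[OF rv_simple[OF s(1) UNIV_I]])
  \<comment> \<open>The factor 2 leaves room: where the limit is nonzero, \<open>s n\<close>
    satisfies the inequality eventually, and where it is zero, so is the truncation. Domination is
    thus gained without disturbing the limit.\<close>
  define E where "E n = {\<omega> \<in> space M. norm (s n \<omega>) \<le> 2 * norm (?p \<omega>)}" for n
  have E: "E n \<in> sets M" for n unfolding E_def by measurable
  define t where "t n \<omega> = indicat_real (E n) \<omega> *\<^sub>R s n \<omega>" for n \<omega>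
  have ts: "simple_function M (t n)" for n
    unfolding t_def[abs_def] by (rule simple_function_compose2[OF simple_function_indicator[OF E] s(1)])
  have tb: "Bochner_Integration.simple_bochner_integrable M (t n)" for n
    by (rule simple_bochner_integrable.intros[OF ts]) simp
  have tlim: "(\<lambda>n. t n \<omega>) \<longlonglongrightarrow> ?p \<omega>" if w: "\<omega> \<in> space M" for \<omega>
  proof (cases "?p \<omega> = 0")
    case True
    then have "t n \<omega> = 0" for n by (auto simp: t_def E_def indicator_def)
    then have "(\<lambda>n. t n \<omega>) = (\<lambda>_. 0)" by auto
    then show ?thesis unfolding True by simp
  next
    case False
    have "eventually (\<lambda>n. norm (s n \<omega>) < 2 * norm (?p \<omega>)) sequentially"
      using False by (intro order_tendstoD(2)[OF tendsto_norm[OF s(2)[OF w]]])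
        (auto simp: indicator_def split: if_splits)
    then have "eventually (\<lambda>n. s n \<omega> = t n \<omega>) sequentially"
      by eventually_elim (use w in \<open>auto simp: t_def E_def\<close>)
    then show ?thesis using s(2)[OF w] by (rule Lim_transform_eventually[rotated])
  qed
  have tnorm: "norm (t n \<omega>) \<le> 2 * norm (?p \<omega>)" for n \<omega>
    by (auto simp: t_def E_def indicator_def split: if_splits)
  define e where "e n \<omega> = norm (?p \<omega> - t n \<omega>)" for n \<omega>
  have em [measurable]: "e n \<in> borel_measurable M" for n
    unfolding e_def[abs_def] by (rule rv_norm_measurable[OF rv_diff[OF p' rv_simple[OF ts]]]) simp
  have pint: "integrable M (\<lambda>\<omega>. norm (?p \<omega>))"
    using integrable_mult_indicator[OF A int] by simp
  have ebound: "norm (e n \<omega>) \<le> 3 * norm (?p \<omega>)" for n \<omega>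
    using norm_triangle_ineq4[of "?p \<omega>" "t n \<omega>"] tnorm[of n \<omega>] by (simp add: e_def)
  have eint: "integrable M (e n)" for n
    by (rule Bochner_Integration.integrable_bound[of M "\<lambda>\<omega>. 3 * norm (?p \<omega>)"])
      (use pint ebound in \<open>auto simp: em\<close>)
  have "(\<lambda>n. \<integral>\<omega>. e n \<omega> \<partial>M) \<longlonglongrightarrow> (\<integral>\<omega>. 0 \<partial>M)"
  proof (rule integral_dominated_convergence[where w = "\<lambda>\<omega>. 3 * norm (?p \<omega>)"])
    show "AE \<omega> in M. (\<lambda>n. e n \<omega>) \<longlonglongrightarrow> 0"
    proof (rule AE_I2)
      fix \<omega> assume "\<omega> \<in> space M"
      then have "(\<lambda>n. e n \<omega>) \<longlonglongrightarrow> norm (?p \<omega> - ?p \<omega>)"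
        unfolding e_def by (intro tendsto_intros tlim)
      then show "(\<lambda>n. e n \<omega>) \<longlonglongrightarrow> 0" by simp
    qed
    show "AE \<omega> in M. norm (e n \<omega>) \<le> 3 * norm (?p \<omega>)" for n using ebound by (intro AE_I2)
    show "integrable M (\<lambda>\<omega>. 3 * norm (?p \<omega>))" using pint by (rule integrable_mult_right)
  qed measurable
  then have elim: "(\<lambda>n. \<integral>\<omega>. e n \<omega> \<partial>M) \<longlonglongrightarrow> 0" by simp
  have "(\<integral>\<^sup>+\<omega>. norm (?p \<omega> - t n \<omega>) \<partial>M) = ennreal (\<integral>\<omega>. e n \<omega> \<partial>M)" for n
    using nn_integral_eq_integral[OF eint[of n]] unfolding e_def[abs_def] by simp
  then have 1: "(\<lambda>n. \<integral>\<^sup>+\<omega>. norm (?p \<omega> - t n \<omega>) \<partial>M) \<longlonglongrightarrow> 0"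
    using tendsto_ennrealI[OF elim] by simp
  let ?X = "\<lambda>n. Bochner_Integration.simple_bochner_integral M (t n)"
  have lin: "linear (\<lambda>f :: 'b \<Rightarrow>\<^sub>L 'k. blinfun_apply f b)" for b
    by (rule linearI) (simp_all add: blinfun.add_left blinfun.scaleR_left)
  have pb: "integrable M (\<lambda>\<omega>. blinfun_apply (?p \<omega>) b)" for b
  proof (rule Bochner_Integration.integrable_bound[of M "\<lambda>\<omega>. norm (?p \<omega>) * norm b"])
    show "integrable M (\<lambda>\<omega>. norm (?p \<omega>) * norm b)" using pint by (rule integrable_mult_left)
    show "(\<lambda>\<omega>. blinfun_apply (?p \<omega>) b) \<in> borel_measurable M" by (rule rv_apply_measurable[OF p'])
    show "AE \<omega> in M. norm (blinfun_apply (?p \<omega>) b) \<le> norm (norm (?p \<omega>) * norm b)"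
      using norm_blinfun[of "?p _" b] by (intro AE_I2) (simp add: abs_mult)
  qed
  have "norm (?X n - y) \<le> (\<integral>\<omega>. e n \<omega> \<partial>M)" for n
  proof (rule norm_blinfun_le_unit)
    fix b :: 'b assume b: "norm b \<le> 1"
    have tbb: "Bochner_Integration.simple_bochner_integrable M (\<lambda>\<omega>. blinfun_apply (t n \<omega>) b)"
      by (rule simple_bochner_integrable_compose2[OF _ tb tb, of "\<lambda>f _. blinfun_apply f b"]) simp
    have ti: "integrable M (\<lambda>\<omega>. blinfun_apply (t n \<omega>) b)"
      using has_bochner_integral_simple_bochner_integrable[OF tbb] by (rule integrable.intros)
    have "blinfun_apply (?X n) b = (\<integral>\<omega>. blinfun_apply (t n \<omega>) b \<partial>M)"
      unfolding simple_bochner_integral_linear[OF lin tb, symmetric]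
      by (rule simple_bochner_integrable_eq_integral[OF tbb])
    moreover have "blinfun_apply y b = (\<integral>\<omega>. blinfun_apply (?p \<omega>) b \<partial>M)"
      unfolding y[symmetric] by (simp add: set_lebesgue_integral_def blinfun.scaleR_left)
    ultimately have "blinfun_apply (?X n - y) b = (\<integral>\<omega>. blinfun_apply (t n \<omega>) b - blinfun_apply (?p \<omega>) b \<partial>M)"
      by (simp only: blinfun.diff_left Bochner_Integration.integral_diff[OF ti pb])
    then have "norm (blinfun_apply (?X n - y) b) \<le> (\<integral>\<omega>. norm (blinfun_apply (t n \<omega>) b - blinfun_apply (?p \<omega>) b) \<partial>M)"
      by (simp only: integral_norm_bound)
    also have "\<dots> \<le> (\<integral>\<omega>. e n \<omega> \<partial>M)"
    proof (rule integral_mono[OF _ eint])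
      show "integrable M (\<lambda>\<omega>. norm (blinfun_apply (t n \<omega>) b - blinfun_apply (?p \<omega>) b))"
        using ti pb by (intro integrable_norm Bochner_Integration.integrable_diff)
      fix \<omega>
      have "norm (blinfun_apply (t n \<omega> - ?p \<omega>) b) \<le> norm (t n \<omega> - ?p \<omega>) * norm b" by (rule norm_blinfun)
      also have "\<dots> \<le> norm (t n \<omega> - ?p \<omega>) * 1" using b by (intro mult_left_mono) auto
      finally show "norm (blinfun_apply (t n \<omega>) b - blinfun_apply (?p \<omega>) b) \<le> e n \<omega>"
        by (simp add: e_def blinfun.diff_left norm_minus_commute)
    qed
    finally show "norm (blinfun_apply (?X n - y) b) \<le> (\<integral>\<omega>. e n \<omega> \<partial>M)" .
  qed
  then have "(\<lambda>n. ?X n - y) \<longlonglongrightarrow> 0"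
    by (intro Lim_null_comparison[OF _ elim]) auto
  then have "?X \<longlonglongrightarrow> y" by (rule LIM_zero_cancel)
  then show ?thesis using p' tb 1 unfolding has_vector_integral_def by blast
qed

text \<open>Comparing \<open>g\<close> with a fixed \<open>b\<close> leaves an error of at most
  \<open>\<eta>\<close> times their distance; at almost every \<omega> one may then put
  \<open>b = s n \<omega>\<close>. The bound itself localizes \<open>\<Phi>\<close>, in place of a
  splitting along the pieces of simple functions.\<close>

lemma (in K_normed_space) determined_by_constants:
  fixes \<Phi> :: "('w \<Rightarrow> 'b) \<Rightarrow> 'w \<Rightarrow> 'k" and q :: "'w \<Rightarrow> 'b \<Rightarrow>\<^sub>L 'k"
  assumes g: "g \<in> random_variables M UNIV"
    and add: "\<And>g h. g \<in> random_variables M UNIV \<Longrightarrow> h \<in> random_variables M UNIV \<Longrightarrow>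
      AE \<omega> in M. \<Phi> (\<lambda>\<omega>. g \<omega> + h \<omega>) \<omega> = \<Phi> g \<omega> + \<Phi> h \<omega>"
    and bound: "\<And>g. g \<in> random_variables M UNIV \<Longrightarrow> AE \<omega> in M. norm (\<Phi> g \<omega>) \<le> \<eta> \<omega> * norm (g \<omega>)"
    and const: "\<And>b. AE \<omega> in M. \<Phi> (\<lambda>_. b) \<omega> = blinfun_apply (q \<omega>) b"
  shows "AE \<omega> in M. \<Phi> g \<omega> = blinfun_apply (q \<omega>) (g \<omega>)"
proof -
  obtain s where s: "\<And>n::nat. simple_function M (s n)" "\<And>\<omega>. \<omega> \<in> space M \<Longrightarrow> (\<lambda>n. s n \<omega>) \<longlonglongrightarrow> g \<omega>"
    using g by (rule rvE) (rule that, assumption+)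
  have c: "(\<lambda>_. b) \<in> random_variables M UNIV" for b :: 'b by (rule rv_const) simp
  have "AE \<omega> in M. norm (\<Phi> g \<omega> - blinfun_apply (q \<omega>) b) \<le> \<eta> \<omega> * norm (g \<omega> - b)" for b
  proof -
    have gb: "(\<lambda>\<omega>. g \<omega> - b) \<in> random_variables M UNIV" by (rule rv_diff[OF g c])
    from add[OF gb c, of b] bound[OF gb] const[of b] show ?thesis
      by eventually_elim simp
  qed
  then have "AE \<omega> in M. \<forall>n. norm (\<Phi> g \<omega> - blinfun_apply (q \<omega>) (s n \<omega>)) \<le> \<eta> \<omega> * norm (g \<omega> - s n \<omega>)"
    by (rule AE_rv_approx[OF s(1)])
  with AE_space show ?thesis
  proof eventually_elim
    case (elim \<omega>)
    have "(\<lambda>n. \<eta> \<omega> * norm (g \<omega> - s n \<omega>)) \<longlonglongrightarrow> \<eta> \<omega> * norm (g \<omega> - g \<omega>)"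
      by (intro tendsto_intros s(2) elim(1))
    then have "(\<lambda>n. \<eta> \<omega> * norm (g \<omega> - s n \<omega>)) \<longlonglongrightarrow> 0" by simp
    from Lim_null_comparison[OF always_eventually[OF elim(2)] this]
    have "(\<lambda>n. \<Phi> g \<omega> - blinfun_apply (q \<omega>) (s n \<omega>)) \<longlonglongrightarrow> 0" .
    moreover have "(\<lambda>n. \<Phi> g \<omega> - blinfun_apply (q \<omega>) (s n \<omega>)) \<longlonglongrightarrow> \<Phi> g \<omega> - blinfun_apply (q \<omega>) (g \<omega>)"
      by (intro tendsto_intros s(2) elim(1))
    ultimately have "\<Phi> g \<omega> - blinfun_apply (q \<omega>) (g \<omega>) = 0" by (rule LIMSEQ_unique[rotated])
    then show ?case by simp
  qed
qed

section \<open>Quotient modules\<close>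

lemma equiv_ae_rel: "equiv S (ae_rel M S)"
proof (rule equivI)
  show "ae_rel M S \<subseteq> S \<times> S" by (auto simp: ae_rel_def)
  show "refl_on S (ae_rel M S)" by (auto simp: ae_rel_def refl_on_def)
  show "sym (ae_rel M S)" by (rule symI) (auto simp: ae_rel_def elim: eventually_mono)
  show "trans (ae_rel M S)"
  proof (rule transI)
    fix f g h assume "(f, g) \<in> ae_rel M S" "(g, h) \<in> ae_rel M S"
    then have "f \<in> S" "h \<in> S" "AE x in M. f x = g x" "AE x in M. g x = h x" by (auto simp: ae_rel_def)
    moreover from this(3,4) have "AE x in M. f x = h x" by eventually_elim simp
    ultimately show "(f, h) \<in> ae_rel M S" by (simp add: ae_rel_def)
  qed
qed

lemma equiv_wstar_rel: "equiv (wstar_random_variables M scl) (wstar_rel M scl)"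
proof (rule equivI)
  show "wstar_rel M scl \<subseteq> wstar_random_variables M scl \<times> wstar_random_variables M scl"
    by (auto simp: wstar_rel_def)
  show "refl_on (wstar_random_variables M scl) (wstar_rel M scl)" by (auto simp: wstar_rel_def refl_on_def)
  show "sym (wstar_rel M scl)"
    by (rule symI) (simp add: wstar_rel_def eq_commute)
  show "trans (wstar_rel M scl)"
  proof (rule transI)
    fix f g h assume a: "(f, g) \<in> wstar_rel M scl" "(g, h) \<in> wstar_rel M scl"
    have "AE x in M. blinfun_apply (f x) b = blinfun_apply (h x) b" for b
    proof -
      have "AE x in M. blinfun_apply (f x) b = blinfun_apply (g x) b"
        "AE x in M. blinfun_apply (g x) b = blinfun_apply (h x) b" using a by (auto simp: wstar_rel_def)
      then show ?thesis by eventually_elim simp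
    qed
    then show "(f, h) \<in> wstar_rel M scl" using a by (simp add: wstar_rel_def)
  qed
qed

text \<open>Here and in \<open>lift2_class\<close> the union over all representatives collapses,
  because compatibility puts every result into the class of one of them.\<close>

lemma lift1_class:
  assumes "equiv S1 R1" "equiv S R" "x \<in> S1"
    and compat: "\<And>x'. (x, x') \<in> R1 \<Longrightarrow> ((\<lambda>\<omega>. op (x \<omega>)), (\<lambda>\<omega>. op (x' \<omega>))) \<in> R"
  shows "lift1 R op (R1 `` {x}) = R `` {\<lambda>\<omega>. op (x \<omega>)}"
proof -
  have "R `` {\<lambda>\<omega>. op (x' \<omega>)} = R `` {\<lambda>\<omega>. op (x \<omega>)}" if "x' \<in> R1 `` {x}" for x'
    using equiv_class_eq[OF assms(2) compat] that by auto
  moreover have "x \<in> R1 `` {x}" using equiv_class_self[OF assms(1,3)] .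
  ultimately show ?thesis unfolding lift1_def by blast
qed

lemma lift2_class:
  assumes "equiv S1 R1" "equiv S2 R2" "equiv S R" "x \<in> S1" "y \<in> S2"
    and compat: "\<And>x' y'. (x, x') \<in> R1 \<Longrightarrow> (y, y') \<in> R2 \<Longrightarrow>
      ((\<lambda>\<omega>. op (x \<omega>) (y \<omega>)), (\<lambda>\<omega>. op (x' \<omega>) (y' \<omega>))) \<in> R"
  shows "lift2 R op (R1 `` {x}) (R2 `` {y}) = R `` {\<lambda>\<omega>. op (x \<omega>) (y \<omega>)}"
proof -
  have "R `` {\<lambda>\<omega>. op (x' \<omega>) (y' \<omega>)} = R `` {\<lambda>\<omega>. op (x \<omega>) (y \<omega>)}"
    if "x' \<in> R1 `` {x}" "y' \<in> R2 `` {y}" for x' y'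
    using equiv_class_eq[OF assms(3) compat] that by auto
  moreover have "x \<in> R1 `` {x}" "y \<in> R2 `` {y}"
    using equiv_class_self[OF assms(1,4)] equiv_class_self[OF assms(2,5)] .
  ultimately show ?thesis unfolding lift2_def by blast
qed

section \<open>Scalar classes, their ring and their order in terms of representatives\<close>

abbreviation L0_class :: "'w measure \<Rightarrow> ('w \<Rightarrow> 'k::real_normed_field) \<Rightarrow> ('w \<Rightarrow> 'k) set" where
  "L0_class M x \<equiv> L0_rel M `` {x}"

lemma L0_class_eq_iff:
  "x \<in> borel_measurable M \<Longrightarrow> y \<in> borel_measurable M \<Longrightarrow> L0_class M x = L0_class M y \<longleftrightarrow> (AE \<omega> in M. x \<omega> = y \<omega>)"
  by (subst eq_equiv_class_iff[OF equiv_ae_rel]) (auto simp: ae_rel_def)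

lemma L0_class_closed: "x \<in> borel_measurable M \<Longrightarrow> L0_class M x \<in> carrier (L0_ring M)"
  by (simp add: L0_ring_def quotientI)

lemma L0_carrierE:
  assumes "X \<in> carrier (L0_ring M)"
  obtains x where "x \<in> borel_measurable M" "X = L0_class M x"
  using assms by (auto simp: L0_ring_def elim: quotientE)

lemma L0_mult:
  fixes x y :: "'w \<Rightarrow> 'k::real_or_complex"
  assumes "x \<in> borel_measurable M" "y \<in> borel_measurable M"
  shows "L0_class M x \<otimes>\<^bsub>L0_ring M\<^esub> L0_class M y = L0_class M (\<lambda>\<omega>. x \<omega> * y \<omega>)"
proof -
  have "lift2 (L0_rel M) (*) (L0_class M x) (L0_class M y) = L0_class M (\<lambda>\<omega>. x \<omega> * y \<omega>)"
    by (rule lift2_class[OF equiv_ae_rel equiv_ae_rel equiv_ae_rel assms])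
      (auto simp: ae_rel_def elim!: eventually_elim2)
  then show ?thesis by (simp add: L0_ring_def)
qed

lemma L0_add:
  fixes x y :: "'w \<Rightarrow> 'k::real_or_complex"
  assumes "x \<in> borel_measurable M" "y \<in> borel_measurable M"
  shows "L0_class M x \<oplus>\<^bsub>L0_ring M\<^esub> L0_class M y = L0_class M (\<lambda>\<omega>. x \<omega> + y \<omega>)"
proof -
  have "lift2 (L0_rel M) (+) (L0_class M x) (L0_class M y) = L0_class M (\<lambda>\<omega>. x \<omega> + y \<omega>)"
    by (rule lift2_class[OF equiv_ae_rel equiv_ae_rel equiv_ae_rel assms])
      (auto simp: ae_rel_def elim!: eventually_elim2)
  then show ?thesis by (simp add: L0_ring_def)
qed

lemma L0_zero: "\<zero>\<^bsub>L0_ring M\<^esub> = L0_class M (\<lambda>_. 0)"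
  and L0_one: "\<one>\<^bsub>L0_ring M\<^esub> = L0_class M (\<lambda>_. 1)"
  by (simp_all add: L0_ring_def)

lemma L0_abs_class:
  fixes x :: "'w \<Rightarrow> 'k::real_or_complex"
  assumes "x \<in> borel_measurable M"
  shows "L0_abs M (L0_class M x) = L0_class M (\<lambda>\<omega>. norm (x \<omega>))"
  unfolding L0_abs_def
  by (rule lift1_class[OF equiv_ae_rel equiv_ae_rel assms])
    (auto simp: ae_rel_def elim!: eventually_mono)

lemma L0_le_iff:
  assumes x: "x \<in> borel_measurable M" and y: "y \<in> borel_measurable M"
  shows "L0_class M x \<sqsubseteq>\<^bsub>L0_order M\<^esub> L0_class M y \<longleftrightarrow> (AE \<omega> in M. x \<omega> \<le> (y \<omega> :: real))"
proof
  assume "L0_class M x \<sqsubseteq>\<^bsub>L0_order M\<^esub> L0_class M y"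
  then obtain x' y' where "AE \<omega> in M. x \<omega> = x' \<omega>" "AE \<omega> in M. y \<omega> = y' \<omega>" "AE \<omega> in M. x' \<omega> \<le> y' \<omega>"
    by (auto simp: L0_order_def ae_rel_def)
  then show "AE \<omega> in M. x \<omega> \<le> y \<omega>" by eventually_elim simp
next
  assume "AE \<omega> in M. x \<omega> \<le> y \<omega>"
  then show "L0_class M x \<sqsubseteq>\<^bsub>L0_order M\<^esub> L0_class M y"
    using equiv_class_self[OF equiv_ae_rel x] equiv_class_self[OF equiv_ae_rel y]
    by (auto simp: L0_order_def)
qed

lemma L0_order_carrier: "carrier (L0_order M) = carrier (L0_ring M)"
  by (simp add: L0_order_def L0_ring_def)

lemma L0_nonneg_iff:
  assumes x: "x \<in> borel_measurable M"
  shows "L0_class M x \<in> L0_nonneg M \<longleftrightarrow> (AE \<omega> in M. 0 \<le> x \<omega>)"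
  using L0_class_closed[OF x] L0_le_iff[OF _ x, of "\<lambda>_. 0"]
  by (simp add: L0_nonneg_def L0_zero L0_order_carrier)

lemma L0_nonnegE:
  assumes "X \<in> L0_nonneg M"
  obtains x where "x \<in> borel_measurable M" "X = L0_class M x" "AE \<omega> in M. 0 \<le> x \<omega>"
proof -
  have "X \<in> carrier (L0_ring M)" using assms by (simp add: L0_nonneg_def L0_order_carrier)
  then obtain x where "x \<in> borel_measurable M" "X = L0_class M x" by (rule L0_carrierE)
  then show ?thesis using that assms L0_nonneg_iff by blast
qed

lemma L0_le_antisym:
  assumes "X \<in> carrier (L0_ring M)" "Y \<in> carrier (L0_ring M)" "X \<sqsubseteq>\<^bsub>L0_order M\<^esub> Y" "Y \<sqsubseteq>\<^bsub>L0_order M\<^esub> X"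
  shows "X = Y"
proof -
  obtain x where x: "x \<in> borel_measurable M" "X = L0_class M x" using assms(1) by (rule L0_carrierE)
  obtain y where y: "y \<in> borel_measurable M" "Y = L0_class M y" using assms(2) by (rule L0_carrierE)
  have "AE \<omega> in M. x \<omega> \<le> y \<omega>" "AE \<omega> in M. y \<omega> \<le> x \<omega>"
    using assms(3,4) x y L0_le_iff by blast+
  then have "AE \<omega> in M. x \<omega> = y \<omega>" by eventually_elim simp
  then show ?thesis using x y L0_class_eq_iff by blast
qed

text \<open>\<open>inf\<close> is a choice by \<open>SOME\<close>, made unique by antisymmetry on
  the carrier. The case of a least element is the one that occurs: the bounds of a represented
  functional contain its norm.\<close>

lemma L0_inf_eq:
  assumes N: "N \<in> A" and A: "A \<subseteq> carrier (L0_ring M)"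
    and le: "\<And>X. X \<in> A \<Longrightarrow> N \<sqsubseteq>\<^bsub>L0_order M\<^esub> X"
  shows "\<Sqinter>\<^bsub>L0_order M\<^esub> A = N"
  unfolding inf_def
proof (rule some_equality)
  show "greatest (L0_order M) N (Lower (L0_order M) A)"
    using assms by (auto simp: greatest_def Lower_def L0_order_carrier)
  fix Y assume "greatest (L0_order M) Y (Lower (L0_order M) A)"
  then have "Y \<in> carrier (L0_ring M)" "Y \<sqsubseteq>\<^bsub>L0_order M\<^esub> N" "N \<sqsubseteq>\<^bsub>L0_order M\<^esub> Y"
    using assms by (auto simp: greatest_def Lower_def L0_order_carrier)
  then show "Y = N" using L0_le_antisym N A by blast
qed

lemma L0_sup_eq:
  assumes N: "N \<in> carrier (L0_ring M)" and A: "A \<subseteq> carrier (L0_ring M)"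
    and ub: "\<And>X. X \<in> A \<Longrightarrow> X \<sqsubseteq>\<^bsub>L0_order M\<^esub> N"
    and least: "\<And>Y. Y \<in> carrier (L0_ring M) \<Longrightarrow> (\<And>X. X \<in> A \<Longrightarrow> X \<sqsubseteq>\<^bsub>L0_order M\<^esub> Y) \<Longrightarrow> N \<sqsubseteq>\<^bsub>L0_order M\<^esub> Y"
  shows "\<Squnion>\<^bsub>L0_order M\<^esub> A = N"
  unfolding sup_def
proof (rule some_equality)
  have NU: "N \<in> Upper (L0_order M) A" using N ub by (auto simp: Upper_def L0_order_carrier)
  have Ncl: "N \<sqsubseteq>\<^bsub>L0_order M\<^esub> Y" if "Y \<in> Upper (L0_order M) A" for Y
    using that A by (intro least) (auto simp: Upper_def L0_order_carrier)
  show "least (L0_order M) N (Upper (L0_order M) A)"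
    using NU Ncl by (auto simp: least_def Upper_def)
  fix Y assume "least (L0_order M) Y (Upper (L0_order M) A)"
  then have Y: "Y \<in> Upper (L0_order M) A" "Y \<sqsubseteq>\<^bsub>L0_order M\<^esub> N" using NU by (auto simp: least_def)
  then show "Y = N" using L0_le_antisym[of Y M N] Ncl N by (auto simp: Upper_def L0_order_carrier)
qed

lemma cring_L0: "cring (L0_ring M :: ('w \<Rightarrow> 'k::real_or_complex) set ring)"
proof (rule cringI)
  show "abelian_group (L0_ring M :: ('w \<Rightarrow> 'k) set ring)"
  proof (rule abelian_groupI)
    fix X :: "('w \<Rightarrow> 'k) set" assume "X \<in> carrier (L0_ring M)"
    then obtain x where x: "x \<in> borel_measurable M" "X = L0_class M x" by (rule L0_carrierE)
    show "\<exists>Y\<in>carrier (L0_ring M). Y \<oplus>\<^bsub>L0_ring M\<^esub> X = \<zero>\<^bsub>L0_ring M\<^esub>"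
      by (rule bexI[of _ "L0_class M (\<lambda>\<omega>. - x \<omega>)"]) (simp_all add: x L0_class_closed L0_add L0_zero)
  qed (auto elim!: L0_carrierE simp: L0_class_closed L0_add L0_zero add_ac)
  show "comm_monoid (L0_ring M :: ('w \<Rightarrow> 'k) set ring)"
    by (rule comm_monoidI) (auto elim!: L0_carrierE simp: L0_class_closed L0_mult L0_one mult_ac)
qed (auto elim!: L0_carrierE simp: L0_class_closed L0_mult L0_add distrib_right)

text \<open>A quotient \<open>S // R\<close> of a space of vector-valued functions with pointwise operations; \<open>N x\<close>
  represents the \<open>L\<^sup>0\<close>-norm of the class of \<open>x\<close>.\<close>

locale quotient_rn_space = K_normed_space scl
  for scl :: "'k::real_or_complex \<Rightarrow> 'x::real_normed_vector \<Rightarrow> 'x" +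
  fixes M :: "'w measure" and S :: "('w \<Rightarrow> 'x) set" and R and E :: "('w, 'k, ('w \<Rightarrow> 'x) set) rn_module"
    and N :: "('w \<Rightarrow> 'x) \<Rightarrow> 'w \<Rightarrow> real"
  assumes equiv: "equiv S R" and zero_S: "(\<lambda>_. 0) \<in> S"
    and R_add: "(x, x') \<in> R \<Longrightarrow> (y, y') \<in> R \<Longrightarrow> ((\<lambda>\<omega>. x \<omega> + y \<omega>), (\<lambda>\<omega>. x' \<omega> + y' \<omega>)) \<in> R"
    and R_scl: "(\<xi>, \<xi>') \<in> L0_rel M \<Longrightarrow> (x, x') \<in> R \<Longrightarrow> ((\<lambda>\<omega>. scl (\<xi> \<omega>) (x \<omega>)), (\<lambda>\<omega>. scl (\<xi>' \<omega>) (x' \<omega>))) \<in> R"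
    and carrier_E: "carrier E = S // R" and zero_E: "\<zero>\<^bsub>E\<^esub> = R `` {\<lambda>_. 0}"
    and add_E: "add E = lift2 R (+)" and smult_E: "smult E = lift2 R scl"
    and rnorm_E: "x \<in> S \<Longrightarrow> rnorm E (R `` {x}) = L0_class M (N x)"
    and N_measurable: "x \<in> S \<Longrightarrow> N x \<in> borel_measurable M"
    and N_nonneg: "x \<in> S \<Longrightarrow> AE \<omega> in M. 0 \<le> N x \<omega>"
    and N_scl: "\<xi> \<in> borel_measurable M \<Longrightarrow> x \<in> S \<Longrightarrow> AE \<omega> in M. N (\<lambda>\<omega>. scl (\<xi> \<omega>) (x \<omega>)) \<omega> = norm (\<xi> \<omega>) * N x \<omega>"
    and N_add: "x \<in> S \<Longrightarrow> y \<in> S \<Longrightarrow> AE \<omega> in M. N (\<lambda>\<omega>. x \<omega> + y \<omega>) \<omega> \<le> N x \<omega> + N y \<omega>"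
    and N_zero: "x \<in> S \<Longrightarrow> (AE \<omega> in M. N x \<omega> = 0) \<longleftrightarrow> (x, \<lambda>_. 0) \<in> R"
begin

lemma R_refl: "x \<in> S \<Longrightarrow> (x, x) \<in> R"
  using equiv by (auto simp: equiv_def refl_on_def)

lemma R_S: "(x, y) \<in> R \<Longrightarrow> x \<in> S"
  using equiv by (auto simp: equiv_def)

lemma add_S: "x \<in> S \<Longrightarrow> y \<in> S \<Longrightarrow> (\<lambda>\<omega>. x \<omega> + y \<omega>) \<in> S"
  using R_S[OF R_add[OF R_refl R_refl]] .

lemma scl_S: "\<xi> \<in> borel_measurable M \<Longrightarrow> x \<in> S \<Longrightarrow> (\<lambda>\<omega>. scl (\<xi> \<omega>) (x \<omega>)) \<in> S"
  by (rule R_S[OF R_scl[OF _ R_refl]]) (auto simp: ae_rel_def)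

lemma class_closed: "x \<in> S \<Longrightarrow> R `` {x} \<in> carrier E"
  by (simp add: carrier_E quotientI)

lemma carrierE:
  assumes "X \<in> carrier E"
  obtains x where "x \<in> S" "X = R `` {x}"
  using assms by (auto simp: carrier_E elim: quotientE)

lemma add_class: "x \<in> S \<Longrightarrow> y \<in> S \<Longrightarrow> R `` {x} \<oplus>\<^bsub>E\<^esub> R `` {y} = R `` {\<lambda>\<omega>. x \<omega> + y \<omega>}"
  unfolding add_E by (rule lift2_class[OF equiv equiv equiv]) (auto intro: R_add)

lemma smult_class: "\<xi> \<in> borel_measurable M \<Longrightarrow> x \<in> S \<Longrightarrow> L0_class M \<xi> \<odot>\<^bsub>E\<^esub> R `` {x} = R `` {\<lambda>\<omega>. scl (\<xi> \<omega>) (x \<omega>)}"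
  unfolding smult_E by (rule lift2_class[OF equiv_ae_rel equiv equiv]) (auto intro: R_scl)

lemma class_eq_iff: "x \<in> S \<Longrightarrow> y \<in> S \<Longrightarrow> R `` {x} = R `` {y} \<longleftrightarrow> (x, y) \<in> R"
  by (rule eq_equiv_class_iff[OF equiv])

lemma module: "Module.module (L0_ring M) E"
proof (rule moduleI[OF cring_L0])
  show "abelian_group E"
  proof (rule abelian_groupI)
    fix X assume "X \<in> carrier E"
    then obtain x where x: "x \<in> S" "X = R `` {x}" by (rule carrierE)
    \<comment> \<open>Closure of \<open>S\<close> is known for sums and scalar multiples, so
      inverses are formed as multiples by -1.\<close>
    have n: "(\<lambda>\<omega>. scl (- 1) (x \<omega>)) \<in> S" by (rule scl_S) (use x in auto)
    show "\<exists>Y\<in>carrier E. Y \<oplus>\<^bsub>E\<^esub> X = \<zero>\<^bsub>E\<^esub>"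
      by (rule bexI[of _ "R `` {\<lambda>\<omega>. scl (- 1) (x \<omega>)}"])
        (use x n in \<open>simp_all add: add_class class_closed zero_E\<close>)
  qed (auto elim!: carrierE simp: class_closed add_class zero_E zero_S add_S add_ac)
qed (auto elim!: carrierE L0_carrierE simp: class_closed add_class smult_class scl_S add_S L0_add L0_mult L0_one
    scale_left_distrib scale_right_distrib)

theorem random_normed: "random_normed_module M E"
  unfolding random_normed_module_def
proof (intro conjI ballI module)
  show "rnorm E \<in> carrier E \<rightarrow> L0_nonneg M"
    by (auto elim!: carrierE simp: rnorm_E L0_nonneg_iff N_measurable N_nonneg)
  show "rnorm E (\<xi> \<odot>\<^bsub>E\<^esub> x) = L0_abs M \<xi> \<otimes>\<^bsub>L0_ring M\<^esub> rnorm E x"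
    if \<xi>: "\<xi> \<in> carrier (L0_ring M)" and x: "x \<in> carrier E" for \<xi> x
  proof -
    obtain a where a: "a \<in> borel_measurable M" "\<xi> = L0_class M a" using \<xi> by (rule L0_carrierE)
    obtain y where y: "y \<in> S" "x = R `` {y}" using x by (rule carrierE)
    have "(\<lambda>\<omega>. norm (a \<omega>) * N y \<omega>) \<in> borel_measurable M" using a(1) N_measurable[OF y(1)] by measurable
    then have "L0_class M (N (\<lambda>\<omega>. scl (a \<omega>) (y \<omega>))) = L0_class M (\<lambda>\<omega>. norm (a \<omega>) * N y \<omega>)"
      using N_scl[OF a(1) y(1)] N_measurable[OF scl_S[OF a(1) y(1)]] by (subst L0_class_eq_iff)
    then show ?thesis
      using a y N_measurable[OF y(1)] by (simp add: smult_class rnorm_E scl_S L0_abs_class L0_mult)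
  qed
  show "rnorm E (x \<oplus>\<^bsub>E\<^esub> y) \<sqsubseteq>\<^bsub>L0_order M\<^esub> rnorm E x \<oplus>\<^bsub>L0_ring M\<^esub> rnorm E y"
    if x: "x \<in> carrier E" and y: "y \<in> carrier E" for x y
  proof -
    obtain u where u: "u \<in> S" "x = R `` {u}" using x by (rule carrierE)
    obtain v where v: "v \<in> S" "y = R `` {v}" using y by (rule carrierE)
    have "(\<lambda>\<omega>. N u \<omega> + N v \<omega>) \<in> borel_measurable M"
      using N_measurable[OF u(1)] N_measurable[OF v(1)] by measurable
    then show ?thesis
      using u v N_add[OF u(1) v(1)]
      by (simp add: add_class rnorm_E add_S L0_add N_measurable L0_le_iff)
  qed
  show "rnorm E x = \<zero>\<^bsub>L0_ring M\<^esub> \<longleftrightarrow> x = \<zero>\<^bsub>E\<^esub>" if x: "x \<in> carrier E" for x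
  proof -
    obtain u where u: "u \<in> S" "x = R `` {u}" using x by (rule carrierE)
    show ?thesis
      unfolding u(2) rnorm_E[OF u(1)] L0_zero zero_E class_eq_iff[OF u(1) zero_S] N_zero[OF u(1), symmetric]
      by (rule L0_class_eq_iff[OF N_measurable[OF u(1)]]) simp
  qed
qed

end

text \<open>Used with the canonical map: the axioms of the random conjugate space are inherited from
  \<open>L0_wstar\<close> through the bijection instead of being verified for functionals.\<close>

lemma rn_module_transport:
  fixes E :: "('w, 'k::real_or_complex, 'e) rn_module" and F :: "('w, 'k, 'f) rn_module"
  assumes E: "random_normed_module M E" and bij: "bij_betw T (carrier E) (carrier F)"
    and add: "\<And>x y. x \<in> carrier E \<Longrightarrow> y \<in> carrier E \<Longrightarrow> T (x \<oplus>\<^bsub>E\<^esub> y) = T x \<oplus>\<^bsub>F\<^esub> T y"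
    and smult: "\<And>\<xi> x. \<xi> \<in> carrier (L0_ring M) \<Longrightarrow> x \<in> carrier E \<Longrightarrow> T (\<xi> \<odot>\<^bsub>E\<^esub> x) = \<xi> \<odot>\<^bsub>F\<^esub> T x"
    and zero: "T \<zero>\<^bsub>E\<^esub> = \<zero>\<^bsub>F\<^esub>"
    and norm: "\<And>x. x \<in> carrier E \<Longrightarrow> rnorm F (T x) = rnorm E x"
  shows "random_normed_module M F"
proof -
  interpret module "L0_ring M" E using E by (simp add: random_normed_module_def)
  have im: "carrier F = T ` carrier E" and inj: "inj_on T (carrier E)" using bij by (auto simp: bij_betw_def)
  have "Module.module (L0_ring M) F"
  proof (rule moduleI[OF cring_L0])
    show "abelian_group F"
    proof (rule abelian_groupI)
      fix X assume "X \<in> carrier F"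
      then obtain x where x: "x \<in> carrier E" "X = T x" by (auto simp: im)
      obtain y where y: "y \<in> carrier E" "y \<oplus>\<^bsub>E\<^esub> x = \<zero>\<^bsub>E\<^esub>"
        using abelian_groupE(6)[OF M.abelian_group_axioms x(1)] by blast
      then have "T y \<oplus>\<^bsub>F\<^esub> X = \<zero>\<^bsub>F\<^esub>" using add[of y x] x zero by simp
      then show "\<exists>Y\<in>carrier F. Y \<oplus>\<^bsub>F\<^esub> X = \<zero>\<^bsub>F\<^esub>" using y(1) im by blast
    qed (auto simp: im add[symmetric] zero[symmetric] M.a_ac)
  qed (auto simp: im add[symmetric] smult[symmetric] smult_l_distr smult_r_distr smult_assoc1)
  then show ?thesis
    using E inj unfolding random_normed_module_def
    by (auto simp: im add[symmetric] smult[symmetric] norm zero[symmetric] inj_on_eq_iff)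
qed

section \<open>The canonical map\<close>

text \<open>A representative of the essential supremum, and hence of the \<open>L\<^sup>0\<close>-norm; \<open>SOME\<close> is meaningful only for
  \<open>w\<^sup>*\<close>-random variables.\<close>

definition wstar_norm :: "'w measure \<Rightarrow> ('w \<Rightarrow> 'b::real_normed_vector \<Rightarrow>\<^sub>L 'k::real_or_complex) \<Rightarrow> 'w \<Rightarrow> real" where
  "wstar_norm M q = (SOME \<eta>. \<eta> \<in> borel_measurable M \<and>
    (\<forall>b. norm b \<le> 1 \<longrightarrow> (AE \<omega> in M. norm (blinfun_apply (q \<omega>) b) \<le> \<eta> \<omega>)) \<and>
    (\<forall>\<zeta>. (\<forall>b. norm b \<le> 1 \<longrightarrow> (AE \<omega> in M. norm (blinfun_apply (q \<omega>) b) \<le> \<zeta> \<omega>)) \<longrightarrow> (AE \<omega> in M. \<eta> \<omega> \<le> \<zeta> \<omega>)))"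

locale prob_K_normed = prob_space M + K_normed_space scl
  for M :: "'w measure" and scl :: "'k::real_or_complex \<Rightarrow> 'b::real_normed_vector \<Rightarrow> 'b"
begin

abbreviation "W \<equiv> wstar_random_variables M scl"

text \<open>The family over the unit ball may be uncountable, but the finite pointwise bound
  \<open>norm (q \<omega>)\<close> suffices for \<open>ess_sup_exists\<close>.\<close>

lemma
  assumes q: "q \<in> W"
  shows wstar_norm_measurable: "wstar_norm M q \<in> borel_measurable M"
    and wstar_norm_upper: "norm b \<le> 1 \<Longrightarrow> AE \<omega> in M. norm (blinfun_apply (q \<omega>) b) \<le> wstar_norm M q \<omega>"
    and wstar_norm_least: "(\<And>b. norm b \<le> 1 \<Longrightarrow> AE \<omega> in M. norm (blinfun_apply (q \<omega>) b) \<le> \<zeta> \<omega>) \<Longrightarrow>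
      AE \<omega> in M. wstar_norm M q \<omega> \<le> \<zeta> \<omega>"
proof -
  let ?U = "(\<lambda>b \<omega>. norm (blinfun_apply (q \<omega>) b)) ` {b. norm b \<le> 1}"
  have "\<exists>\<eta>\<in>borel_measurable M. (\<forall>u\<in>?U. AE x in M. u x \<le> \<eta> x) \<and>
      (\<forall>\<zeta>. (\<forall>u\<in>?U. AE x in M. u x \<le> \<zeta> x) \<longrightarrow> (AE x in M. \<eta> x \<le> \<zeta> x))"
  proof (rule ess_sup_exists[where h = "\<lambda>\<omega>. norm (q \<omega>)"])
    show "?U \<noteq> {}" by (auto intro!: exI[of _ 0])
    show "?U \<subseteq> borel_measurable M" using wstarD(2)[OF q] by auto
    fix u x assume "u \<in> ?U"
    then obtain b where b: "norm b \<le> 1" "u = (\<lambda>\<omega>. norm (blinfun_apply (q \<omega>) b))" by auto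
    have "norm (blinfun_apply (q x) b) \<le> norm (q x) * norm b" by (rule norm_blinfun)
    also have "\<dots> \<le> norm (q x) * 1" using b(1) by (intro mult_left_mono) auto
    finally show "u x \<le> norm (q x)" by (simp add: b(2))
  qed
  then have "\<exists>\<eta>. \<eta> \<in> borel_measurable M \<and>
    (\<forall>b. norm b \<le> 1 \<longrightarrow> (AE \<omega> in M. norm (blinfun_apply (q \<omega>) b) \<le> \<eta> \<omega>)) \<and>
    (\<forall>\<zeta>. (\<forall>b. norm b \<le> 1 \<longrightarrow> (AE \<omega> in M. norm (blinfun_apply (q \<omega>) b) \<le> \<zeta> \<omega>)) \<longrightarrow> (AE \<omega> in M. \<eta> \<omega> \<le> \<zeta> \<omega>))"
    by (simp add: Bex_def)
  from someI_ex[OF this, folded wstar_norm_def]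
  show "wstar_norm M q \<in> borel_measurable M"
    "norm b \<le> 1 \<Longrightarrow> AE \<omega> in M. norm (blinfun_apply (q \<omega>) b) \<le> wstar_norm M q \<omega>"
    "(\<And>b. norm b \<le> 1 \<Longrightarrow> AE \<omega> in M. norm (blinfun_apply (q \<omega>) b) \<le> \<zeta> \<omega>) \<Longrightarrow>
      AE \<omega> in M. wstar_norm M q \<omega> \<le> \<zeta> \<omega>"
    by (simp_all del: all_simps)
qed

lemma wstar_norm_nonneg: "q \<in> W \<Longrightarrow> AE \<omega> in M. 0 \<le> wstar_norm M q \<omega>"
  using wstar_norm_upper[of q 0] by simp

lemma wstar_norm_cong:
  assumes q: "q \<in> W" "q' \<in> W" and eq: "\<And>b. AE \<omega> in M. blinfun_apply (q \<omega>) b = blinfun_apply (q' \<omega>) b"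
  shows "AE \<omega> in M. wstar_norm M q \<omega> = wstar_norm M q' \<omega>"
proof -
  have "AE \<omega> in M. wstar_norm M q \<omega> \<le> wstar_norm M q' \<omega>"
  proof (rule wstar_norm_least[OF q(1)])
    fix b :: 'b assume "norm b \<le> 1"
    from eq[of b] wstar_norm_upper[OF q(2) this]
    show "AE \<omega> in M. norm (blinfun_apply (q \<omega>) b) \<le> wstar_norm M q' \<omega>" by eventually_elim simp
  qed
  moreover have "AE \<omega> in M. wstar_norm M q' \<omega> \<le> wstar_norm M q \<omega>"
  proof (rule wstar_norm_least[OF q(2)])
    fix b :: 'b assume "norm b \<le> 1"
    from eq[of b] wstar_norm_upper[OF q(1) this]
    show "AE \<omega> in M. norm (blinfun_apply (q' \<omega>) b) \<le> wstar_norm M q \<omega>" by eventually_elim simp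
  qed
  ultimately show ?thesis by eventually_elim simp
qed

text \<open>For a general w*-random variable the essential supremum may be smaller than the
  pointwise norm; strong measurability excludes this. Hence the embedding of the strong space into
  \<open>L0_wstar\<close> preserves norms.\<close>

lemma wstar_norm_strong:
  assumes p: "p \<in> random_variables M (dual_space scl)"
  shows "AE \<omega> in M. wstar_norm M p \<omega> = norm (p \<omega>)"
proof -
  note q = strong_imp_wstar[OF p]
  have "AE \<omega> in M. norm (p \<omega>) \<le> wstar_norm M p \<omega>"
    by (rule strong_norm_AE_le[OF p wstar_norm_upper[OF q]])
  moreover have "AE \<omega> in M. wstar_norm M p \<omega> \<le> norm (p \<omega>)"
  proof (rule wstar_norm_least[OF q], rule AE_I2)
    fix b :: 'b and \<omega> assume b: "norm b \<le> 1"
    have "norm (blinfun_apply (p \<omega>) b) \<le> norm (p \<omega>) * norm b" by (rule norm_blinfun)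
    also have "\<dots> \<le> norm (p \<omega>) * 1" using b by (intro mult_left_mono) auto
    finally show "norm (blinfun_apply (p \<omega>) b) \<le> norm (p \<omega>)" by simp
  qed
  ultimately show ?thesis by eventually_elim simp
qed

lemma dual_space_0: "0 \<in> dual_space scl"
  and dual_space_add: "f \<in> dual_space scl \<Longrightarrow> g \<in> dual_space scl \<Longrightarrow> f + g \<in> dual_space scl"
  and dual_space_scl: "f \<in> dual_space scl \<Longrightarrow> dual_scl a f \<in> dual_space scl"
  by (simp_all add: dual_space_def blinfun.add_left distrib_left mult.left_commute)

lemma wstarI:
  "(\<And>\<omega>. \<omega> \<in> space M \<Longrightarrow> q \<omega> \<in> dual_space scl) \<Longrightarrow>
    (\<And>b. (\<lambda>\<omega>. blinfun_apply (q \<omega>) b) \<in> borel_measurable M) \<Longrightarrow> q \<in> W"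
  unfolding wstar_random_variables_def by blast

lemma wstar_add: "q \<in> W \<Longrightarrow> q' \<in> W \<Longrightarrow> (\<lambda>\<omega>. q \<omega> + q' \<omega>) \<in> W"
  by (rule wstarI) (auto simp: blinfun.add_left intro!: dual_space_add borel_measurable_add dest: wstarD)

lemma wstar_scl: "\<xi> \<in> borel_measurable M \<Longrightarrow> q \<in> W \<Longrightarrow> (\<lambda>\<omega>. dual_scl (\<xi> \<omega>) (q \<omega>)) \<in> W"
  by (rule wstarI) (auto intro!: dual_space_scl borel_measurable_times dest: wstarD)

lemma wstar_0: "(\<lambda>_. 0) \<in> W"
  unfolding wstar_random_variables_def by (auto simp: dual_space_0)

lemma rv_const_UNIV: "(\<lambda>_. b) \<in> random_variables M UNIV"
  by (rule rv_const) simp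

text \<open>The union over representatives in the definition collapses, since all of them have the
  same supremum, which \<open>L0_sup_eq\<close> identifies.\<close>

lemma rnorm_wstar:
  assumes q: "q \<in> W"
  shows "rnorm (L0_wstar M scl) (wstar_rel M scl `` {q}) = L0_class M (wstar_norm M q)"
proof -
  let ?A = "\<lambda>q. (\<lambda>b. L0_class M (\<lambda>\<omega>. norm (blinfun_apply (q \<omega>) b))) ` {b. norm b \<le> 1}"
  have m: "(\<lambda>\<omega>. norm (blinfun_apply (q \<omega>) b)) \<in> borel_measurable M" if "q \<in> W" for q b
    using wstarD(2)[OF that] by measurable
  have sup: "\<Squnion>\<^bsub>L0_order M\<^esub> (?A q) = L0_class M (wstar_norm M q)" if q: "q \<in> W" for q
  proof (rule L0_sup_eq)
    note wm = wstar_norm_measurable[OF q]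
    show "L0_class M (wstar_norm M q) \<in> carrier (L0_ring M)" by (rule L0_class_closed[OF wm])
    show "?A q \<subseteq> carrier (L0_ring M)" using m[OF q] by (auto intro: L0_class_closed)
    show "X \<sqsubseteq>\<^bsub>L0_order M\<^esub> L0_class M (wstar_norm M q)" if "X \<in> ?A q" for X
      using that wstar_norm_upper[OF q] L0_le_iff[OF m[OF q] wm] by blast
    fix Y :: "('w \<Rightarrow> real) set"
    assume Y: "Y \<in> carrier (L0_ring M)" and ub: "\<And>X. X \<in> ?A q \<Longrightarrow> X \<sqsubseteq>\<^bsub>L0_order M\<^esub> Y"
    obtain \<zeta> where z: "\<zeta> \<in> borel_measurable M" "Y = L0_class M \<zeta>" using Y by (rule L0_carrierE)
    have "AE \<omega> in M. norm (blinfun_apply (q \<omega>) b) \<le> \<zeta> \<omega>" if b: "norm b \<le> 1" for b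
    proof -
      have "L0_class M (\<lambda>\<omega>. norm (blinfun_apply (q \<omega>) b)) \<sqsubseteq>\<^bsub>L0_order M\<^esub> L0_class M \<zeta>"
        unfolding z(2)[symmetric] by (rule ub) (use b in auto)
      then show ?thesis by (simp only: L0_le_iff[OF m[OF q] z(1)])
    qed
    then show "L0_class M (wstar_norm M q) \<sqsubseteq>\<^bsub>L0_order M\<^esub> Y"
      unfolding z(2) L0_le_iff[OF wm z(1)] by (rule wstar_norm_least[OF q])
  qed
  have "\<Squnion>\<^bsub>L0_order M\<^esub> (?A q') = L0_class M (wstar_norm M q)" if "q' \<in> wstar_rel M scl `` {q}" for q'
  proof -
    have q': "q' \<in> W" and eq: "\<And>b. AE \<omega> in M. blinfun_apply (q' \<omega>) b = blinfun_apply (q \<omega>) b"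
      using that by (auto simp: wstar_rel_def eq_commute)
    show ?thesis
      using wstar_norm_cong[OF q' q eq] wstar_norm_measurable[OF q] wstar_norm_measurable[OF q']
      by (simp only: sup[OF q'] L0_class_eq_iff)
  qed
  moreover have "q \<in> wstar_rel M scl `` {q}" by (rule equiv_class_self[OF equiv_wstar_rel q])
  ultimately show ?thesis unfolding L0_wstar_def Let_def by auto
qed

lemma wstar_norm_scl:
  assumes a: "a \<in> borel_measurable M" and q: "q \<in> W"
  shows "AE \<omega> in M. wstar_norm M (\<lambda>\<omega>. dual_scl (a \<omega>) (q \<omega>)) \<omega> = norm (a \<omega>) * wstar_norm M q \<omega>"
proof -
  let ?aq = "\<lambda>\<omega>. dual_scl (a \<omega>) (q \<omega>)"
  note aq = wstar_scl[OF a q]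
  have "AE \<omega> in M. wstar_norm M ?aq \<omega> \<le> norm (a \<omega>) * wstar_norm M q \<omega>"
  proof (rule wstar_norm_least[OF aq])
    fix b :: 'b assume "norm b \<le> 1"
    from wstar_norm_upper[OF q this]
    show "AE \<omega> in M. norm (blinfun_apply (?aq \<omega>) b) \<le> norm (a \<omega>) * wstar_norm M q \<omega>"
      by eventually_elim (simp add: norm_mult mult_left_mono)
  qed
  \<comment> \<open>The reverse inequality comes from division by \<open>norm (a \<omega>)\<close>.
    Where \<open>a\<close> vanishes, the comparison function is the norm itself, and the claim there
    follows from the first inequality and nonnegativity.\<close>
  moreover have "AE \<omega> in M. wstar_norm M q \<omega> \<le>
      (if a \<omega> = 0 then wstar_norm M q \<omega> else wstar_norm M ?aq \<omega> / norm (a \<omega>))"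
  proof (rule wstar_norm_least[OF q])
    fix b :: 'b assume b: "norm b \<le> 1"
    from wstar_norm_upper[OF q b] wstar_norm_upper[OF aq b]
    show "AE \<omega> in M. norm (blinfun_apply (q \<omega>) b) \<le>
        (if a \<omega> = 0 then wstar_norm M q \<omega> else wstar_norm M ?aq \<omega> / norm (a \<omega>))"
      by eventually_elim (simp add: norm_mult field_simps)
  qed
  moreover note wstar_norm_nonneg[OF aq]
  ultimately show ?thesis
  proof eventually_elim
    case (elim \<omega>)
    then show ?case by (cases "a \<omega> = 0") (auto simp: field_simps)
  qed
qed

lemma wstar_norm_add:
  assumes q: "q \<in> W" and q': "q' \<in> W"
  shows "AE \<omega> in M. wstar_norm M (\<lambda>\<omega>. q \<omega> + q' \<omega>) \<omega> \<le> wstar_norm M q \<omega> + wstar_norm M q' \<omega>"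
proof (rule wstar_norm_least[OF wstar_add[OF q q']])
  fix b :: 'b assume b: "norm b \<le> 1"
  from wstar_norm_upper[OF q b] wstar_norm_upper[OF q' b]
  show "AE \<omega> in M. norm (blinfun_apply (q \<omega> + q' \<omega>) b) \<le> wstar_norm M q \<omega> + wstar_norm M q' \<omega>"
    by eventually_elim (auto simp: blinfun.add_left intro: order_trans[OF norm_triangle_ineq])
qed

lemma wstar_norm_zero:
  assumes q: "q \<in> W"
  shows "(AE \<omega> in M. wstar_norm M q \<omega> = 0) \<longleftrightarrow> (q, \<lambda>_. 0) \<in> wstar_rel M scl"
proof
  assume 0: "AE \<omega> in M. wstar_norm M q \<omega> = 0"
  have "AE \<omega> in M. blinfun_apply (q \<omega>) b = 0" for b
  proof -
    have "AE \<omega> in M. norm (blinfun_apply (q \<omega>) b) \<le> wstar_norm M q \<omega> * norm b"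
      by (rule pairing_bound[OF rv_const_UNIV wstar_norm_upper[OF q]])
    with 0 show ?thesis by eventually_elim simp
  qed
  then show "(q, \<lambda>_. 0) \<in> wstar_rel M scl" using q wstar_0 by (simp add: wstar_rel_def)
next
  assume "(q, \<lambda>_. 0) \<in> wstar_rel M scl"
  then have 0: "AE \<omega> in M. blinfun_apply (q \<omega>) b = 0" for b by (simp add: wstar_rel_def)
  have "AE \<omega> in M. wstar_norm M q \<omega> \<le> 0"
    by (rule wstar_norm_least[OF q]) (use 0 in auto)
  with wstar_norm_nonneg[OF q] show "AE \<omega> in M. wstar_norm M q \<omega> = 0" by eventually_elim simp
qed

lemma quotient_wstar: "quotient_rn_space dual_scl M W (wstar_rel M scl) (L0_wstar M scl) (wstar_norm M)"
proof (rule quotient_rn_space.intro[OF K_normed_space_dual quotient_rn_space_axioms.intro])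
  show "equiv W (wstar_rel M scl)" by (rule equiv_wstar_rel)
  show "(\<lambda>\<omega>. x \<omega> + y \<omega>, \<lambda>\<omega>. x' \<omega> + y' \<omega>) \<in> wstar_rel M scl"
    if "(x, x') \<in> wstar_rel M scl" "(y, y') \<in> wstar_rel M scl" for x x' y y'
  proof -
    have "AE \<omega> in M. blinfun_apply (x \<omega> + y \<omega>) b = blinfun_apply (x' \<omega> + y' \<omega>) b" for b
    proof -
      have "AE \<omega> in M. blinfun_apply (x \<omega>) b = blinfun_apply (x' \<omega>) b"
        "AE \<omega> in M. blinfun_apply (y \<omega>) b = blinfun_apply (y' \<omega>) b" using that by (auto simp: wstar_rel_def)
      then show ?thesis by eventually_elim (simp add: blinfun.add_left)
    qed
    then show ?thesis using that by (auto simp: wstar_rel_def wstar_add)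
  qed
  show "(\<lambda>\<omega>. dual_scl (\<xi> \<omega>) (x \<omega>), \<lambda>\<omega>. dual_scl (\<xi>' \<omega>) (x' \<omega>)) \<in> wstar_rel M scl"
    if "(\<xi>, \<xi>') \<in> L0_rel M" "(x, x') \<in> wstar_rel M scl" for \<xi> \<xi>' x x'
  proof -
    have "AE \<omega> in M. blinfun_apply (dual_scl (\<xi> \<omega>) (x \<omega>)) b = blinfun_apply (dual_scl (\<xi>' \<omega>) (x' \<omega>)) b" for b
    proof -
      have "AE \<omega> in M. \<xi> \<omega> = \<xi>' \<omega>" "AE \<omega> in M. blinfun_apply (x \<omega>) b = blinfun_apply (x' \<omega>) b"
        using that by (auto simp: wstar_rel_def ae_rel_def)
      then show ?thesis by eventually_elim simp
    qed
    then show ?thesis using that by (auto simp: wstar_rel_def ae_rel_def wstar_scl)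
  qed
qed (auto simp: L0_wstar_def Let_def wstar_0 wstar_norm_measurable wstar_norm_nonneg wstar_norm_scl
  wstar_norm_add wstar_norm_zero rnorm_wstar[unfolded L0_wstar_def Let_def, simplified])

text \<open>One construction for both strong spaces: \<open>V\<close> is all of \<open>B\<close>, or
  the dual space inside the bounded real-linear maps.\<close>

lemma quotient_strong:
  fixes scl' :: "'k \<Rightarrow> 'x::real_normed_vector \<Rightarrow> 'x"
  assumes K: "K_normed_space scl'" and V: "0 \<in> V" "\<And>x y. x \<in> V \<Longrightarrow> y \<in> V \<Longrightarrow> x + y \<in> V"
    "\<And>a x. x \<in> V \<Longrightarrow> scl' a x \<in> V"
  shows "quotient_rn_space scl' M (random_variables M V) (ae_rel M (random_variables M V))
    (L0_space M scl' V) (\<lambda>x \<omega>. norm (x \<omega>))"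
proof -
  interpret K: K_normed_space scl' by (rule K)
  show ?thesis
  proof (rule quotient_rn_space.intro[OF K quotient_rn_space_axioms.intro])
    let ?S = "random_variables M V" and ?R = "ae_rel M (random_variables M V)"
    show "equiv ?S ?R" by (rule equiv_ae_rel)
    show "(\<lambda>_. 0) \<in> ?S" by (rule rv_const[OF V(1)])
    show "(\<lambda>\<omega>. x \<omega> + y \<omega>, \<lambda>\<omega>. x' \<omega> + y' \<omega>) \<in> ?R" if "(x, x') \<in> ?R" "(y, y') \<in> ?R" for x x' y y'
      using that V(2) by (auto simp: ae_rel_def rv_add elim!: eventually_elim2)
    show "(\<lambda>\<omega>. scl' (\<xi> \<omega>) (x \<omega>), \<lambda>\<omega>. scl' (\<xi>' \<omega>) (x' \<omega>)) \<in> ?R"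
      if "(\<xi>, \<xi>') \<in> L0_rel M" "(x, x') \<in> ?R" for \<xi> \<xi>' x x'
      using that V(3) by (auto simp: ae_rel_def K.rv_scl elim!: eventually_elim2)
    show "rnorm (L0_space M scl' V) (?R `` {x}) = L0_class M (\<lambda>\<omega>. norm (x \<omega>))" if x: "x \<in> ?S" for x
    proof -
      have "lift1 (L0_rel M) norm (?R `` {x}) = L0_class M (\<lambda>\<omega>. norm (x \<omega>))"
        by (rule lift1_class[OF equiv_ae_rel equiv_ae_rel x])
          (auto simp: ae_rel_def rv_norm_measurable elim!: eventually_mono)
      then show ?thesis by (simp add: L0_space_def Let_def)
    qed
    show "(AE \<omega> in M. norm (x \<omega>) = 0) \<longleftrightarrow> (x, \<lambda>_. 0) \<in> ?R" if "x \<in> ?S" for x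
      using that rv_const[OF V(1), where M = M] by (simp add: ae_rel_def)
  qed (auto simp: L0_space_def Let_def rv_norm_measurable K.norm_scl norm_triangle_ineq)
qed

end

text \<open>Replace each simple approximation by an almost best approximation of it in \<open>V\<close>.\<close>

lemma rv_restrict:
  assumes f: "f \<in> random_variables M UNIV" and V: "\<And>\<omega>. \<omega> \<in> space M \<Longrightarrow> f \<omega> \<in> V" and ne: "V \<noteq> {}"
  shows "f \<in> random_variables M V"
proof -
  obtain s where s: "\<And>n::nat. simple_function M (s n)" "\<And>\<omega>. \<omega> \<in> space M \<Longrightarrow> (\<lambda>n. s n \<omega>) \<longlonglongrightarrow> f \<omega>"
    using f by (rule rvE) (rule that, assumption+)
  have "\<exists>v\<in>V. \<forall>w\<in>V. norm (y - v) < norm (y - w) + 1 / real (Suc k)" for y :: 'b and k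
  proof -
    have bdd: "bdd_below ((\<lambda>w. norm (y - w)) ` V)" by (rule bdd_belowI2[of _ 0]) simp
    have "(INF w\<in>V. norm (y - w)) < (INF w\<in>V. norm (y - w)) + 1 / real (Suc k)" by simp
    then obtain v where v: "v \<in> V" "norm (y - v) < (INF w\<in>V. norm (y - w)) + 1 / real (Suc k)"
      using cINF_less_iff[OF ne bdd] by blast
    have "norm (y - v) < norm (y - w) + 1 / real (Suc k)" if "w \<in> V" for w
      using v(2) cINF_lower[OF bdd that] by linarith
    then show ?thesis using v(1) by blast
  qed
  then obtain v where v: "\<And>y k. v y k \<in> V" "\<And>y k w. w \<in> V \<Longrightarrow> norm (y - v y k) < norm (y - w) + 1 / real (Suc k)"
    by metis
  show ?thesis
  proof (rule rvI[where s = "\<lambda>n \<omega>. v (s n \<omega>) n"])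
    show "simple_function M (\<lambda>\<omega>. v (s n \<omega>) n)" for n
      by (rule simple_function_compose1[OF s(1)])
    show "(\<lambda>n. v (s n \<omega>) n) \<longlonglongrightarrow> f \<omega>" if w: "\<omega> \<in> space M" for \<omega>
    proof -
      \<comment> \<open>Since \<open>f \<omega>\<close> competes in the choice of \<open>v\<close>,
        the replacement is farther from \<open>s n \<omega>\<close> than \<open>f \<omega>\<close>
        by less than \<open>1 / real (Suc n)\<close>; the triangle inequality gives the factor
        2.\<close>
      have le: "norm (v (s n \<omega>) n - f \<omega>) \<le> 2 * norm (s n \<omega> - f \<omega>) + 1 / real (Suc n)" for n
        using v(2)[OF V[OF w], of "s n \<omega>" n] norm_triangle_ineq[of "v (s n \<omega>) n - s n \<omega>" "s n \<omega> - f \<omega>"]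
          norm_minus_commute[of "v (s n \<omega>) n" "s n \<omega>"] by simp
      have "(\<lambda>n. 2 * norm (s n \<omega> - f \<omega>) + 1 / real (Suc n)) \<longlonglongrightarrow> 2 * norm (f \<omega> - f \<omega>) + 0"
        by (intro tendsto_intros s(2)[OF w] LIMSEQ_Suc[OF lim_1_over_n])
      then have "(\<lambda>n. 2 * norm (s n \<omega> - f \<omega>) + 1 / real (Suc n)) \<longlonglongrightarrow> 0" by simp
      then have "(\<lambda>n. v (s n \<omega>) n - f \<omega>) \<longlonglongrightarrow> 0"
        by (rule Lim_null_comparison[rotated]) (rule always_eventually, rule allI, rule le)
      then show ?thesis by (rule LIM_zero_cancel)
    qed
  qed (use V v(1) in auto)
qed

section \<open>The canonical map: well-definedness, injectivity, norm and surjectivity\<close>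

context prob_K_normed
begin

abbreviation "G \<equiv> random_variables M (UNIV :: 'b set)"
abbreviation "E \<equiv> L0_space M scl UNIV"
abbreviation "P \<equiv> random_variables M (dual_space scl)"
abbreviation "G_class g \<equiv> ae_rel M G `` {g}"
abbreviation "P_class p \<equiv> ae_rel M P `` {p}"
abbreviation "W_class q \<equiv> wstar_rel M scl `` {q}"
abbreviation "T \<equiv> canonical_map M scl"

interpretation w: quotient_rn_space dual_scl M W "wstar_rel M scl" "L0_wstar M scl" "wstar_norm M"
  by (rule quotient_wstar)

interpretation g: quotient_rn_space scl M G "ae_rel M G" E "\<lambda>x \<omega>. norm (x \<omega>)"
  by (rule quotient_strong[OF K_normed_space_axioms]) auto

interpretation s: quotient_rn_space dual_scl M P "ae_rel M P" "L0_space M dual_scl (dual_space scl)" "\<lambda>x \<omega>. norm (x \<omega>)"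
  by (rule quotient_strong[OF K_normed_space_dual dual_space_0 dual_space_add dual_space_scl])

lemma pairing_W: "g \<in> G \<Longrightarrow> q \<in> W \<Longrightarrow> (\<lambda>\<omega>. blinfun_apply (q \<omega>) (g \<omega>)) \<in> borel_measurable M"
  by (rule pairing_measurable[OF _ wstarD(2)])

text \<open>w*-equivalence controls fixed vectors only; \<open>pairing_cong\<close> extends this to
  strongly measurable \<open>g\<close>, so the pairing descends to classes.\<close>

lemma pairing_L0_rel:
  assumes "(g, g') \<in> ae_rel M G" "(q, q') \<in> wstar_rel M scl"
  shows "((\<lambda>\<omega>. blinfun_apply (q \<omega>) (g \<omega>)), (\<lambda>\<omega>. blinfun_apply (q' \<omega>) (g' \<omega>))) \<in> L0_rel M"
proof -
  have a: "g \<in> G" "g' \<in> G" "AE \<omega> in M. g \<omega> = g' \<omega>" "q \<in> W" "q' \<in> W"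
    "\<And>b. AE \<omega> in M. blinfun_apply (q \<omega>) b = blinfun_apply (q' \<omega>) b"
    using assms by (auto simp: ae_rel_def wstar_rel_def)
  from pairing_cong[OF a(1) a(6)] a(3)
  have "AE \<omega> in M. blinfun_apply (q \<omega>) (g \<omega>) = blinfun_apply (q' \<omega>) (g' \<omega>)" by eventually_elim simp
  then show ?thesis using a by (simp add: ae_rel_def pairing_W)
qed

lemma T_W: "q \<in> W \<Longrightarrow> g \<in> G \<Longrightarrow> T (W_class q) (G_class g) = L0_class M (\<lambda>\<omega>. blinfun_apply (q \<omega>) (g \<omega>))"
  unfolding canonical_map_def L0_pairing_def
  by (simp add: g.class_closed) (rule lift2_class[OF equiv_ae_rel equiv_wstar_rel equiv_ae_rel],
    auto intro: pairing_L0_rel)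

lemma T_extensional: "T f \<in> extensional (carrier E)"
  by (simp add: canonical_map_def)

text \<open>A.e. equality implies w*-equivalence, so both classes of \<open>p\<close> pair alike.
  Results on w* classes carry over to the strong space through this identity.\<close>

lemma T_P:
  assumes p: "p \<in> P"
  shows "T (P_class p) = T (W_class p)"
proof (rule extensionalityI[OF T_extensional T_extensional])
  fix X assume X: "X \<in> carrier E"
  then obtain g where g: "g \<in> G" "X = G_class g" by (rule g.carrierE)
  have "lift2 (L0_rel M) (\<lambda>b b'. blinfun_apply b' b) (G_class g) (P_class p) = L0_class M (\<lambda>\<omega>. blinfun_apply (p \<omega>) (g \<omega>))"
  proof (rule lift2_class[OF equiv_ae_rel equiv_ae_rel equiv_ae_rel g(1) p])
    fix g' p' assume a: "(g, g') \<in> ae_rel M G" "(p, p') \<in> ae_rel M P"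
    have "(p, p') \<in> wstar_rel M scl"
      using a(2) strong_imp_wstar[of p M scl] strong_imp_wstar[of p' M scl]
      by (auto simp: ae_rel_def wstar_rel_def elim: eventually_mono)
    then show "((\<lambda>\<omega>. blinfun_apply (p \<omega>) (g \<omega>)), (\<lambda>\<omega>. blinfun_apply (p' \<omega>) (g' \<omega>))) \<in> L0_rel M"
      by (rule pairing_L0_rel[OF a(1)])
  qed
  then show "T (P_class p) X = T (W_class p) X"
    using T_W[OF strong_imp_wstar[OF p] g(1)] X g(2) by (simp add: canonical_map_def L0_pairing_def)
qed

lemma T_ext:
  assumes q: "q \<in> W" and F: "F \<in> extensional (carrier E)"
    and eq: "\<And>g. g \<in> G \<Longrightarrow> F (G_class g) = L0_class M (\<lambda>\<omega>. blinfun_apply (q \<omega>) (g \<omega>))"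
  shows "T (W_class q) = F"
proof (rule extensionalityI[OF T_extensional F])
  fix X assume "X \<in> carrier E"
  then obtain g where "g \<in> G" "X = G_class g" by (rule g.carrierE)
  then show "T (W_class q) X = F X" using T_W[OF q] eq by simp
qed

text \<open>Constant variables already separate w* classes, by the form of w*-equivalence.\<close>

lemma T_inj:
  assumes q: "q \<in> W" "q' \<in> W" and eq: "T (W_class q) = T (W_class q')"
  shows "(q, q') \<in> wstar_rel M scl"
proof -
  have "AE \<omega> in M. blinfun_apply (q \<omega>) b = blinfun_apply (q' \<omega>) b" for b
  proof -
    have "L0_class M (\<lambda>\<omega>. blinfun_apply (q \<omega>) b) = L0_class M (\<lambda>\<omega>. blinfun_apply (q' \<omega>) b)"
      using T_W[OF q(1) rv_const_UNIV, of b] T_W[OF q(2) rv_const_UNIV, of b] eq by simp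
    then show ?thesis using L0_class_eq_iff[OF wstarD(2)[OF q(1)] wstarD(2)[OF q(2)]] by blast
  qed
  then show ?thesis using q by (simp add: wstar_rel_def)
qed

lemma wstar_norm_dual_bound:
  assumes q: "q \<in> W"
  shows "L0_class M (wstar_norm M q) \<in> dual_bounds M E (T (W_class q))"
  unfolding dual_bounds_def
proof (intro CollectI conjI ballI)
  note wm = wstar_norm_measurable[OF q]
  show "L0_class M (wstar_norm M q) \<in> L0_nonneg M"
    using wm wstar_norm_nonneg[OF q] by (simp add: L0_nonneg_iff)
  fix X assume "X \<in> carrier E"
  then obtain g where g: "g \<in> G" "X = G_class g" by (rule g.carrierE)
  have 1: "(\<lambda>\<omega>. norm (blinfun_apply (q \<omega>) (g \<omega>))) \<in> borel_measurable M" using pairing_W[OF g(1) q] by measurable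
  have 2: "(\<lambda>\<omega>. wstar_norm M q \<omega> * norm (g \<omega>)) \<in> borel_measurable M"
    using wm rv_norm_measurable[OF g(1)] by measurable
  show "L0_abs M (T (W_class q) X) \<sqsubseteq>\<^bsub>L0_order M\<^esub> L0_class M (wstar_norm M q) \<otimes>\<^bsub>L0_ring M\<^esub> rnorm E X"
    using pairing_bound[OF g(1) wstar_norm_upper[OF q]]
    unfolding g(2) T_W[OF q g(1)] L0_abs_class[OF pairing_W[OF g(1) q]] g.rnorm_E[OF g(1)]
      L0_mult[OF wm rv_norm_measurable[OF g(1)]] L0_le_iff[OF 1 2] .
qed

text \<open>Translates a bound in the order of classes into a.e. inequalities for chosen
  representatives \<open>\<Phi>\<close>; it serves both \<open>T (W_class q)\<close> and an
  arbitrary functional.\<close>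

lemma dual_boundsD:
  assumes F: "\<And>g. g \<in> G \<Longrightarrow> F (G_class g) = L0_class M (\<Phi> g)" "\<And>g. g \<in> G \<Longrightarrow> \<Phi> g \<in> borel_measurable M"
    and X: "X \<in> dual_bounds M E (F :: _ \<Rightarrow> ('w \<Rightarrow> 'k) set)"
  obtains z where "z \<in> borel_measurable M" "X = L0_class M z" "AE \<omega> in M. 0 \<le> z \<omega>"
    "\<And>g. g \<in> G \<Longrightarrow> AE \<omega> in M. norm (\<Phi> g \<omega>) \<le> z \<omega> * norm (g \<omega>)"
proof -
  have "X \<in> L0_nonneg M" using X by (simp add: dual_bounds_def)
  then obtain z where z: "z \<in> borel_measurable M" "X = L0_class M z" "AE \<omega> in M. 0 \<le> z \<omega>" by (rule L0_nonnegE)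
  have "AE \<omega> in M. norm (\<Phi> g \<omega>) \<le> z \<omega> * norm (g \<omega>)" if g: "g \<in> G" for g
  proof -
    note n = rv_norm_measurable[OF g]
    have "L0_abs M (F (G_class g)) \<sqsubseteq>\<^bsub>L0_order M\<^esub> X \<otimes>\<^bsub>L0_ring M\<^esub> rnorm E (G_class g)"
      using X g.class_closed[OF g] by (simp add: dual_bounds_def)
    then have le: "L0_class M (\<lambda>\<omega>. norm (\<Phi> g \<omega>)) \<sqsubseteq>\<^bsub>L0_order M\<^esub> L0_class M (\<lambda>\<omega>. z \<omega> * norm (g \<omega>))"
      by (simp only: F(1)[OF g] L0_abs_class[OF F(2)[OF g]] z(2) g.rnorm_E[OF g] L0_mult[OF z(1) n])
    have "(\<lambda>\<omega>. norm (\<Phi> g \<omega>)) \<in> borel_measurable M" using F(2)[OF g] by measurable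
    moreover have "(\<lambda>\<omega>. z \<omega> * norm (g \<omega>)) \<in> borel_measurable M" using z(1) n by measurable
    ultimately show ?thesis using le by (simp only: L0_le_iff)
  qed
  then show ?thesis using that z by blast
qed

text \<open>The infimum is attained: the w* norm is a bound by \<open>pairing_bound\<close>, and
  every bound, tested on constants of the unit ball, dominates the essential supremum.\<close>

lemma rnorm_T:
  assumes q: "q \<in> W"
  shows "rnorm (random_conjugate M E) (T (W_class q)) = L0_class M (wstar_norm M q)"
proof -
  have "\<Sqinter>\<^bsub>L0_order M\<^esub> (dual_bounds M E (T (W_class q))) = L0_class M (wstar_norm M q)"
  proof (rule L0_inf_eq[OF wstar_norm_dual_bound[OF q]])
    show "dual_bounds M E (T (W_class q)) \<subseteq> carrier (L0_ring M)"
      by (auto simp: dual_bounds_def L0_nonneg_def L0_order_carrier)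
    fix X assume X: "X \<in> dual_bounds M E (T (W_class q))"
    obtain z where z: "z \<in> borel_measurable M" "X = L0_class M z" "AE \<omega> in M. 0 \<le> z \<omega>"
      "\<And>g. g \<in> G \<Longrightarrow> AE \<omega> in M. norm (blinfun_apply (q \<omega>) (g \<omega>)) \<le> z \<omega> * norm (g \<omega>)"
      by (rule dual_boundsD[where F = "T (W_class q)" and \<Phi> = "\<lambda>g \<omega>. blinfun_apply (q \<omega>) (g \<omega>)" and X = X])
        (rule T_W[OF q] pairing_W[OF _ q] X that; assumption)+
    have "AE \<omega> in M. wstar_norm M q \<omega> \<le> z \<omega>"
    proof (rule wstar_norm_least[OF q])
      fix b :: 'b assume b: "norm b \<le> 1"
      from z(4)[OF rv_const_UNIV, of b] z(3)
      show "AE \<omega> in M. norm (blinfun_apply (q \<omega>) b) \<le> z \<omega>"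
      proof eventually_elim
        case (elim \<omega>)
        have "z \<omega> * norm b \<le> z \<omega> * 1" using elim(2) b by (intro mult_left_mono) auto
        then show ?case using elim(1) by simp
      qed
    qed
    then show "L0_class M (wstar_norm M q) \<sqsubseteq>\<^bsub>L0_order M\<^esub> X"
      unfolding z(2) L0_le_iff[OF wstar_norm_measurable[OF q] z(1)] .
  qed
  then show ?thesis by (simp add: random_conjugate_def)
qed

lemma T_add:
  assumes q: "q \<in> W" "q' \<in> W"
  shows "T (W_class q \<oplus>\<^bsub>L0_wstar M scl\<^esub> W_class q') = T (W_class q) \<oplus>\<^bsub>random_conjugate M E\<^esub> T (W_class q')"
  unfolding w.add_class[OF q]
proof (rule T_ext[OF wstar_add[OF q]])
  show "T (W_class q) \<oplus>\<^bsub>random_conjugate M E\<^esub> T (W_class q') \<in> extensional (carrier E)"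
    by (simp add: random_conjugate_def)
  fix g assume g: "g \<in> G"
  show "(T (W_class q) \<oplus>\<^bsub>random_conjugate M E\<^esub> T (W_class q')) (G_class g) =
      L0_class M (\<lambda>\<omega>. blinfun_apply (q \<omega> + q' \<omega>) (g \<omega>))"
    using g q by (simp add: random_conjugate_def g.class_closed T_W L0_add pairing_W blinfun.add_left)
qed

lemma T_smult:
  assumes x: "x \<in> borel_measurable M" and q: "q \<in> W"
  shows "T (L0_class M x \<odot>\<^bsub>L0_wstar M scl\<^esub> W_class q) = L0_class M x \<odot>\<^bsub>random_conjugate M E\<^esub> T (W_class q)"
  unfolding w.smult_class[OF x q]
proof (rule T_ext[OF wstar_scl[OF x q]])
  show "L0_class M x \<odot>\<^bsub>random_conjugate M E\<^esub> T (W_class q) \<in> extensional (carrier E)"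
    by (simp add: random_conjugate_def)
  fix g assume g: "g \<in> G"
  show "(L0_class M x \<odot>\<^bsub>random_conjugate M E\<^esub> T (W_class q)) (G_class g) =
      L0_class M (\<lambda>\<omega>. blinfun_apply (dual_scl (x \<omega>) (q \<omega>)) (g \<omega>))"
    using g q x by (simp add: random_conjugate_def g.class_closed T_W L0_mult pairing_W)
qed

lemma T_zero: "T \<zero>\<^bsub>L0_wstar M scl\<^esub> = \<zero>\<^bsub>random_conjugate M E\<^esub>"
  unfolding w.zero_E
proof (rule T_ext[OF wstar_0])
  show "\<zero>\<^bsub>random_conjugate M E\<^esub> \<in> extensional (carrier E)" by (simp add: random_conjugate_def)
  fix g assume g: "g \<in> G"
  then show "\<zero>\<^bsub>random_conjugate M E\<^esub> (G_class g) = L0_class M (\<lambda>\<omega>. blinfun_apply 0 (g \<omega>))"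
    by (simp add: random_conjugate_def g.class_closed L0_zero)
qed

lemma T_closed:
  assumes q: "q \<in> W"
  shows "T (W_class q) \<in> carrier (random_conjugate M E)"
proof -
  have lin: "blinfun_apply (q \<omega>) (scl a b) = a * blinfun_apply (q \<omega>) b" if "\<omega> \<in> space M" for \<omega> a b
    using wstarD(1)[OF q that] by (simp add: dual_space_def)
  have "T (W_class q) (X \<oplus>\<^bsub>E\<^esub> Y) = T (W_class q) X \<oplus>\<^bsub>L0_ring M\<^esub> T (W_class q) Y"
    if X: "X \<in> carrier E" and Y: "Y \<in> carrier E" for X Y
  proof -
    obtain g where g: "g \<in> G" "X = G_class g" using X by (rule g.carrierE)
    obtain h where h: "h \<in> G" "Y = G_class h" using Y by (rule g.carrierE)
    show ?thesis
      using g h q by (simp add: g.add_class g.add_S T_W L0_add pairing_W blinfun.add_right)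
  qed
  moreover have "T (W_class q) (\<xi> \<odot>\<^bsub>E\<^esub> X) = \<xi> \<otimes>\<^bsub>L0_ring M\<^esub> T (W_class q) X"
    if \<xi>: "\<xi> \<in> carrier (L0_ring M)" and X: "X \<in> carrier E" for \<xi> X
  proof -
    obtain g where g: "g \<in> G" "X = G_class g" using X by (rule g.carrierE)
    obtain x where x: "x \<in> borel_measurable M" "\<xi> = L0_class M x" using \<xi> by (rule L0_carrierE)
    have m: "(\<lambda>\<omega>. x \<omega> * blinfun_apply (q \<omega>) (g \<omega>)) \<in> borel_measurable M"
      using x(1) pairing_W[OF g(1) q] by measurable
    have "L0_class M (\<lambda>\<omega>. blinfun_apply (q \<omega>) (scl (x \<omega>) (g \<omega>))) = L0_class M (\<lambda>\<omega>. x \<omega> * blinfun_apply (q \<omega>) (g \<omega>))"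
      by (subst L0_class_eq_iff[OF pairing_W[OF g.scl_S[OF x(1) g(1)] q] m]) (auto simp: lin)
    then show ?thesis
      using g x q by (simp add: g.smult_class g.scl_S T_W L0_mult pairing_W)
  qed
  moreover have "T (W_class q) \<in> carrier E \<rightarrow>\<^sub>E carrier (L0_ring M)"
  proof (rule PiE_I)
    fix X assume "X \<in> carrier E"
    then obtain g where g: "g \<in> G" "X = G_class g" by (rule g.carrierE)
    then show "T (W_class q) X \<in> carrier (L0_ring M)" using q by (simp add: T_W L0_class_closed pairing_W)
  next
    fix X assume "X \<notin> carrier E"
    then show "T (W_class q) X = undefined" by (simp add: canonical_map_def)
  qed
  ultimately show ?thesis using wstar_norm_dual_bound[OF q] by (auto simp: random_conjugate_def)
qed

text \<open>With a representative \<open>\<Phi> g\<close> chosen for each \<open>g\<close>, the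
  values on constants form an a.e. linear dominated family to which \<open>linear_selection\<close>
  applies. That the selection represents \<open>F\<close> on all \<open>g\<close> is
  \<open>determined_by_constants\<close>.\<close>

lemma T_surj:
  assumes cm: "complete_measure M" and F: "F \<in> carrier (random_conjugate M E)"
  shows "\<exists>q\<in>W. F = T (W_class q)"
proof -
  have Fc: "F \<in> carrier E \<rightarrow>\<^sub>E carrier (L0_ring M)"
    and Fadd: "\<And>X Y. X \<in> carrier E \<Longrightarrow> Y \<in> carrier E \<Longrightarrow> F (X \<oplus>\<^bsub>E\<^esub> Y) = F X \<oplus>\<^bsub>L0_ring M\<^esub> F Y"
    and Fsmult: "\<And>\<xi> X. \<xi> \<in> carrier (L0_ring M) \<Longrightarrow> X \<in> carrier E \<Longrightarrow> F (\<xi> \<odot>\<^bsub>E\<^esub> X) = \<xi> \<otimes>\<^bsub>L0_ring M\<^esub> F X"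
    and Fbd: "dual_bounds M E F \<noteq> {}"
    using F by (auto simp: random_conjugate_def)
  have "\<forall>g\<in>G. \<exists>y. y \<in> borel_measurable M \<and> F (G_class g) = L0_class M y"
  proof
    fix g assume "g \<in> G"
    then have "F (G_class g) \<in> carrier (L0_ring M)" using Fc g.class_closed by blast
    then show "\<exists>y. y \<in> borel_measurable M \<and> F (G_class g) = L0_class M y" by (rule L0_carrierE) blast
  qed
  then obtain \<Phi> where \<Phi>m: "\<And>g. g \<in> G \<Longrightarrow> \<Phi> g \<in> borel_measurable M"
    and \<Phi>: "\<And>g. g \<in> G \<Longrightarrow> F (G_class g) = L0_class M (\<Phi> g)" by metis
  obtain X where X: "X \<in> dual_bounds M E F" using Fbd by blast
  obtain z where z: "z \<in> borel_measurable M" "X = L0_class M z" "AE \<omega> in M. 0 \<le> z \<omega>"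
      "\<And>g. g \<in> G \<Longrightarrow> AE \<omega> in M. norm (\<Phi> g \<omega>) \<le> z \<omega> * norm (g \<omega>)"
    by (rule dual_boundsD[where F = F and \<Phi> = \<Phi> and X = X]) (rule \<Phi> \<Phi>m X that; assumption)+
  have \<Phi>_add: "AE \<omega> in M. \<Phi> (\<lambda>\<omega>. g \<omega> + h \<omega>) \<omega> = \<Phi> g \<omega> + \<Phi> h \<omega>" if g: "g \<in> G" and h: "h \<in> G" for g h
  proof -
    have "L0_class M (\<Phi> (\<lambda>\<omega>. g \<omega> + h \<omega>)) = L0_class M (\<lambda>\<omega>. \<Phi> g \<omega> + \<Phi> h \<omega>)"
      using Fadd[OF g.class_closed[OF g] g.class_closed[OF h]]
      by (simp only: g.add_class[OF g h] \<Phi>[OF g.add_S[OF g h]] \<Phi>[OF g] \<Phi>[OF h] L0_add[OF \<Phi>m[OF g] \<Phi>m[OF h]])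
    then show ?thesis
      by (subst (asm) L0_class_eq_iff[OF \<Phi>m[OF g.add_S[OF g h]] borel_measurable_add[OF \<Phi>m[OF g] \<Phi>m[OF h]]])
  qed
  have \<Phi>_scl: "AE \<omega> in M. \<Phi> (\<lambda>_. scl a b) \<omega> = a * \<Phi> (\<lambda>_. b) \<omega>" for a b
  proof -
    let ?c = "\<lambda>_::'w. b" and ?a = "\<lambda>_::'w. a"
    have c: "?c \<in> G" "(\<lambda>_. scl a b) \<in> G" by (rule rv_const_UNIV)+
    have am: "?a \<in> borel_measurable M" by simp
    have "L0_class M (\<Phi> (\<lambda>_. scl a b)) = L0_class M (\<lambda>\<omega>. a * \<Phi> ?c \<omega>)"
      using Fsmult[OF L0_class_closed[OF am] g.class_closed[OF c(1)]]
      by (simp only: g.smult_class[OF am c(1)] \<Phi>[OF c(1)] \<Phi>[OF c(2)] L0_mult[OF am \<Phi>m[OF c(1)]])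
    then show ?thesis
      by (subst (asm) L0_class_eq_iff[OF \<Phi>m[OF c(2)] borel_measurable_times[OF am \<Phi>m[OF c(1)]]])
  qed
  have "\<exists>q\<in>W. \<forall>b. AE \<omega> in M. blinfun_apply (q \<omega>) b = \<Phi> (\<lambda>_. b) \<omega>"
  proof (rule linear_selection[OF cm K_normed_space_axioms _ _ _ z(1)])
    show "\<Phi> (\<lambda>_. b) \<in> borel_measurable M" for b by (rule \<Phi>m[OF rv_const_UNIV])
    show "AE \<omega> in M. \<Phi> (\<lambda>_. b + c) \<omega> = \<Phi> (\<lambda>_. b) \<omega> + \<Phi> (\<lambda>_. c) \<omega>" for b c
      by (rule \<Phi>_add[OF rv_const_UNIV rv_const_UNIV])
    show "AE \<omega> in M. \<Phi> (\<lambda>_. scl a b) \<omega> = a * \<Phi> (\<lambda>_. b) \<omega>" for a b by (rule \<Phi>_scl)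
    show "AE \<omega> in M. norm (\<Phi> (\<lambda>_. b) \<omega>) \<le> z \<omega> * norm b" for b by (rule z(4)[OF rv_const_UNIV])
  qed
  then obtain q where q: "q \<in> W" "\<And>b. AE \<omega> in M. \<Phi> (\<lambda>_. b) \<omega> = blinfun_apply (q \<omega>) b"
    by (auto simp: eq_commute)
  have "T (W_class q) = F"
  proof (rule T_ext[OF q(1)])
    show "F \<in> extensional (carrier E)" using Fc by (simp add: PiE_def)
    fix g assume g: "g \<in> G"
    show "F (G_class g) = L0_class M (\<lambda>\<omega>. blinfun_apply (q \<omega>) (g \<omega>))"
      unfolding \<Phi>[OF g] L0_class_eq_iff[OF \<Phi>m[OF g] pairing_W[OF g q(1)]]
      by (rule determined_by_constants[OF g \<Phi>_add z(4) q(2)])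
  qed
  then show ?thesis using q(1) by blast
qed

theorem T_wstar_isomorphism:
  assumes cm: "complete_measure M"
  shows "rn_isomorphism M (L0_wstar M scl) (random_conjugate M E) T"
proof -
  have bij: "bij_betw T (carrier (L0_wstar M scl)) (carrier (random_conjugate M E))"
  proof (rule bij_betw_imageI)
    show "inj_on T (carrier (L0_wstar M scl))"
    proof (rule inj_onI)
      fix X Y assume "X \<in> carrier (L0_wstar M scl)" "Y \<in> carrier (L0_wstar M scl)" and eq: "T X = T Y"
      then obtain q q' where "q \<in> W" "X = W_class q" "q' \<in> W" "Y = W_class q'" by (metis w.carrierE)
      then show "X = Y" using T_inj[of q q'] eq w.class_eq_iff by simp
    qed
    show "T ` carrier (L0_wstar M scl) = carrier (random_conjugate M E)"
    proof
      show "T ` carrier (L0_wstar M scl) \<subseteq> carrier (random_conjugate M E)"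
        by (auto elim!: w.carrierE simp: T_closed)
      show "carrier (random_conjugate M E) \<subseteq> T ` carrier (L0_wstar M scl)"
        using T_surj[OF cm] w.class_closed by blast
    qed
  qed
  have add: "T (X \<oplus>\<^bsub>L0_wstar M scl\<^esub> Y) = T X \<oplus>\<^bsub>random_conjugate M E\<^esub> T Y"
    if "X \<in> carrier (L0_wstar M scl)" "Y \<in> carrier (L0_wstar M scl)" for X Y
    using that by (auto elim!: w.carrierE intro: T_add)
  have smult: "T (\<xi> \<odot>\<^bsub>L0_wstar M scl\<^esub> X) = \<xi> \<odot>\<^bsub>random_conjugate M E\<^esub> T X"
    if "\<xi> \<in> carrier (L0_ring M)" "X \<in> carrier (L0_wstar M scl)" for \<xi> X
    using that by (auto elim!: w.carrierE L0_carrierE intro: T_smult)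
  have norm: "rnorm (random_conjugate M E) (T X) = rnorm (L0_wstar M scl) X" if "X \<in> carrier (L0_wstar M scl)" for X
    using that by (auto elim!: w.carrierE simp: rnorm_T w.rnorm_E)
  have "random_normed_module M (random_conjugate M E)"
    by (rule rn_module_transport[OF w.random_normed bij add smult T_zero norm])
  then show ?thesis
    unfolding rn_isomorphism_def using w.random_normed bij add smult norm by blast
qed

text \<open>Injectivity and norm preservation on the strong space hold anyway; only surjectivity is
  at stake. Every functional is \<open>T\<close> of some w* class, so the question is whether that
  class contains a strongly measurable variable.\<close>

lemma T_strong_isomorphism_iff:
  assumes cm: "complete_measure M"
  shows "rn_isomorphism M (L0_space M dual_scl (dual_space scl)) (random_conjugate M E) T \<longleftrightarrow>
    (\<forall>q\<in>W. \<exists>p\<in>P. \<forall>b. AE \<omega> in M. blinfun_apply (p \<omega>) b = blinfun_apply (q \<omega>) b)"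
proof
  let ?S = "L0_space M dual_scl (dual_space scl)" and ?F = "random_conjugate M E"
  {
    assume iso: "rn_isomorphism M ?S ?F T"
    show "\<forall>q\<in>W. \<exists>p\<in>P. \<forall>b. AE \<omega> in M. blinfun_apply (p \<omega>) b = blinfun_apply (q \<omega>) b"
    proof
      fix q assume q: "q \<in> W"
      have "T (W_class q) \<in> T ` carrier ?S"
        using iso T_closed[OF q] by (simp add: rn_isomorphism_def bij_betw_def)
      then obtain X where X: "X \<in> carrier ?S" "T (W_class q) = T X" by blast
      obtain p where p: "p \<in> P" "X = P_class p" using X(1) by (rule s.carrierE)
      have "T (W_class p) = T (W_class q)" using X(2) T_P[OF p(1)] p(2) by simp
      then have "(p, q) \<in> wstar_rel M scl" by (rule T_inj[OF strong_imp_wstar[OF p(1)] q])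
      then show "\<exists>p\<in>P. \<forall>b. AE \<omega> in M. blinfun_apply (p \<omega>) b = blinfun_apply (q \<omega>) b"
        using p(1) by (auto simp: wstar_rel_def)
    qed
  next
    assume ex: "\<forall>q\<in>W. \<exists>p\<in>P. \<forall>b. AE \<omega> in M. blinfun_apply (p \<omega>) b = blinfun_apply (q \<omega>) b"
    have bij: "bij_betw T (carrier ?S) (carrier ?F)"
    proof (rule bij_betw_imageI)
      show "inj_on T (carrier ?S)"
      proof (rule inj_onI)
        fix X Y assume XY: "X \<in> carrier ?S" "Y \<in> carrier ?S" and eq: "T X = T Y"
        obtain p where p: "p \<in> P" "X = P_class p" using XY(1) by (rule s.carrierE)
        obtain p' where p': "p' \<in> P" "Y = P_class p'" using XY(2) by (rule s.carrierE)
        have "T (W_class p) = T (W_class p')" using eq p p' T_P by simp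
        then have "(p, p') \<in> wstar_rel M scl"
          by (rule T_inj[OF strong_imp_wstar[OF p(1)] strong_imp_wstar[OF p'(1)]])
        then have "AE \<omega> in M. p \<omega> = p' \<omega>"
          by (intro strong_AE_eq[OF p(1) p'(1)]) (simp add: wstar_rel_def)
        then show "X = Y" using p p' s.class_eq_iff[OF p(1) p'(1)] by (simp add: ae_rel_def)
      qed
      show "T ` carrier ?S = carrier ?F"
      proof
        show "T ` carrier ?S \<subseteq> carrier ?F"
          by (auto elim!: s.carrierE simp: T_P T_closed strong_imp_wstar)
        show "carrier ?F \<subseteq> T ` carrier ?S"
        proof
          fix F assume "F \<in> carrier ?F"
          then obtain q where q: "q \<in> W" "F = T (W_class q)" using T_surj[OF cm] by blast
          obtain p where p: "p \<in> P" "\<forall>b. AE \<omega> in M. blinfun_apply (p \<omega>) b = blinfun_apply (q \<omega>) b"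
            using ex q(1) by blast
          have "(p, q) \<in> wstar_rel M scl" using p q(1) strong_imp_wstar[OF p(1)] by (simp add: wstar_rel_def)
          then have "W_class p = W_class q" using w.class_eq_iff[OF strong_imp_wstar[OF p(1)] q(1)] by blast
          then have "F = T (P_class p)" using q(2) T_P[OF p(1)] by simp
          then show "F \<in> T ` carrier ?S" using s.class_closed[OF p(1)] by blast
        qed
      qed
    qed
    have add: "T (X \<oplus>\<^bsub>?S\<^esub> Y) = T X \<oplus>\<^bsub>?F\<^esub> T Y" if XY: "X \<in> carrier ?S" "Y \<in> carrier ?S" for X Y
    proof -
      obtain p where p: "p \<in> P" "X = P_class p" using XY(1) by (rule s.carrierE)
      obtain p' where p': "p' \<in> P" "Y = P_class p'" using XY(2) by (rule s.carrierE)
      note W = strong_imp_wstar[OF p(1)] strong_imp_wstar[OF p'(1)]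
      show ?thesis
        unfolding p(2) p'(2) s.add_class[OF p(1) p'(1)] T_P[OF p(1)] T_P[OF p'(1)]
          T_P[OF s.add_S[OF p(1) p'(1)]] T_add[OF W, symmetric] w.add_class[OF W] ..
    qed
    have smult: "T (\<xi> \<odot>\<^bsub>?S\<^esub> X) = \<xi> \<odot>\<^bsub>?F\<^esub> T X" if \<xi>: "\<xi> \<in> carrier (L0_ring M)" and X: "X \<in> carrier ?S" for \<xi> X
    proof -
      obtain p where p: "p \<in> P" "X = P_class p" using X by (rule s.carrierE)
      obtain x where x: "x \<in> borel_measurable M" "\<xi> = L0_class M x" using \<xi> by (rule L0_carrierE)
      note W = strong_imp_wstar[OF p(1)]
      show ?thesis
        unfolding p(2) x(2) s.smult_class[OF x(1) p(1)] T_P[OF p(1)]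
          T_P[OF s.scl_S[OF x(1) p(1)]] T_smult[OF x(1) W, symmetric] w.smult_class[OF x(1) W] ..
    qed
    have norm: "rnorm ?F (T X) = rnorm ?S X" if X: "X \<in> carrier ?S" for X
    proof -
      obtain p where p: "p \<in> P" "X = P_class p" using X by (rule s.carrierE)
      note W = strong_imp_wstar[OF p(1)]
      show ?thesis
        unfolding p(2) T_P[OF p(1)] rnorm_T[OF W] s.rnorm_E[OF p(1)]
          L0_class_eq_iff[OF wstar_norm_measurable[OF W] rv_norm_measurable[OF p(1)]]
        by (rule wstar_norm_strong[OF p(1)])
    qed
    have "random_normed_module M ?F" using T_wstar_isomorphism[OF cm] by (simp add: rn_isomorphism_def)
    then show "rn_isomorphism M ?S ?F T"
      unfolding rn_isomorphism_def using s.random_normed bij add smult norm by blast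
  }
qed

end

section \<open>The Radon--Nikodym property\<close>

context prob_K_normed
begin

lemma strong_representative_imp_RNP:
  assumes cm: "complete_measure M"
    and ex: "\<And>q. q \<in> W \<Longrightarrow> \<exists>p\<in>P. \<forall>b. AE \<omega> in M. blinfun_apply (p \<omega>) b = blinfun_apply (q \<omega>) b"
  shows "radon_nikodym_property M (dual_space scl)"
  unfolding radon_nikodym_property_def
proof (intro allI impI)
  fix \<mu> :: "'w set \<Rightarrow> 'b \<Rightarrow>\<^sub>L 'k"
  assume \<mu>V: "\<mu> \<in> sets M \<rightarrow> dual_space scl" and \<mu>: "countably_additive_vm M \<mu>" "continuous_vm M \<mu>" "bounded_variation_vm M \<mu>"
  obtain u \<xi> where \<xi>: "integrable M \<xi>" and all: "\<forall>b. integrable M (u b) \<and>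
      (\<forall>A\<in>sets M. (\<integral>x\<in>A. u b x \<partial>M) = blinfun_apply (\<mu> A) b) \<and> (AE x in M. norm (u b x) \<le> \<xi> x * norm b)"
    using blinfun_vm_density[OF \<mu>] by (elim exE conjE) (rule that)
  have u: "integrable M (u b)" "A \<in> sets M \<Longrightarrow> (\<integral>x\<in>A. u b x \<partial>M) = blinfun_apply (\<mu> A) b"
    "AE x in M. norm (u b x) \<le> \<xi> x * norm b" for b A using all by auto
  have um: "u b \<in> borel_measurable M" for b using u(1) by (rule borel_measurable_integrable)
  have seti: "set_integrable M A (u b)" if "A \<in> sets M" for A b
    unfolding set_integrable_def by (rule integrable_mult_indicator[OF that u(1)])
  \<comment> \<open>Densities are unique a.e., so linearity of \<open>\<mu> A\<close> in
    \<open>b\<close> passes to \<open>u\<close>, with a null set for each choice of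
    arguments.\<close>
  have u_add: "AE x in M. u (b + c) x = u b x + u c x" for b c
  proof (rule AE_eq_of_set_integrals[OF u(1) Bochner_Integration.integrable_add[OF u(1) u(1)]])
    fix A assume A: "A \<in> sets M"
    show "(\<integral>x\<in>A. u (b + c) x \<partial>M) = (\<integral>x\<in>A. u b x + u c x \<partial>M)"
      by (simp only: set_integral_add(2)[OF seti[OF A] seti[OF A]] u(2)[OF A] blinfun.add_right)
  qed
  have u_scl: "AE x in M. u (scl a b) x = a * u b x" for a b
  proof (rule AE_eq_of_set_integrals[OF u(1) integrable_mult_right[OF u(1)]])
    fix A assume A: "A \<in> sets M"
    have "\<mu> A \<in> dual_space scl" using \<mu>V A by blast
    then show "(\<integral>x\<in>A. u (scl a b) x \<partial>M) = (\<integral>x\<in>A. a * u b x \<partial>M)"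
      by (simp only: set_integral_mult_right u(2)[OF A]) (simp add: dual_space_def)
  qed
  have \<xi>m: "\<xi> \<in> borel_measurable M" using \<xi> by (rule borel_measurable_integrable)
  obtain q where q: "q \<in> W" "\<forall>b. AE x in M. blinfun_apply (q x) b = u b x"
    using linear_selection[OF cm K_normed_space_axioms um u_add u_scl \<xi>m u(3)] by blast
  obtain p where p: "p \<in> P" "\<forall>b. AE x in M. blinfun_apply (p x) b = blinfun_apply (q x) b"
    using ex[OF q(1)] by blast
  have pu: "AE x in M. blinfun_apply (p x) b = u b x" for b
    using p(2)[rule_format, of b] q(2)[rule_format, of b] by eventually_elim simp
  \<comment> \<open>The bound is known a.e. for each vector; strong measurability of
    \<open>p\<close> lifts it to the operator norm, which yields integrability.\<close>
  have pn: "AE x in M. norm (p x) \<le> \<bar>\<xi> x\<bar>"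
  proof (rule strong_norm_AE_le[OF p(1)])
    fix b :: 'b assume b: "norm b \<le> 1"
    from pu[of b] u(3)[of b] show "AE x in M. norm (blinfun_apply (p x) b) \<le> \<bar>\<xi> x\<bar>"
    proof eventually_elim
      case (elim x)
      have "\<xi> x * norm b \<le> \<bar>\<xi> x\<bar> * norm b" by (intro mult_right_mono) auto
      also have "\<dots> \<le> \<bar>\<xi> x\<bar> * 1" using b by (intro mult_left_mono) auto
      finally show ?case using elim by simp
    qed
  qed
  have pint: "integrable M (\<lambda>x. norm (p x))"
    by (rule Bochner_Integration.integrable_bound[OF integrable_abs[OF \<xi>] rv_norm_measurable[OF p(1)]])
      (use pn in \<open>auto elim!: eventually_mono\<close>)
  show "\<exists>h\<in>space M \<rightarrow> dual_space scl. \<forall>A\<in>sets M. has_vector_integral M (\<lambda>\<omega>. indicator A \<omega> *\<^sub>R h \<omega>) (\<mu> A)"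
  proof (intro bexI ballI)
    show "p \<in> space M \<rightarrow> dual_space scl" using rvD[OF p(1)] by blast
    fix A assume A: "A \<in> sets M"
    show "has_vector_integral M (\<lambda>\<omega>. indicator A \<omega> *\<^sub>R p \<omega>) (\<mu> A)"
    proof (rule has_vector_integralI[OF finite_measure_axioms p(1) A pint])
      fix b
      have "(\<integral>x\<in>A. blinfun_apply (p x) b \<partial>M) = (\<integral>x\<in>A. u b x \<partial>M)"
        unfolding set_lebesgue_integral_def
      proof (rule integral_cong_AE)
        show "AE x in M. indicat_real A x *\<^sub>R blinfun_apply (p x) b = indicat_real A x *\<^sub>R u b x"
          using pu[of b] by eventually_elim simp
        show "(\<lambda>x. indicat_real A x *\<^sub>R blinfun_apply (p x) b) \<in> borel_measurable M"
          using wstarD(2)[OF strong_imp_wstar[OF p(1)], of b] A by measurable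
        show "(\<lambda>x. indicat_real A x *\<^sub>R u b x) \<in> borel_measurable M" using um A by measurable
      qed
      then show "(\<integral>x\<in>A. blinfun_apply (p x) b \<partial>M) = blinfun_apply (\<mu> A) b" using u(2)[OF A] by simp
    qed
  qed
qed

text \<open>Normalizing \<open>q\<close> by its norm gives the indefinite integral \<open>A \<mapsto> \<integral>\<^sub>A q / (1 + \<parallel>q\<parallel>)\<close>, a vector
  measure dominated by \<open>P\<close>.\<close>

lemma RNP_imp_strong_representative:
  assumes rnp: "radon_nikodym_property M (dual_space scl)" and q: "q \<in> W"
  shows "\<exists>p\<in>P. \<forall>b. AE \<omega> in M. blinfun_apply (p \<omega>) b = blinfun_apply (q \<omega>) b"
proof -
  \<comment> \<open>\<open>wstar_norm\<close> is nonnegative only a.e.; the absolute value makes the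
    divisor positive at every point.\<close>
  define d where "d \<omega> = 1 + \<bar>wstar_norm M q \<omega>\<bar>" for \<omega>
  have d0: "0 < d \<omega>" for \<omega> by (simp add: d_def add_pos_nonneg)
  have [measurable]: "wstar_norm M q \<in> borel_measurable M" by (rule wstar_norm_measurable[OF q])
  have dm [measurable]: "d \<in> borel_measurable M" unfolding d_def[abs_def] by measurable
  have [measurable]: "(\<lambda>\<omega>. blinfun_apply (q \<omega>) b) \<in> borel_measurable M" for b by (rule wstarD(2)[OF q])
  define r where "r b \<omega> = blinfun_apply (q \<omega>) b /\<^sub>R d \<omega>" for b \<omega>
  have rm [measurable]: "r b \<in> borel_measurable M" for b unfolding r_def[abs_def] by measurable
  have qb: "AE \<omega> in M. norm (blinfun_apply (q \<omega>) b) \<le> wstar_norm M q \<omega> * norm b" for b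
    by (rule pairing_bound[OF rv_const_UNIV wstar_norm_upper[OF q]])
  have rb: "AE \<omega> in M. norm (r b \<omega>) \<le> norm b" for b
    using qb[of b]
  proof eventually_elim
    case (elim \<omega>)
    have "wstar_norm M q \<omega> * norm b \<le> d \<omega> * norm b" by (intro mult_right_mono) (auto simp: d_def)
    then have "norm (blinfun_apply (q \<omega>) b) \<le> d \<omega> * norm b" using elim by linarith
    then show ?case using d0[of \<omega>] by (simp add: r_def field_simps)
  qed
  have rint: "integrable M (r b)" for b by (rule integrable_const_bound[OF rb rm])
  have seti: "set_integrable M A (r b)" if "A \<in> sets M" for A b
    unfolding set_integrable_def by (rule integrable_mult_indicator[OF that rint])
  define I where "I A b = (\<integral>\<omega>\<in>A. r b \<omega> \<partial>M)" for A b
  have I_norm: "norm (I A b) \<le> measure M A * norm b" if A: "A \<in> sets M" for A b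
  proof -
    have "norm (I A b) \<le> (\<integral>\<omega>. norm (indicat_real A \<omega> *\<^sub>R r b \<omega>) \<partial>M)"
      unfolding I_def set_lebesgue_integral_def by (rule integral_norm_bound)
    also have "\<dots> \<le> (\<integral>\<omega>. indicat_real A \<omega> * norm b \<partial>M)"
    proof (rule integral_mono_AE)
      show "integrable M (\<lambda>\<omega>. norm (indicat_real A \<omega> *\<^sub>R r b \<omega>))"
        by (rule integrable_norm[OF integrable_mult_indicator[OF A rint]])
      show "integrable M (\<lambda>\<omega>. indicat_real A \<omega> * norm b)"
        by (rule integrable_mult_left) (simp add: integrable_indicator_iff A less_top[symmetric])
      show "AE \<omega> in M. norm (indicat_real A \<omega> *\<^sub>R r b \<omega>) \<le> indicat_real A \<omega> * norm b"
        using rb[of b] by eventually_elim (simp add: indicator_def)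
    qed
    also have "\<dots> = measure M A * norm b" using A by simp
    finally show ?thesis .
  qed
  define \<mu> where "\<mu> A = (if A \<in> sets M then Blinfun (I A) else 0)" for A
  have bl: "bounded_linear (I A)" if A: "A \<in> sets M" for A
  proof (rule bounded_linear_intro)
    show "I A (b + c) = I A b + I A c" for b c
      unfolding I_def
      by (subst set_integral_add(2)[OF seti[OF A] seti[OF A], symmetric])
        (simp add: r_def[abs_def] blinfun.add_right scaleR_add_right)
    show "I A (t *\<^sub>R b) = t *\<^sub>R I A b" for t b
      unfolding I_def by (subst set_integral_scaleR_right[symmetric])
        (simp add: r_def[abs_def] blinfun.scaleR_right mult.commute)
    show "norm (I A b) \<le> norm b * measure M A" for b using I_norm[OF A] by (simp add: mult.commute)
  qed
  have \<mu>: "blinfun_apply (\<mu> A) b = I A b" if "A \<in> sets M" for A b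
    using that by (simp add: \<mu>_def bounded_linear_Blinfun_apply[OF bl])
  have \<mu>_norm: "norm (\<mu> A) \<le> measure M A" if A: "A \<in> sets M" for A
    by (rule norm_blinfun_bound) (use I_norm[OF A] \<mu>[OF A] in auto)
  have \<mu>_Un: "\<mu> (A \<union> B) = \<mu> A + \<mu> B" if A: "A \<in> sets M" and B: "B \<in> sets M" and AB: "A \<inter> B = {}" for A B
  proof (rule blinfun_eqI)
    fix b
    show "blinfun_apply (\<mu> (A \<union> B)) b = blinfun_apply (\<mu> A + \<mu> B) b"
      using set_integral_Un[OF AB seti[OF A, of b] seti[OF B, of b]]
      by (simp add: blinfun.add_left \<mu>[OF A] \<mu>[OF B] \<mu>[OF sets.Un[OF A B]] I_def)
  qed
  have \<mu>V: "\<mu> \<in> sets M \<rightarrow> dual_space scl"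
  proof
    fix A assume A: "A \<in> sets M"
    have "I A (scl a b) = a * I A b" for a b
    proof -
      have "I A (scl a b) = (\<integral>\<omega>\<in>A. a * r b \<omega> \<partial>M)"
        unfolding I_def
      proof (rule set_lebesgue_integral_cong[OF A], intro allI impI)
        fix \<omega> assume "\<omega> \<in> A"
        then have "q \<omega> \<in> dual_space scl" using wstarD(1)[OF q] A sets.sets_into_space by blast
        then show "r (scl a b) \<omega> = a * r b \<omega>" by (simp add: r_def dual_space_def)
      qed
      then show ?thesis by (simp add: I_def)
    qed
    then show "\<mu> A \<in> dual_space scl" by (simp add: dual_space_def \<mu>[OF A])
  qed
  have ca: "countably_additive_vm M \<mu>"
    unfolding countably_additive_vm_def
  proof (intro allI impI)
    fix A :: "nat \<Rightarrow> 'w set" assume A: "range A \<subseteq> sets M" "disjoint_family A"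
    have part: "\<mu> (\<Union>i<n. A i) = (\<Sum>i<n. \<mu> (A i))" for n
    proof (induction n)
      case 0
      have "norm (\<mu> {}) \<le> 0" using \<mu>_norm[of "{}"] by simp
      then show ?case by simp
    next
      case (Suc n)
      have "A i \<inter> A n = {}" if "i < n" for i
        using disjoint_family_onD[OF A(2), of i n] that by simp
      then have "(\<Union>i<n. A i) \<inter> A n = {}" by blast
      then have "\<mu> ((\<Union>i<n. A i) \<union> A n) = \<mu> (\<Union>i<n. A i) + \<mu> (A n)" using A(1) by (intro \<mu>_Un) auto
      moreover have "(\<Union>i<n. A i) \<union> A n = (\<Union>i<Suc n. A i)" by (auto simp: lessThan_Suc)
      ultimately show ?case using Suc by simp
    qed
    let ?U = "\<Union>n. A n"
    \<comment> \<open>The remainder of the series is \<open>\<mu>\<close> of the tail set, bounded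
      by its probability, so norm convergence follows from countable additivity of
      \<open>M\<close>.\<close>
    have le: "norm ((\<Sum>i<n. \<mu> (A i)) - \<mu> ?U) \<le> measure M ?U - (\<Sum>i<n. measure M (A i))" for n
    proof -
      have sets: "?U \<in> sets M" "(\<Union>i<n. A i) \<in> sets M" using A(1) by auto
      have U: "?U = (\<Union>i<n. A i) \<union> (?U - (\<Union>i<n. A i))" by auto
      have "\<mu> ?U = \<mu> (\<Union>i<n. A i) + \<mu> (?U - (\<Union>i<n. A i))"
        by (subst U, rule \<mu>_Un) (use sets in auto)
      then have "norm ((\<Sum>i<n. \<mu> (A i)) - \<mu> ?U) = norm (\<mu> (?U - (\<Union>i<n. A i)))"
        by (simp add: part)
      also have "\<dots> \<le> measure M (?U - (\<Union>i<n. A i))" by (rule \<mu>_norm) (use sets in auto)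
      also have "\<dots> = measure M ?U - measure M (\<Union>i<n. A i)"
        by (rule finite_measure_Diff) (use sets in auto)
      also have "measure M (\<Union>i<n. A i) = (\<Sum>i<n. measure M (A i))"
        by (rule finite_measure_finite_Union) (use A in \<open>auto simp: disjoint_family_on_def\<close>)
      finally show ?thesis .
    qed
    have "(\<lambda>n. \<Sum>i<n. measure M (A i)) \<longlonglongrightarrow> measure M ?U"
      using finite_measure_UNION[OF A] by (simp add: sums_def)
    then have "(\<lambda>n. measure M ?U - (\<Sum>i<n. measure M (A i))) \<longlonglongrightarrow> measure M ?U - measure M ?U"
      by (intro tendsto_intros)
    then have "(\<lambda>n. measure M ?U - (\<Sum>i<n. measure M (A i))) \<longlonglongrightarrow> 0" by simp
    then have "(\<lambda>n. (\<Sum>i<n. \<mu> (A i)) - \<mu> ?U) \<longlonglongrightarrow> 0"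
      by (rule Lim_null_comparison[rotated]) (rule always_eventually, rule allI, rule le)
    then show "(\<lambda>n. \<mu> (A n)) sums \<mu> ?U" unfolding sums_def by (rule LIM_zero_cancel)
  qed
  have cont: "continuous_vm M \<mu>"
    unfolding continuous_vm_def using \<mu>_norm by (meson order_le_less_trans)
  have bv: "bounded_variation_vm M \<mu>"
    unfolding bounded_variation_vm_def
  proof (intro exI[of _ 1] allI impI)
    fix \<pi> assume p: "finite \<pi>" "\<pi> \<subseteq> sets M" "partition_on (space M) \<pi>"
    have "(\<Sum>A\<in>\<pi>. norm (\<mu> A)) \<le> (\<Sum>A\<in>\<pi>. measure M A)" using p(2) \<mu>_norm by (intro sum_mono) auto
    also have "\<dots> = measure M (\<Union>A\<in>\<pi>. A)"
      by (rule finite_measure_finite_Union[symmetric])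
        (use p partition_onD2[OF p(3)] in \<open>auto simp: disjoint_family_on_def disjoint_def\<close>)
    also have "\<dots> \<le> 1" by (rule prob_le_1)
    finally show "(\<Sum>A\<in>\<pi>. norm (\<mu> A)) \<le> 1" .
  qed
  obtain h where h: "h \<in> space M \<rightarrow> dual_space scl"
    "\<And>A. A \<in> sets M \<Longrightarrow> has_vector_integral M (\<lambda>\<omega>. indicator A \<omega> *\<^sub>R h \<omega>) (\<mu> A)"
    using rnp \<mu>V ca cont bv unfolding radon_nikodym_property_def by blast
  \<comment> \<open>The integral property for \<open>A = space M\<close> is the source of the strong
    measurability of \<open>h\<close>.\<close>
  have hG: "(\<lambda>\<omega>. indicator (space M) \<omega> *\<^sub>R h \<omega>) \<in> random_variables M UNIV"
    using h(2)[OF sets.top] by (simp add: has_vector_integral_def)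
  \<comment> \<open>The simple approximations obtained so far may leave the dual space;
    \<open>rv_restrict\<close> moves them into it.\<close>
  have hP: "(\<lambda>\<omega>. indicat_real (space M) \<omega> *\<^sub>R h \<omega>) \<in> P"
    by (rule rv_restrict[OF hG]) (use h(1) dual_space_0 in auto)
  \<comment> \<open>Multiplication by \<open>d\<close> undoes the normalization and keeps strong
    measurability, though integrability may be lost.\<close>
  define p where "p \<omega> = dual_scl (of_real (d \<omega>)) (indicat_real (space M) \<omega> *\<^sub>R h \<omega>)" for \<omega>
  have pP: "p \<in> P"
    unfolding p_def[abs_def]
    by (rule K_normed_space.rv_scl[OF K_normed_space_dual _ hP dual_space_scl]) measurable
  \<comment> \<open>Evaluating the vector integrals at \<open>b\<close> gives the set integrals of
    \<open>r b\<close>, and these determine the function a.e.\<close>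
  have hr: "AE \<omega> in M. blinfun_apply (h \<omega>) b = r b \<omega>" for b
  proof (rule AE_eq_of_set_integrals[OF _ rint])
    have i: "has_bochner_integral M (\<lambda>\<omega>. indicat_real A \<omega> *\<^sub>R blinfun_apply (h \<omega>) b) (I A b)"
      if "A \<in> sets M" for A
      using has_vector_integral_apply[OF h(2)[OF that], of b] by (simp add: blinfun.scaleR_left \<mu>[OF that])
    show "integrable M (\<lambda>\<omega>. blinfun_apply (h \<omega>) b)"
      using integrable.intros[OF i[OF sets.top]] by (rule Bochner_Integration.integrable_cong[THEN iffD1, rotated 2]) auto
    show "(\<integral>\<omega>\<in>A. blinfun_apply (h \<omega>) b \<partial>M) = (\<integral>\<omega>\<in>A. r b \<omega> \<partial>M)" if "A \<in> sets M" for A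
      using has_bochner_integral_integral_eq[OF i[OF that]] by (simp add: set_lebesgue_integral_def I_def)
  qed
  have "AE \<omega> in M. blinfun_apply (p \<omega>) b = blinfun_apply (q \<omega>) b" for b
    using hr[of b] AE_space
  proof eventually_elim
    case (elim \<omega>)
    then have "blinfun_apply (p \<omega>) b = d \<omega> *\<^sub>R r b \<omega>" by (simp add: p_def scaleR_conv_of_real)
    then show ?case using d0[of \<omega>] by (simp add: r_def)
  qed
  then show ?thesis using pP by blast
qed

end

theorem theorem4p4:
  fixes M :: "'w measure"
    and scl :: "'k::real_or_complex \<Rightarrow> 'b::real_normed_vector \<Rightarrow> 'b"
  assumes "prob_space M" and "complete_measure M"
    and "K_normed_space scl"
  shows "rn_isomorphism M (L0_wstar M scl) (random_conjugate M (L0_space M scl UNIV))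
      (canonical_map M scl) \<and>
    (rn_isomorphism M (L0_space M dual_scl (dual_space scl))
      (random_conjugate M (L0_space M scl UNIV)) (canonical_map M scl)
      \<longleftrightarrow> radon_nikodym_property M (dual_space scl))"
proof -
  interpret prob_K_normed M scl
    using assms(1,3) by (rule prob_K_normed.intro)
  show ?thesis
    using T_wstar_isomorphism[OF assms(2)] T_strong_isomorphism_iff[OF assms(2)]
      strong_representative_imp_RNP[OF assms(2)] RNP_imp_strong_representative by blast
qed

end
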